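(* There exist inductive families of finite sets $X,Y,A$ and $B$ for which the set $\mathcal C_{\rm qs}(X,Y,A,B)$ is not closed in the BW topology.
   Context: For $d\in\mathbb N$, $[d]=\{1,\dots,d\}$. An inductive family of finite sets is a sequence $X=(X_n)_{n\in\mathbb N}$ of non-empty finite sets with $X_{n+1}=X_n\times[d_n^X]$ for some $d_n^X\in\mathbb N$. Set $d_0^X=|X_1|$, $\Omega_X=\prod_{i=0}^\infty[d_i^X]$ (product topology), and let $\mu_X$ be the product of the uniform probability measures; $L^1(\Omega_X),L^\infty(\Omega_X)$ are with respect to $\mu_X$. For a Hilbert space $H$ and $g\in L^1(\Omega_X)$, $L_g:L^\infty(\Omega_X)\bar\otimes\mathcal B(H)\to\mathcal B(H)$ is the slice map ($L_g(f\otimes T)=(\int fg\,d\mu_X)T$). $\mathcal C_{\rm qs}(X,Y,A,B)$ is the set of unital completely positive maps $\Gamma:C(\Omega_A)\otimes C(\Omega_B)\to L^\infty(\Omega_X)\bar\otimes L^\infty(\Omega_Y)$ for which there are separable Hilbert spaces $H,K$, a unit vector $\xi\in H\otimes K$ and unital completely positive maps $\Phi:C(\Omega_A)\to L^\infty(\Omega_X)\bar\otimes\mathcal B(H)$, $\Psi:C(\Omega_B)\to L^\infty(\Omega_Y)\bar\otimes\mathcal B(K)$ with $\langle g_1\otimes g_2,\Gamma(f_1\otimes f_2)\rangle=\langle(L_{g_1}(\Phi(f_1))\otimes L_{g_2}(\Psi(f_2)))\xi,\xi\rangle$ for all $f_1\in C(\Omega_A)$, $f_2\in C(\Omega_B)$,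 $g_1\in L^1(\Omega_X)$, $g_2\in L^1(\Omega_Y)$, where $\langle g,f\rangle=\int gf\,d(\mu_X\times\mu_Y)$. The BW topology on the set of unital completely positive maps $C(\Omega_A)\otimes C(\Omega_B)\to L^\infty(\Omega_X)\bar\otimes L^\infty(\Omega_Y)$ is the point-weak* topology: $\Gamma_\lambda\to\Gamma$ iff $\langle g,\Gamma_\lambda(h)\rangle\to\langle g,\Gamma(h)\rangle$ for all $h\in C(\Omega_A)\otimes C(\Omega_B)$ and $g\in L^1(\Omega_X\times\Omega_Y)$. *)

theory Defs
  imports "HOL-Probability.Probability" "HOL-Algebra.Module"
begin

section \<open>Complex vector spaces with carrier\<close>

definition complex_ring :: "complex ring" where
  "complex_ring = \<lparr>carrier = UNIV, mult = (*), one = 1, zero = 0, add = (+)\<rparr>"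

definition linear_map ::
  "(complex, 'a, 'y) module_scheme \<Rightarrow> (complex, 'b, 'z) module_scheme \<Rightarrow> ('a \<Rightarrow> 'b) \<Rightarrow> bool" where
  "linear_map V W f \<longleftrightarrow> f \<in> carrier V \<rightarrow> carrier W \<and>
     (\<forall>x\<in>carrier V. \<forall>y\<in>carrier V. f (x \<oplus>\<^bsub>V\<^esub> y) = f x \<oplus>\<^bsub>W\<^esub> f y) \<and>
     (\<forall>c. \<forall>x\<in>carrier V. f (c \<odot>\<^bsub>V\<^esub> x) = c \<odot>\<^bsub>W\<^esub> f x)"

definition linear_span :: "(complex, 'a, 'z) module_scheme \<Rightarrow> 'a set \<Rightarrow> 'a set" where
  "linear_span V S = \<Inter> {U. submodule U complex_ring V \<and> S \<subseteq> U}"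

section \<open>Hilbert spaces\<close>

text \<open>Inner products are linear in the first variable. The fields \<open>mult\<close> and \<open>one\<close> inherited from
  \<open>module\<close> play no role for a Hilbert space.\<close>

record 'h inner_module = "(complex, 'h) module" +
  ip :: "'h \<Rightarrow> 'h \<Rightarrow> complex"

definition hnorm :: "'h inner_module \<Rightarrow> 'h \<Rightarrow> real" where
  "hnorm H x = sqrt (Re (ip H x x))"

text \<open>The locale \<open>Metric_space\<close> demands symmetry and nonnegativity of the distance also outside of
  the carrier, hence the conditional.\<close>

definition hdist :: "'h inner_module \<Rightarrow> 'h \<Rightarrow> 'h \<Rightarrow> real" where
  "hdist H x y = (if x \<in> carrier H \<and> y \<in> carrier H then hnorm H (x \<ominus>\<^bsub>H\<^esub> y) else 0)"

definition norm_topology :: "'h inner_module \<Rightarrow> 'h topology" where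
  "norm_topology H = Metric_space.mtopology (carrier H) (hdist H)"

locale hilbert_space = module complex_ring H for H :: "'h inner_module" +
  assumes ip_add: "\<lbrakk>x \<in> carrier H; y \<in> carrier H; z \<in> carrier H\<rbrakk>
      \<Longrightarrow> ip H (x \<oplus>\<^bsub>H\<^esub> y) z = ip H x z + ip H y z"
    and ip_smult: "\<lbrakk>x \<in> carrier H; y \<in> carrier H\<rbrakk> \<Longrightarrow> ip H (c \<odot>\<^bsub>H\<^esub> x) y = c * ip H x y"
    and ip_cnj: "\<lbrakk>x \<in> carrier H; y \<in> carrier H\<rbrakk> \<Longrightarrow> ip H y x = cnj (ip H x y)"
    and ip_nonneg: "x \<in> carrier H \<Longrightarrow> 0 \<le> Re (ip H x x)"
    and ip_definite: "\<lbrakk>x \<in> carrier H; ip H x x = 0\<rbrakk> \<Longrightarrow> x = \<zero>\<^bsub>H\<^esub>"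
    and complete: "Metric_space.mcomplete (carrier H) (hdist H)"

definition separable_hilbert_space :: "'h inner_module \<Rightarrow> bool" where
  "separable_hilbert_space H \<longleftrightarrow> hilbert_space H \<and> separable_space (norm_topology H)"

text \<open>\<open>W\<close> together with the bilinear map \<open>t\<close> is a Hilbert space tensor product of \<open>H\<close> and \<open>K\<close>;
  \<open>t h k\<close> is the elementary tensor of \<open>h\<close> and \<open>k\<close>. These conditions determine \<open>(W, t)\<close> up to a
  unique unitary intertwining the elementary tensors.\<close>

definition hilbert_tensor ::
  "'h inner_module \<Rightarrow> 'k inner_module \<Rightarrow> 'w inner_module \<Rightarrow> ('h \<Rightarrow> 'k \<Rightarrow> 'w) \<Rightarrow> bool" where
  "hilbert_tensor H K W t \<longleftrightarrow> hilbert_space W \<and>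
     (\<forall>k\<in>carrier K. linear_map H W (\<lambda>h. t h k)) \<and>
     (\<forall>h\<in>carrier H. linear_map K W (\<lambda>k. t h k)) \<and>
     (\<forall>h\<in>carrier H. \<forall>k\<in>carrier K. \<forall>h'\<in>carrier H. \<forall>k'\<in>carrier K.
        ip W (t h k) (t h' k') = ip H h h' * ip K k k') \<and>
     norm_topology W closure_of linear_span W {t h k | h k. h \<in> carrier H \<and> k \<in> carrier K}
       = carrier W"

section \<open>Matrix ordered spaces and unital completely positive maps\<close>

text \<open>\<open>mpos V n a\<close>: the \<open>n \<times> n\<close> matrix \<open>(a i j)\<close> for \<open>i, j < n\<close> is positive in \<open>M\<^sub>n(V)\<close>. The unit is
  the field \<open>one\<close>.\<close>

record 'a matrix_ordered = "(complex, 'a) module" +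
  mpos :: "nat \<Rightarrow> (nat \<Rightarrow> nat \<Rightarrow> 'a) \<Rightarrow> bool"

definition ucp :: "'a matrix_ordered \<Rightarrow> 'b matrix_ordered \<Rightarrow> ('a \<Rightarrow> 'b) \<Rightarrow> bool" where
  "ucp V W \<Phi> \<longleftrightarrow> linear_map V W \<Phi> \<and> \<Phi> \<one>\<^bsub>V\<^esub> = \<one>\<^bsub>W\<^esub> \<and>
     (\<forall>n a. (\<forall>i<n. \<forall>j<n. a i j \<in> carrier V) \<and> mpos V n a \<longrightarrow> mpos W n (\<lambda>i j. \<Phi> (a i j)))"

definition psd :: "nat \<Rightarrow> (nat \<Rightarrow> nat \<Rightarrow> complex) \<Rightarrow> bool" where
  "psd n A \<longleftrightarrow> (\<forall>c. (\<Sum>i<n. \<Sum>j<n. cnj (c i) * A i j * c j) \<in> \<real>\<^sub>\<ge>\<^sub>0)"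

subsection \<open>Continuous functions\<close>

definition cont_fun :: "'x topology \<Rightarrow> ('x \<Rightarrow> complex) matrix_ordered" where
  "cont_fun T = \<lparr>carrier = {f \<in> extensional (topspace T). continuous_map T euclidean f},
     mult = (\<lambda>f g. \<lambda>x\<in>topspace T. f x * g x), one = (\<lambda>x\<in>topspace T. 1),
     zero = (\<lambda>x\<in>topspace T. 0), add = (\<lambda>f g. \<lambda>x\<in>topspace T. f x + g x),
     smult = (\<lambda>c f. \<lambda>x\<in>topspace T. c * f x),
     mpos = (\<lambda>n a. \<forall>x\<in>topspace T. psd n (\<lambda>i j. a i j x))\<rparr>"

subsection \<open>Function spaces of a measure\<close>

definition ae_class :: "'x measure \<Rightarrow> ('x \<Rightarrow> complex) \<Rightarrow> ('x \<Rightarrow> complex) set" where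
  "ae_class M f = {g \<in> borel_measurable M. AE x in M. g x = f x}"

definition rep :: "('x \<Rightarrow> complex) set \<Rightarrow> 'x \<Rightarrow> complex" where
  "rep u = (SOME f. f \<in> u)"

definition ess_bounded :: "'x measure \<Rightarrow> ('x \<Rightarrow> complex) set" where
  "ess_bounded M = {f \<in> borel_measurable M. \<exists>C. AE x in M. norm (f x) \<le> C}"

definition Linfty :: "'x measure \<Rightarrow> ('x \<Rightarrow> complex) set matrix_ordered" where
  "Linfty M = \<lparr>carrier = ae_class M ` ess_bounded M,
     mult = (\<lambda>u v. ae_class M (\<lambda>x. rep u x * rep v x)), one = ae_class M (\<lambda>x. 1),
     zero = ae_class M (\<lambda>x. 0), add = (\<lambda>u v. ae_class M (\<lambda>x. rep u x + rep v x)),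
     smult = (\<lambda>c u. ae_class M (\<lambda>x. c * rep u x)),
     mpos = (\<lambda>n a. AE x in M. psd n (\<lambda>i j. rep (a i j) x))\<rparr>"

definition pairing :: "'x measure \<Rightarrow> ('x \<Rightarrow> complex) \<Rightarrow> ('x \<Rightarrow> complex) set \<Rightarrow> complex" where
  "pairing M g u = (LINT x|M. g x * rep u x)"

definition L2 :: "'x measure \<Rightarrow> ('x \<Rightarrow> complex) set inner_module" where
  "L2 M = \<lparr>carrier = ae_class M ` {f \<in> borel_measurable M. integrable M (\<lambda>x. (norm (f x))\<^sup>2)},
     mult = undefined, one = undefined,
     zero = ae_class M (\<lambda>x. 0), add = (\<lambda>u v. ae_class M (\<lambda>x. rep u x + rep v x)),
     smult = (\<lambda>c u. ae_class M (\<lambda>x. c * rep u x)),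
     ip = (\<lambda>u v. LINT x|M. rep u x * cnj (rep v x))\<rparr>"

definition mult_op :: "'x measure \<Rightarrow> ('x \<Rightarrow> complex) \<Rightarrow> ('x \<Rightarrow> complex) set \<Rightarrow> ('x \<Rightarrow> complex) set" where
  "mult_op M f = (\<lambda>u\<in>carrier (L2 M). ae_class M (\<lambda>x. f x * rep u x))"

subsection \<open>Bounded operators\<close>

definition bounded_op :: "'h inner_module \<Rightarrow> ('h \<Rightarrow> 'h) \<Rightarrow> bool" where
  "bounded_op H T \<longleftrightarrow> T \<in> extensional (carrier H) \<and> linear_map H H T \<and>
     (\<exists>C. \<forall>x\<in>carrier H. hnorm H (T x) \<le> C * hnorm H x)"

definition bounded_ops :: "'h inner_module \<Rightarrow> ('h \<Rightarrow> 'h) matrix_ordered" where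
  "bounded_ops H = \<lparr>carrier = {T. bounded_op H T},
     mult = (\<lambda>S T. \<lambda>x\<in>carrier H. S (T x)), one = (\<lambda>x\<in>carrier H. x),
     zero = (\<lambda>x\<in>carrier H. \<zero>\<^bsub>H\<^esub>), add = (\<lambda>S T. \<lambda>x\<in>carrier H. S x \<oplus>\<^bsub>H\<^esub> T x),
     smult = (\<lambda>c T. \<lambda>x\<in>carrier H. c \<odot>\<^bsub>H\<^esub> T x),
     mpos = (\<lambda>n a. \<forall>\<xi>. (\<forall>i<n. \<xi> i \<in> carrier H) \<longrightarrow>
       (\<Sum>i<n. \<Sum>j<n. ip H (a i j (\<xi> j)) (\<xi> i)) \<in> \<real>\<^sub>\<ge>\<^sub>0)\<rparr>"

definition tensor_op :: "'h inner_module \<Rightarrow> 'k inner_module \<Rightarrow> 'w inner_module \<Rightarrow> ('h \<Rightarrow> 'k \<Rightarrow> 'w)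
    \<Rightarrow> ('h \<Rightarrow> 'h) \<Rightarrow> ('k \<Rightarrow> 'k) \<Rightarrow> 'w \<Rightarrow> 'w" where
  "tensor_op H K W t S T = (THE R. bounded_op W R \<and>
     (\<forall>h\<in>carrier H. \<forall>k\<in>carrier K. R (t h k) = t (S h) (T k)))"

text \<open>The ultraweak topology is the weak* topology of \<open>bounded_ops H\<close> as the dual of the trace class: the
  normal functionals are \<open>T \<mapsto> \<Sum>n. \<langle>T \<xi>\<^sub>n, \<eta>\<^sub>n\<rangle>\<close> for square summable \<open>\<xi>\<close>, \<open>\<eta>\<close>.\<close>

definition square_summable :: "'h inner_module \<Rightarrow> (nat \<Rightarrow> 'h) set" where
  "square_summable H = {\<xi>. range \<xi> \<subseteq> carrier H \<and> summable (\<lambda>n. (hnorm H (\<xi> n))\<^sup>2)}"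

definition ultraweak :: "'h inner_module \<Rightarrow> ('h \<Rightarrow> 'h) topology" where
  "ultraweak H = pullback_topology (carrier (bounded_ops H))
     (\<lambda>T. \<lambda>(\<xi>, \<eta>)\<in>square_summable H \<times> square_summable H. \<Sum>n. ip H (T (\<xi> n)) (\<eta> n))
     (product_topology (\<lambda>_. euclidean) (square_summable H \<times> square_summable H))"

text \<open>The von Neumann algebra tensor product of \<open>L\<^sup>\<infinity>(M)\<close> and \<open>B(H)\<close>: the weak* closure of the
  algebraic tensor product in \<open>B(L\<^sup>2(M) \<otimes> H)\<close>, where \<open>L\<^sup>\<infinity>(M)\<close> acts by multiplication and \<open>(W, t)\<close>
  realizes \<open>L\<^sup>2(M) \<otimes> H\<close>.\<close>

definition vN_tensor :: "'x measure \<Rightarrow> 'h inner_module \<Rightarrow> 'w inner_module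
    \<Rightarrow> (('x \<Rightarrow> complex) set \<Rightarrow> 'h \<Rightarrow> 'w) \<Rightarrow> ('w \<Rightarrow> 'w) matrix_ordered" where
  "vN_tensor M H W t = (bounded_ops W)\<lparr>carrier := ultraweak W closure_of linear_span (bounded_ops W)
     {tensor_op (L2 M) H W t (mult_op M f) T | f T. f \<in> ess_bounded M \<and> T \<in> carrier (bounded_ops H)}\<rparr>"

text \<open>The slice map of \<open>g \<in> L\<^sup>1(M)\<close> is the unique weak* continuous linear map taking
  \<open>f \<otimes> T\<close> to \<open>(\<integral> f g) T\<close>.\<close>

definition slice_map :: "'x measure \<Rightarrow> 'h inner_module \<Rightarrow> 'w inner_module
    \<Rightarrow> (('x \<Rightarrow> complex) set \<Rightarrow> 'h \<Rightarrow> 'w) \<Rightarrow> ('x \<Rightarrow> complex) \<Rightarrow> ('w \<Rightarrow> 'w) \<Rightarrow> ('h \<Rightarrow> 'h)" where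
  "slice_map M H W t g = (THE L. L \<in> extensional (carrier (vN_tensor M H W t)) \<and>
     linear_map (vN_tensor M H W t) (bounded_ops H) L \<and>
     continuous_map (subtopology (ultraweak W) (carrier (vN_tensor M H W t))) (ultraweak H) L \<and>
     (\<forall>f\<in>ess_bounded M. \<forall>T\<in>carrier (bounded_ops H).
        L (tensor_op (L2 M) H W t (mult_op M f) T) = (LINT x|M. f x * g x) \<odot>\<^bsub>bounded_ops H\<^esub> T))"

section \<open>Inductive families of finite sets\<close>

text \<open>The sets \<open>X\<^sub>n\<close> consist of iterated pairs, so a type closed under pairing with natural numbers is
  needed; \<open>X\<^sub>1\<close> may be any non-empty finite set. Indices start at \<open>1\<close> and \<open>X 0\<close> is irrelevant.\<close>

datatype point = Atom nat | Ext point nat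

type_synonym seq = "nat \<Rightarrow> nat"

type_synonym family = "nat \<Rightarrow> point set"

definition times_upto :: "point set \<Rightarrow> nat \<Rightarrow> point set" where
  "times_upto S d = (\<lambda>(x, k). Ext x k) ` (S \<times> {1..d})"

definition inductive_family :: "family \<Rightarrow> bool" where
  "inductive_family X \<longleftrightarrow> (\<forall>n\<ge>1. finite (X n) \<and> X n \<noteq> {} \<and> (\<exists>d. X (Suc n) = times_upto (X n) d))"

definition mult_seq :: "family \<Rightarrow> nat \<Rightarrow> nat" where
  "mult_seq X n = (if n = 0 then card (X 1) else (THE d. X (Suc n) = times_upto (X n) d))"

definition Omega :: "family \<Rightarrow> seq topology" where
  "Omega X = product_topology (\<lambda>i. discrete_topology {1..mult_seq X i}) UNIV"

definition mu :: "family \<Rightarrow> seq measure" where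
  "mu X = PiM UNIV (\<lambda>i. uniform_count_measure {1..mult_seq X i})"

section \<open>Quantum spatial correlations and the BW topology\<close>

text \<open>\<open>C(\<Omega>\<^sub>A) \<otimes> C(\<Omega>\<^sub>B)\<close> is \<open>C(\<Omega>\<^sub>A \<times> \<Omega>\<^sub>B)\<close>, and the von Neumann algebra tensor product of
  \<open>L\<^sup>\<infinity>(\<Omega>\<^sub>X)\<close> and \<open>L\<^sup>\<infinity>(\<Omega>\<^sub>Y)\<close> is \<open>L\<^sup>\<infinity>(\<Omega>\<^sub>X \<times> \<Omega>\<^sub>Y)\<close>.\<close>

definition ucp_maps :: "family \<Rightarrow> family \<Rightarrow> family \<Rightarrow> family
    \<Rightarrow> ((seq \<times> seq \<Rightarrow> complex) \<Rightarrow> (seq \<times> seq \<Rightarrow> complex) set) set" where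
  "ucp_maps X Y A B =
     {\<Gamma> \<in> extensional (carrier (cont_fun (prod_topology (Omega A) (Omega B)))).
       ucp (cont_fun (prod_topology (Omega A) (Omega B))) (Linfty (mu X \<Otimes>\<^sub>M mu Y)) \<Gamma>}"

definition BW_topology :: "family \<Rightarrow> family \<Rightarrow> family \<Rightarrow> family
    \<Rightarrow> ((seq \<times> seq \<Rightarrow> complex) \<Rightarrow> (seq \<times> seq \<Rightarrow> complex) set) topology" where
  "BW_topology X Y A B =
     (let I = carrier (cont_fun (prod_topology (Omega A) (Omega B)))
                \<times> {g. integrable (mu X \<Otimes>\<^sub>M mu Y) g}
      in pullback_topology (ucp_maps X Y A B)
           (\<lambda>\<Gamma>. \<lambda>(h, g)\<in>I. pairing (mu X \<Otimes>\<^sub>M mu Y) g (\<Gamma> h))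
           (product_topology (\<lambda>_. euclidean) I))"

text \<open>Every separable Hilbert space has at most the cardinality of the continuum, so up to unitary
  equivalence its carrier is a subset of the following type; the vector space operations and the
  inner product on that carrier are arbitrary. The same applies to the tensor products below, which
  are separable too; the choice of their realizations is immaterial.\<close>

type_synonym universe = "nat \<Rightarrow> complex"

definition C_qs :: "family \<Rightarrow> family \<Rightarrow> family \<Rightarrow> family
    \<Rightarrow> ((seq \<times> seq \<Rightarrow> complex) \<Rightarrow> (seq \<times> seq \<Rightarrow> complex) set) set" where
  "C_qs X Y A B = {\<Gamma> \<in> ucp_maps X Y A B.
     \<exists>(H :: universe inner_module) (K :: universe inner_module)
        (HK :: universe inner_module) t (XH :: universe inner_module) t\<^sub>X
        (YK :: universe inner_module) t\<^sub>Y \<xi> \<Phi> \<Psi>.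
       separable_hilbert_space H \<and> separable_hilbert_space K \<and>
       hilbert_tensor H K HK t \<and>
       hilbert_tensor (L2 (mu X)) H XH t\<^sub>X \<and> hilbert_tensor (L2 (mu Y)) K YK t\<^sub>Y \<and>
       \<xi> \<in> carrier HK \<and> hnorm HK \<xi> = 1 \<and>
       ucp (cont_fun (Omega A)) (vN_tensor (mu X) H XH t\<^sub>X) \<Phi> \<and>
       ucp (cont_fun (Omega B)) (vN_tensor (mu Y) K YK t\<^sub>Y) \<Psi> \<and>
       (\<forall>f\<^sub>1\<in>carrier (cont_fun (Omega A)). \<forall>f\<^sub>2\<in>carrier (cont_fun (Omega B)).
        \<forall>g\<^sub>1 g\<^sub>2. integrable (mu X) g\<^sub>1 \<and> integrable (mu Y) g\<^sub>2 \<longrightarrow>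
          pairing (mu X \<Otimes>\<^sub>M mu Y) (\<lambda>(x, y). g\<^sub>1 x * g\<^sub>2 y)
            (\<Gamma> (\<lambda>(a, b)\<in>topspace (prod_topology (Omega A) (Omega B)). f\<^sub>1 a * f\<^sub>2 b))
          = ip HK (tensor_op H K HK t (slice_map (mu X) H XH t\<^sub>X g\<^sub>1 (\<Phi> f\<^sub>1))
                                      (slice_map (mu Y) K YK t\<^sub>Y g\<^sub>2 (\<Psi> f\<^sub>2)) \<xi>) \<xi>)}"

lemma topspace_BW_topology: "topspace (BW_topology X Y A B) = ucp_maps X Y A B"
  by (auto simp: BW_topology_def Let_def topspace_pullback_topology)

lemma C_qs_subset: "C_qs X Y A B \<subseteq> topspace (BW_topology X Y A B)"
  by (auto simp: topspace_BW_topology C_qs_def)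

end

theory Submission
  imports Defs
begin

text \<open>
  Correlations over one-point question spaces already fail to be closed, so the infinite answer
  spaces are to blame rather than a subtle finite game. Let both question spaces be points and both
  answer spaces be the Cantor set. A correlation is then a probability measure on the product of
  two Cantor sets, and it is quantum spatial if it arises from one measurement on each tensor factor
  of a single vector \<open>\<xi>\<close>. Consider the law of \<open>(a, a)\<close> with \<open>a\<close> uniform in the Cantor set.

  This law is a limit of spatial ones. If only the first \<open>n\<close> digits of \<open>a\<close> are random, the law is a
  finite mixture of point masses on the diagonal, and a maximally entangled state on a
  \<open>2\<^sup>n\<close>-dimensional space produces it (\<open>atomic_correlation_spatial\<close>). Continuous functions on a compact
  space cannot distinguish the laws in the limit (\<open>diagonal_integral\<close>).

  It is not spatial itself. Splitting the Cantor set into \<open>2\<^sup>n\<close> cylinders, a spatial realization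
  would measure \<open>\<xi>\<close> on both sides with \<open>2\<^sup>n\<close> equally likely outcomes and perfect correlation, for
  every \<open>n\<close>. But \<open>\<xi>\<close> is approximated in norm by a vector of finite tensor rank, and finite rank only
  supports boundedly many such outcomes (\<open>uniform_correlation_bound\<close>).

  The objects of the definition are determined only up to their universal properties, so these
  have to be unfolded first. Operators \<open>S \<otimes> T\<close> on an abstract Hilbert space tensor product are obtained from
  Schur's product theorem (\<open>psd_entrywise_sum\<close>) and extension by density (\<open>graph_extension\<close>), and the slice
  maps over a point are computed in \<open>slice_map_eq\<close>.
\<close>

section \<open>Elementary geometry of Hilbert spaces\<close>

lemma complex_ring_simps [simp]:
  "carrier complex_ring = UNIV" "mult complex_ring = (*)" "one complex_ring = 1"
  "zero complex_ring = 0" "add complex_ring = (+)"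
  by (simp_all add: complex_ring_def)

lemma cring_complex_ring: "cring complex_ring"
proof (rule cringI)
  show "abelian_group complex_ring"
  proof (rule abelian_groupI)
    fix x assume "x \<in> carrier complex_ring"
    show "\<exists>y\<in>carrier complex_ring. y \<oplus>\<^bsub>complex_ring\<^esub> x = \<zero>\<^bsub>complex_ring\<^esub>"
      by (rule bexI[of _ "- x"]) auto
  qed (auto simp: algebra_simps)
  show "comm_monoid complex_ring"
    by (rule comm_monoidI) (auto simp: algebra_simps)
qed (auto simp: algebra_simps)

definition hlim :: "'h inner_module \<Rightarrow> (nat \<Rightarrow> 'h) \<Rightarrow> 'h \<Rightarrow> bool" where
  "hlim H x l \<longleftrightarrow> (\<lambda>n. hnorm H (x n \<ominus>\<^bsub>H\<^esub> l)) \<longlonglongrightarrow> 0"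

text \<open>Completeness is kept apart: the norm, its metric and the triangle inequality are needed before
  the completeness of a concrete space can be verified.\<close>

locale pre_hilbert = module complex_ring H for H :: "'h inner_module" +
  assumes ip_add: "\<lbrakk>x \<in> carrier H; y \<in> carrier H; z \<in> carrier H\<rbrakk>
      \<Longrightarrow> ip H (x \<oplus>\<^bsub>H\<^esub> y) z = ip H x z + ip H y z"
    and ip_smult: "\<lbrakk>x \<in> carrier H; y \<in> carrier H\<rbrakk> \<Longrightarrow> ip H (c \<odot>\<^bsub>H\<^esub> x) y = c * ip H x y"
    and ip_cnj: "\<lbrakk>x \<in> carrier H; y \<in> carrier H\<rbrakk> \<Longrightarrow> ip H y x = cnj (ip H x y)"
    and ip_nonneg: "x \<in> carrier H \<Longrightarrow> 0 \<le> Re (ip H x x)"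
    and ip_definite: "\<lbrakk>x \<in> carrier H; ip H x x = 0\<rbrakk> \<Longrightarrow> x = \<zero>\<^bsub>H\<^esub>"
begin

lemma smult_in [simp]: "x \<in> carrier H \<Longrightarrow> c \<odot>\<^bsub>H\<^esub> x \<in> carrier H"
  using smult_closed[of c x] by simp

lemma ip_add_right: "\<lbrakk>x \<in> carrier H; y \<in> carrier H; z \<in> carrier H\<rbrakk>
    \<Longrightarrow> ip H x (y \<oplus>\<^bsub>H\<^esub> z) = ip H x y + ip H x z"
  using ip_cnj[of "y \<oplus>\<^bsub>H\<^esub> z" x] ip_cnj[of y x] ip_cnj[of z x] ip_add[of y z x] by simp

lemma ip_smult_right: "\<lbrakk>x \<in> carrier H; y \<in> carrier H\<rbrakk> \<Longrightarrow> ip H x (c \<odot>\<^bsub>H\<^esub> y) = cnj c * ip H x y"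
  using ip_cnj[of "c \<odot>\<^bsub>H\<^esub> y" x] ip_cnj[of y x] ip_smult[of y x c] by simp

lemma ip_zero_left [simp]: "y \<in> carrier H \<Longrightarrow> ip H \<zero>\<^bsub>H\<^esub> y = 0"
  using ip_smult[of "\<zero>\<^bsub>H\<^esub>" y 0] smult_l_null[of "\<zero>\<^bsub>H\<^esub>"] by simp

lemma ip_zero_right [simp]: "y \<in> carrier H \<Longrightarrow> ip H y \<zero>\<^bsub>H\<^esub> = 0"
  using ip_cnj[of "\<zero>\<^bsub>H\<^esub>" y] by simp

lemma ip_neg: "\<lbrakk>x \<in> carrier H; y \<in> carrier H\<rbrakk> \<Longrightarrow> ip H (\<ominus>\<^bsub>H\<^esub> x) y = - ip H x y"
  using ip_add[of "\<ominus>\<^bsub>H\<^esub> x" x y] by (simp add: M.l_neg add_eq_0_iff)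

lemma ip_neg_right: "\<lbrakk>x \<in> carrier H; y \<in> carrier H\<rbrakk> \<Longrightarrow> ip H x (\<ominus>\<^bsub>H\<^esub> y) = - ip H x y"
  using ip_add_right[of x "\<ominus>\<^bsub>H\<^esub> y" y] by (simp add: M.l_neg add_eq_0_iff)

lemma ip_diff: "\<lbrakk>x \<in> carrier H; y \<in> carrier H; z \<in> carrier H\<rbrakk>
    \<Longrightarrow> ip H (x \<ominus>\<^bsub>H\<^esub> y) z = ip H x z - ip H y z"
  by (simp add: a_minus_def ip_add ip_neg)

lemma ip_diff_right: "\<lbrakk>x \<in> carrier H; y \<in> carrier H; z \<in> carrier H\<rbrakk>
    \<Longrightarrow> ip H x (y \<ominus>\<^bsub>H\<^esub> z) = ip H x y - ip H x z"
  by (simp add: a_minus_def ip_add_right ip_neg_right)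

lemmas ip_lin = ip_add ip_add_right ip_smult ip_smult_right ip_neg ip_neg_right ip_diff ip_diff_right

lemma diff_eq_zero [simp]: "\<lbrakk>x \<in> carrier H; y \<in> carrier H\<rbrakk> \<Longrightarrow> x \<ominus>\<^bsub>H\<^esub> y = \<zero>\<^bsub>H\<^esub> \<longleftrightarrow> x = y"
  by (metis M.minus_closed M.minus_equality M.minus_minus M.a_inv_closed M.l_neg M.r_neg M.add.inv_solve_right a_minus_def M.l_zero M.zero_closed)

text \<open>Identities between vectors are reduced by this rule to identities between inner products, that
  is, between complex numbers, where the linearity rules apply.\<close>

lemma ip_ext:
  assumes "x \<in> carrier H" "y \<in> carrier H" "\<And>z. z \<in> carrier H \<Longrightarrow> ip H x z = ip H y z"
  shows "x = y"
proof -
  have "ip H (x \<ominus>\<^bsub>H\<^esub> y) (x \<ominus>\<^bsub>H\<^esub> y) = 0"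
    using assms by (simp add: ip_diff)
  then have "x \<ominus>\<^bsub>H\<^esub> y = \<zero>\<^bsub>H\<^esub>" using assms ip_definite by simp
  then show ?thesis using assms by simp
qed

lemma diff_conv_smult: "\<lbrakk>x \<in> carrier H; y \<in> carrier H\<rbrakk> \<Longrightarrow> x \<ominus>\<^bsub>H\<^esub> y = x \<oplus>\<^bsub>H\<^esub> (-1) \<odot>\<^bsub>H\<^esub> y"
  by (rule ip_ext) (simp_all add: ip_lin)

lemma neg_conv_smult: "x \<in> carrier H \<Longrightarrow> \<ominus>\<^bsub>H\<^esub> x = (-1) \<odot>\<^bsub>H\<^esub> x"
  by (rule ip_ext) (simp_all add: ip_lin)

lemma Im_ip_self [simp]: "x \<in> carrier H \<Longrightarrow> Im (ip H x x) = 0"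
  using arg_cong[OF ip_cnj[of x x], of Im] by simp

lemma ip_self: "x \<in> carrier H \<Longrightarrow> ip H x x = complex_of_real ((hnorm H x)\<^sup>2)"
  by (simp add: hnorm_def ip_nonneg complex_eq_iff)

lemma hnorm_nonneg [simp]: "x \<in> carrier H \<Longrightarrow> 0 \<le> hnorm H x"
  by (simp add: hnorm_def ip_nonneg)

lemma hnorm_sq: "x \<in> carrier H \<Longrightarrow> (hnorm H x)\<^sup>2 = Re (ip H x x)"
  by (simp add: hnorm_def ip_nonneg)

lemma hnorm_eq_0 [simp]: "x \<in> carrier H \<Longrightarrow> hnorm H x = 0 \<longleftrightarrow> x = \<zero>\<^bsub>H\<^esub>"
proof -
  assume x: "x \<in> carrier H"
  have "x = \<zero>\<^bsub>H\<^esub>" if "hnorm H x = 0"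
    using ip_definite[OF x] ip_self[OF x] that by simp
  moreover have "hnorm H \<zero>\<^bsub>H\<^esub> = 0" unfolding hnorm_def by simp
  ultimately show ?thesis by blast
qed

lemma hnorm_zero [simp]: "hnorm H \<zero>\<^bsub>H\<^esub> = 0" by simp

lemma hnorm_smult: "x \<in> carrier H \<Longrightarrow> hnorm H (c \<odot>\<^bsub>H\<^esub> x) = cmod c * hnorm H x"
proof -
  assume x: "x \<in> carrier H"
  have "ip H (c \<odot>\<^bsub>H\<^esub> x) (c \<odot>\<^bsub>H\<^esub> x) = (c * cnj c) * ip H x x"
    using x by (simp add: ip_lin)
  also have "c * cnj c = complex_of_real ((cmod c)\<^sup>2)" by (simp only: complex_norm_square)
  finally have "Re (ip H (c \<odot>\<^bsub>H\<^esub> x) (c \<odot>\<^bsub>H\<^esub> x)) = (cmod c)\<^sup>2 * Re (ip H x x)"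
    by simp
  then show ?thesis unfolding hnorm_def by (simp add: real_sqrt_mult)
qed

lemma cauchy_schwarz:
  assumes x: "x \<in> carrier H" and y: "y \<in> carrier H"
  shows "cmod (ip H x y) \<le> hnorm H x * hnorm H y"
proof (cases "y = \<zero>\<^bsub>H\<^esub>")
  case True then show ?thesis using x by simp
next
  case False
  define N where "N = (hnorm H y)\<^sup>2"
  have N: "N > 0" using False y by (simp add: N_def)
  define z where "z = ip H x y"
  have yy: "ip H y y = complex_of_real N" using y by (simp add: N_def ip_self)
  have xx: "ip H x x = complex_of_real ((hnorm H x)\<^sup>2)" using x by (simp add: ip_self)
  have yx: "ip H y x = cnj z" using ip_cnj[OF x y] by (simp add: z_def)
  \<comment> \<open>\<open>N\<close> times the component of \<open>x\<close> orthogonal to \<open>y\<close>; the inequality says that its norm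
    is nonnegative.\<close>
  define v where "v = (of_real N \<odot>\<^bsub>H\<^esub> x) \<ominus>\<^bsub>H\<^esub> (z \<odot>\<^bsub>H\<^esub> y)"
  have vc: "v \<in> carrier H" using x y by (simp add: v_def)
  have "ip H v v = of_real N * (of_real N * of_real ((hnorm H x)\<^sup>2) - z * cnj z)"
    using x y by (simp add: v_def ip_lin yy xx yx z_def[symmetric] algebra_simps)
  also have "z * cnj z = of_real ((cmod z)\<^sup>2)" by (simp only: complex_norm_square)
  finally have "ip H v v = of_real (N * (N * (hnorm H x)\<^sup>2 - (cmod z)\<^sup>2))"
    by (simp only: of_real_mult of_real_diff)
  then have "Re (ip H v v) = N * (N * (hnorm H x)\<^sup>2 - (cmod z)\<^sup>2)"
    by (simp only: Re_complex_of_real)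
  with ip_nonneg[OF vc] N have "(cmod z)\<^sup>2 \<le> N * (hnorm H x)\<^sup>2"
    by (simp add: zero_le_mult_iff)
  then have "(cmod z)\<^sup>2 \<le> (hnorm H x * hnorm H y)\<^sup>2"
    by (simp add: N_def power_mult_distrib mult.commute)
  then show ?thesis using x y by (simp add: z_def power2_le_iff_abs_le)
qed

lemma hnorm_triangle:
  assumes x: "x \<in> carrier H" and y: "y \<in> carrier H"
  shows "hnorm H (x \<oplus>\<^bsub>H\<^esub> y) \<le> hnorm H x + hnorm H y"
proof -
  have "(hnorm H (x \<oplus>\<^bsub>H\<^esub> y))\<^sup>2 = (hnorm H x)\<^sup>2 + 2 * Re (ip H x y) + (hnorm H y)\<^sup>2"
    using x y ip_cnj[of x y] by (simp add: hnorm_sq ip_lin)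
  also have "Re (ip H x y) \<le> hnorm H x * hnorm H y"
    using cauchy_schwarz[OF x y] complex_Re_le_cmod[of "ip H x y"] by linarith
  finally have "(hnorm H (x \<oplus>\<^bsub>H\<^esub> y))\<^sup>2 \<le> (hnorm H x + hnorm H y)\<^sup>2"
    by (simp add: power2_sum)
  then show ?thesis using x y by (simp add: power2_le_iff_abs_le)
qed

lemma hnorm_diff_commute: "\<lbrakk>x \<in> carrier H; y \<in> carrier H\<rbrakk> \<Longrightarrow> hnorm H (x \<ominus>\<^bsub>H\<^esub> y) = hnorm H (y \<ominus>\<^bsub>H\<^esub> x)"
  by (simp add: hnorm_def ip_lin algebra_simps)

lemma diff_add_diff: "\<lbrakk>x \<in> carrier H; y \<in> carrier H; z \<in> carrier H\<rbrakk>
   \<Longrightarrow> (x \<ominus>\<^bsub>H\<^esub> y) \<oplus>\<^bsub>H\<^esub> (y \<ominus>\<^bsub>H\<^esub> z) = x \<ominus>\<^bsub>H\<^esub> z"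
  by (rule ip_ext) (simp_all add: ip_lin)

lemma hnorm_diff_triangle:
  "\<lbrakk>x \<in> carrier H; y \<in> carrier H; z \<in> carrier H\<rbrakk>
   \<Longrightarrow> hnorm H (x \<ominus>\<^bsub>H\<^esub> z) \<le> hnorm H (x \<ominus>\<^bsub>H\<^esub> y) + hnorm H (y \<ominus>\<^bsub>H\<^esub> z)"
  using hnorm_triangle[of "x \<ominus>\<^bsub>H\<^esub> y" "y \<ominus>\<^bsub>H\<^esub> z"] by (simp add: diff_add_diff)

lemma metric: "Metric_space (carrier H) (hdist H)"
proof
  show "0 \<le> hdist H x y" for x y by (simp add: hdist_def)
  show "hdist H x y = hdist H y x" for x y by (simp add: hdist_def hnorm_diff_commute)
  show "hdist H x y = 0 \<longleftrightarrow> x = y" if "x \<in> carrier H" "y \<in> carrier H" for x y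
    using that by (simp add: hdist_def)
  show "hdist H x z \<le> hdist H x y + hdist H y z"
    if "x \<in> carrier H" "y \<in> carrier H" "z \<in> carrier H" for x y z
    using that by (simp add: hdist_def hnorm_diff_triangle)
qed

subsection \<open>Limits of sequences\<close>

lemma hlim_const: "x \<in> carrier H \<Longrightarrow> hlim H (\<lambda>_. x) x"
  by (simp add: hlim_def M.r_neg a_minus_def)

lemma hlim_norm_bounded:
  assumes x: "\<And>n. x n \<in> carrier H" "l \<in> carrier H" and lim: "hlim H x l"
  shows "\<exists>B. \<forall>n. hnorm H (x n) \<le> B"
proof -
  have "Bseq (\<lambda>n. hnorm H (x n \<ominus>\<^bsub>H\<^esub> l))"
    using lim unfolding hlim_def by (meson convergentI convergent_imp_Bseq)
  then obtain B where B: "\<And>n. norm (hnorm H (x n \<ominus>\<^bsub>H\<^esub> l)) \<le> B" unfolding Bseq_def by blast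
  have "hnorm H (x n) \<le> B + hnorm H l" for n
  proof -
    have "(x n \<ominus>\<^bsub>H\<^esub> l) \<oplus>\<^bsub>H\<^esub> l = x n"
      by (rule ip_ext) (simp_all add: x ip_lin)
    then have "hnorm H (x n) \<le> hnorm H (x n \<ominus>\<^bsub>H\<^esub> l) + hnorm H l"
      using hnorm_triangle[of "x n \<ominus>\<^bsub>H\<^esub> l" l] x by simp
    then show ?thesis using B[of n] by simp
  qed
  then show ?thesis by blast
qed

lemma hlim_ip:
  assumes x: "\<And>n. x n \<in> carrier H" "l \<in> carrier H" and lx: "hlim H x l"
    and y: "\<And>n. y n \<in> carrier H" "m \<in> carrier H" and ly: "hlim H y m"
  shows "(\<lambda>n. ip H (x n) (y n)) \<longlonglongrightarrow> ip H l m"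
proof -
  obtain B where B: "\<And>n. hnorm H (y n) \<le> B" using hlim_norm_bounded[OF y ly] by blast
  have "(\<lambda>n. hnorm H (x n \<ominus>\<^bsub>H\<^esub> l) * B + hnorm H l * hnorm H (y n \<ominus>\<^bsub>H\<^esub> m)) \<longlonglongrightarrow> 0 * B + hnorm H l * 0"
    using lx ly unfolding hlim_def by (intro tendsto_intros)
  then have lim0: "(\<lambda>n. hnorm H (x n \<ominus>\<^bsub>H\<^esub> l) * B + hnorm H l * hnorm H (y n \<ominus>\<^bsub>H\<^esub> m)) \<longlonglongrightarrow> 0" by simp
  have "(\<lambda>n. ip H (x n) (y n) - ip H l m) \<longlonglongrightarrow> 0"
  proof (rule Lim_null_comparison[OF _ lim0], rule always_eventually, rule allI)
    fix n
    have "ip H (x n) (y n) - ip H l m = ip H (x n \<ominus>\<^bsub>H\<^esub> l) (y n) + ip H l (y n \<ominus>\<^bsub>H\<^esub> m)"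
      using x y by (simp add: ip_lin)
    also have "cmod \<dots> \<le> cmod (ip H (x n \<ominus>\<^bsub>H\<^esub> l) (y n)) + cmod (ip H l (y n \<ominus>\<^bsub>H\<^esub> m))"
      by (rule norm_triangle_ineq)
    also have "\<dots> \<le> hnorm H (x n \<ominus>\<^bsub>H\<^esub> l) * hnorm H (y n) + hnorm H l * hnorm H (y n \<ominus>\<^bsub>H\<^esub> m)"
      using x y by (intro add_mono cauchy_schwarz) auto
    also have "\<dots> \<le> hnorm H (x n \<ominus>\<^bsub>H\<^esub> l) * B + hnorm H l * hnorm H (y n \<ominus>\<^bsub>H\<^esub> m)"
      using x B by (intro add_mono mult_left_mono) auto
    finally show "norm (ip H (x n) (y n) - ip H l m)
        \<le> hnorm H (x n \<ominus>\<^bsub>H\<^esub> l) * B + hnorm H l * hnorm H (y n \<ominus>\<^bsub>H\<^esub> m)" .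
  qed
  then show ?thesis using LIM_zero_iff by blast
qed

lemma hlim_norm:
  assumes "\<And>n. x n \<in> carrier H" "l \<in> carrier H" "hlim H x l"
  shows "(\<lambda>n. hnorm H (x n)) \<longlonglongrightarrow> hnorm H l"
  unfolding hnorm_def by (intro tendsto_real_sqrt tendsto_Re hlim_ip assms)

lemma hlim_unique:
  assumes x: "\<And>n. x n \<in> carrier H" "l \<in> carrier H" "m \<in> carrier H"
    and "hlim H x l" "hlim H x m"
  shows "l = m"
proof (rule ip_ext)
  fix z assume z: "z \<in> carrier H"
  show "ip H l z = ip H m z"
    by (rule LIMSEQ_unique[OF hlim_ip[OF _ _ _ _ _ hlim_const[OF z]] hlim_ip[OF _ _ _ _ _ hlim_const[OF z]]])
       (use assms z in auto)
qed (use assms in auto)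

lemma hlim_add:
  assumes x: "\<And>n. x n \<in> carrier H" "l \<in> carrier H" and lx: "hlim H x l"
    and y: "\<And>n. y n \<in> carrier H" "m \<in> carrier H" and ly: "hlim H y m"
  shows "hlim H (\<lambda>n. x n \<oplus>\<^bsub>H\<^esub> y n) (l \<oplus>\<^bsub>H\<^esub> m)"
  unfolding hlim_def
proof (rule Lim_null_comparison)
  show "(\<lambda>n. hnorm H (x n \<ominus>\<^bsub>H\<^esub> l) + hnorm H (y n \<ominus>\<^bsub>H\<^esub> m)) \<longlonglongrightarrow> 0"
    using tendsto_add[OF lx[unfolded hlim_def] ly[unfolded hlim_def]] by simp
  have "norm (hnorm H (x n \<oplus>\<^bsub>H\<^esub> y n \<ominus>\<^bsub>H\<^esub> (l \<oplus>\<^bsub>H\<^esub> m)))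
      \<le> hnorm H (x n \<ominus>\<^bsub>H\<^esub> l) + hnorm H (y n \<ominus>\<^bsub>H\<^esub> m)" for n
  proof -
    have "x n \<oplus>\<^bsub>H\<^esub> y n \<ominus>\<^bsub>H\<^esub> (l \<oplus>\<^bsub>H\<^esub> m) = (x n \<ominus>\<^bsub>H\<^esub> l) \<oplus>\<^bsub>H\<^esub> (y n \<ominus>\<^bsub>H\<^esub> m)"
      by (rule ip_ext) (simp_all add: x y ip_lin)
    then show ?thesis using hnorm_triangle[of "x n \<ominus>\<^bsub>H\<^esub> l" "y n \<ominus>\<^bsub>H\<^esub> m"] x y by simp
  qed
  then show "\<forall>\<^sub>F n in sequentially. norm (hnorm H (x n \<oplus>\<^bsub>H\<^esub> y n \<ominus>\<^bsub>H\<^esub> (l \<oplus>\<^bsub>H\<^esub> m)))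
      \<le> hnorm H (x n \<ominus>\<^bsub>H\<^esub> l) + hnorm H (y n \<ominus>\<^bsub>H\<^esub> m)"
    by simp
qed

lemma hlim_smult:
  assumes x: "\<And>n. x n \<in> carrier H" "l \<in> carrier H" and lx: "hlim H x l"
  shows "hlim H (\<lambda>n. c \<odot>\<^bsub>H\<^esub> x n) (c \<odot>\<^bsub>H\<^esub> l)"
proof -
  have "c \<odot>\<^bsub>H\<^esub> x n \<ominus>\<^bsub>H\<^esub> c \<odot>\<^bsub>H\<^esub> l = c \<odot>\<^bsub>H\<^esub> (x n \<ominus>\<^bsub>H\<^esub> l)" for n
    by (rule ip_ext) (simp_all add: x ip_lin algebra_simps)
  then show ?thesis
    using tendsto_mult_left[OF lx[unfolded hlim_def], of "cmod c"]
    by (simp add: hlim_def hnorm_smult x)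
qed

lemma hlim_cauchy:
  assumes x: "\<And>n. x n \<in> carrier H" and l: "l \<in> carrier H" and lim: "hlim H x l" and e: "e > 0"
  shows "\<exists>N. \<forall>n\<ge>N. \<forall>m\<ge>N. hnorm H (x n \<ominus>\<^bsub>H\<^esub> x m) < e"
proof -
  obtain N where N: "\<And>n. n \<ge> N \<Longrightarrow> hnorm H (x n \<ominus>\<^bsub>H\<^esub> l) < e/2"
    using lim e unfolding hlim_def LIMSEQ_def by (fastforce simp: x l dest: spec[of _ "e/2"])
  have "hnorm H (x n \<ominus>\<^bsub>H\<^esub> x m) < e" if "n \<ge> N" "m \<ge> N" for n m
    using N[OF that(1)] N[OF that(2)] hnorm_diff_triangle[of "x n" l "x m"]
      hnorm_diff_commute[of "x m" l] x l by simp
  then show ?thesis by blast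
qed

lemma topspace_norm_topology [simp]: "topspace (norm_topology H) = carrier H"
  unfolding norm_topology_def using metric by (simp add: Metric_space.topspace_mtopology)

lemma closure_hlim:
  assumes "l \<in> norm_topology H closure_of S"
  shows "\<exists>x. (\<forall>n. x n \<in> S \<and> x n \<in> carrier H) \<and> l \<in> carrier H \<and> hlim H x l"
proof -
  interpret Metric_space "carrier H" "hdist H" by (rule metric)
  have l: "l \<in> carrier H" and b: "\<And>r. r > 0 \<Longrightarrow> \<exists>y\<in>S. y \<in> mball l r"
    using assms unfolding norm_topology_def metric_closure_of by auto
  have "\<forall>n. \<exists>y. y \<in> S \<and> y \<in> carrier H \<and> hnorm H (y \<ominus>\<^bsub>H\<^esub> l) < 1 / real (Suc n)"
  proof
    fix n
    obtain y where "y \<in> S" "y \<in> carrier H" "hdist H l y < 1 / real (Suc n)"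
      using b[of "1 / real (Suc n)"] by auto
    then show "\<exists>y. y \<in> S \<and> y \<in> carrier H \<and> hnorm H (y \<ominus>\<^bsub>H\<^esub> l) < 1 / real (Suc n)"
      using l by (auto simp: hdist_def hnorm_diff_commute)
  qed
  then obtain x where x: "\<And>n. x n \<in> S" "\<And>n. x n \<in> carrier H"
    "\<And>n. hnorm H (x n \<ominus>\<^bsub>H\<^esub> l) < 1 / real (Suc n)" by metis
  have "(\<lambda>n. hnorm H (x n \<ominus>\<^bsub>H\<^esub> l)) \<longlonglongrightarrow> 0"
  proof (rule Lim_null_comparison)
    show "(\<lambda>n. 1 / real (Suc n)) \<longlonglongrightarrow> 0" by (rule LIMSEQ_Suc[OF lim_1_over_n])
    have "norm (hnorm H (x n \<ominus>\<^bsub>H\<^esub> l)) \<le> 1 / real (Suc n)" for n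
      using x(3)[of n] x(2)[of n] l by simp
    then show "\<forall>\<^sub>F n in sequentially. norm (hnorm H (x n \<ominus>\<^bsub>H\<^esub> l)) \<le> 1 / real (Suc n)" by simp
  qed
  then show ?thesis using x l unfolding hlim_def by blast
qed

end

sublocale hilbert_space \<subseteq> pre_hilbert
  by unfold_locales (fact ip_add ip_smult ip_cnj ip_nonneg ip_definite)+

lemma (in hilbert_space) hlim_ex:
  assumes x: "\<And>n. x n \<in> carrier H"
    and cauchy: "\<And>e. e > 0 \<Longrightarrow> \<exists>N. \<forall>n\<ge>N. \<forall>m\<ge>N. hnorm H (x n \<ominus>\<^bsub>H\<^esub> x m) < e"
  shows "\<exists>l\<in>carrier H. hlim H x l"
proof -
  interpret Metric_space "carrier H" "hdist H" by (rule metric)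
  have "MCauchy x"
    unfolding MCauchy_def using x cauchy by (force simp: hdist_def)
  then obtain l where "limitin mtopology x l sequentially"
    using complete unfolding mcomplete_def by blast
  then have l: "l \<in> carrier H" and "\<And>e. e > 0 \<Longrightarrow> \<forall>\<^sub>F n in sequentially. hdist H (x n) l < e"
    unfolding limitin_metric by (auto elim: eventually_mono)
  then have "hlim H x l"
    unfolding hlim_def by (auto simp: tendsto_iff hdist_def x)
  with l show ?thesis by blast
qed

section \<open>Entrywise products of positive matrices\<close>

lemma psd_two_entries:
  assumes "psd n A" "i < n" "m < n"
  shows "cnj x * A i i * x + cnj x * A i m * y + cnj y * A m i * x + cnj y * A m m * y \<in> \<real>\<^sub>\<ge>\<^sub>0"
proof -
  define c where "c = (\<lambda>k. (if k = i then x else 0) + (if k = m then y else 0))"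
  have e: "(\<Sum>k<n. \<Sum>l<n. if k = p then if l = q then z else 0 else 0) = z"
    if "p < n" "q < n" for p q and z :: complex
  proof -
    have "(\<Sum>l<n. if k = p then if l = q then z else 0 else 0) = (if k = p then z else 0)" for k
      using that by simp
    then show ?thesis using that by simp
  qed
  have "(\<Sum>k<n. \<Sum>l<n. cnj (c k) * A k l * c l) =
     (\<Sum>k<n. \<Sum>l<n. (if k = i then if l = i then cnj x * A i i * x else 0 else 0)
       + (if k = i then if l = m then cnj x * A i m * y else 0 else 0)
       + (if k = m then if l = i then cnj y * A m i * x else 0 else 0)
       + (if k = m then if l = m then cnj y * A m m * y else 0 else 0))"
    by (intro sum.cong refl) (auto simp: c_def algebra_simps)
  also have "\<dots> = cnj x * A i i * x + cnj x * A i m * y + cnj y * A m i * x + cnj y * A m m * y"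
    by (simp only: sum.distrib e[OF assms(2) assms(2)] e[OF assms(2) assms(3)]
        e[OF assms(3) assms(2)] e[OF assms(3) assms(3)])
  finally show ?thesis using assms(1)[unfolded psd_def, rule_format, of c] by simp
qed

lemma psd_diag: "\<lbrakk>psd n A; i < n\<rbrakk> \<Longrightarrow> A i i \<in> \<real>\<^sub>\<ge>\<^sub>0"
  using psd_two_entries[of n A i i 1 0] by simp

text \<open>The form takes real values at \<open>e\<^sub>i + e\<^sub>m\<close> and at \<open>e\<^sub>i + \<i> e\<^sub>m\<close>.\<close>

lemma psd_hermitian: "\<lbrakk>psd n A; i < n; m < n\<rbrakk> \<Longrightarrow> A m i = cnj (A i m)"
  using psd_two_entries[of n A i m 1 1] psd_two_entries[of n A i m 1 \<i>]
    psd_diag[of n A i] psd_diag[of n A m]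
  by (auto simp: complex_nonneg_Reals_iff complex_eq_iff)

lemma psd_zero_diag:
  assumes "psd n A" "i < n" "m < n" "A m m = 0"
  shows "A i m = 0"
proof (rule ccontr)
  assume nz: "A i m \<noteq> 0"
  define z where "z = A i m"
  \<comment> \<open>Along \<open>e\<^sub>i - s z\<^sup>* e\<^sub>m\<close> the form is affine in \<open>s\<close> with slope \<open>-2 |z|\<^sup>2\<close>; this \<open>s\<close> makes it negative.\<close>
  define s where "s = (Re (A i i) + 1) / (cmod z)\<^sup>2"
  have h: "A m i = cnj z" using psd_hermitian[OF assms(1-3)] by (simp add: z_def)
  have "A i i + (- (of_real s) * (z * cnj z)) + (- (of_real s) * (z * cnj z)) \<in> \<real>\<^sub>\<ge>\<^sub>0"
    using psd_two_entries[OF assms(1-3), of 1 "- (of_real s) * cnj z"] h assms(4)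
    by (simp add: z_def algebra_simps)
  moreover have "z * cnj z = of_real ((cmod z)\<^sup>2)" by (simp only: complex_norm_square)
  ultimately have "0 \<le> Re (A i i) - 2 * (s * (cmod z)\<^sup>2)"
    by (simp add: complex_nonneg_Reals_iff)
  also have "s * (cmod z)\<^sup>2 = Re (A i i) + 1" using nz by (simp add: s_def z_def)
  finally show False using psd_diag[OF assms(1,2)] by (simp add: complex_nonneg_Reals_iff)
qed

text \<open>The form of the Schur complement is the form of the whole matrix minimized over the last
  coordinate. If the pivot is zero, division by zero removes the correction term, which agrees with
  the vanishing of the last column.\<close>

lemma psd_schur_complement:
  assumes A: "psd (Suc n) A"
  shows "psd n (\<lambda>i j. A i j - A i n * cnj (A j n) / A n n)"
  unfolding psd_def
proof
  fix c :: "nat \<Rightarrow> complex"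
  define d where "d = A n n"
  define s where "s = (\<Sum>j<n. A n j * c j)"
  define F where "F = (\<Sum>i<n. \<Sum>j<n. cnj (c i) * A i j * c j)"
  have dr: "cnj d = d" using psd_hermitian[OF A, of n n] by (simp add: d_def)
  have cs: "(\<Sum>i<n. cnj (c i) * A i n) = cnj s"
    using psd_hermitian[OF A, of n] by (simp add: s_def mult.commute)
  have s2: "(\<Sum>j<n. cnj (A j n) * c j) = s"
    using psd_hermitian[OF A, of _ n] by (simp add: s_def)
  have "(\<Sum>i<n. \<Sum>j<n. cnj (c i) * (A i j - A i n * cnj (A j n) / d) * c j)
     = F - (\<Sum>i<n. cnj (c i) * A i n) * (\<Sum>j<n. cnj (A j n) * c j) / d"
  proof -
    have "(\<Sum>i<n. cnj (c i) * A i n) * (\<Sum>j<n. cnj (A j n) * c j) / d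
       = (\<Sum>i<n. \<Sum>j<n. cnj (c i) * (A i n * cnj (A j n) / d) * c j)"
      unfolding sum_product sum_divide_distrib by (intro sum.cong refl) simp
    then show ?thesis
      by (simp add: F_def sum_subtractf left_diff_distrib right_diff_distrib)
  qed
  also have "\<dots> = F - cnj s * s / d" by (simp only: cs s2)
  also have "\<dots> \<in> \<real>\<^sub>\<ge>\<^sub>0"
  proof -
    \<comment> \<open>The minimizing value of the last coordinate.\<close>
    define e where "e = c(n := - s / d)"
    have "(\<Sum>i<Suc n. \<Sum>j<Suc n. cnj (e i) * A i j * e j) =
       F + (\<Sum>i<n. cnj (c i) * A i n) * e n + cnj (e n) * s + cnj (e n) * d * e n"
    proof -
      have inner: "(\<Sum>j<Suc n. cnj (e i) * A i j * e j)
          = cnj (e i) * (\<Sum>j<n. A i j * c j) + cnj (e i) * A i n * e n" for i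
        by (simp add: e_def sum_distrib_left mult.assoc)
      have "(\<Sum>i<n. cnj (e i) * (\<Sum>j<n. A i j * c j)) = F"
        by (simp add: e_def F_def sum_distrib_left mult.assoc)
      moreover have "(\<Sum>i<n. cnj (e i) * A i n * e n) = (\<Sum>i<n. cnj (c i) * A i n) * e n"
        unfolding sum_distrib_right by (simp add: e_def)
      ultimately show ?thesis
        unfolding inner unfolding sum.distrib sum.lessThan_Suc s_def d_def by simp
    qed
    also have "\<dots> = F - cnj s * s / d"
    proof (cases "d = 0")
      case True then show ?thesis unfolding cs by (simp add: e_def)
    next
      case False
      have "e n = - s / d" "cnj (e n) = - cnj s / d" by (simp_all add: e_def dr)
      with False show ?thesis unfolding cs by simp
    qed
    finally show ?thesis using A[unfolded psd_def, rule_format, of e] by (simp only:)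
  qed
  finally show "(\<Sum>i<n. \<Sum>j<n. cnj (c i) * (A i j - A i n * cnj (A j n) / A n n) * c j) \<in> \<real>\<^sub>\<ge>\<^sub>0"
    by (simp add: d_def)
qed

text \<open>Cholesky factorization: split off the rank one matrix of the last column and recurse on the
  Schur complement.\<close>

lemma psd_gram:
  assumes "psd n A"
  shows "\<exists>v. \<forall>i<n. \<forall>j<n. A i j = (\<Sum>k<n. v k i * cnj (v k j))"
  using assms
proof (induction n arbitrary: A)
  case 0 then show ?case by simp
next
  case (Suc n)
  note A = Suc.prems
  define d where "d = A n n"
  have d: "d \<in> \<real>\<^sub>\<ge>\<^sub>0" using psd_diag[OF A, of n] by (simp add: d_def)
  define r where "r = sqrt (Re d)"
  have rr: "d = of_real r * of_real r"
    using d by (auto simp: r_def complex_nonneg_Reals_iff complex_eq_iff)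
  obtain v where v: "\<And>i j. i < n \<Longrightarrow> j < n \<Longrightarrow>
      A i j - A i n * cnj (A j n) / d = (\<Sum>k<n. v k i * cnj (v k j))"
    using Suc.IH[OF psd_schur_complement[OF A]] unfolding d_def by blast
  define u where "u = (\<lambda>k i. if k = n then A i n / of_real r else if i = n then 0 else v k i)"
  have z: "A i n = 0" if "d = 0" "i < Suc n" for i
    using psd_zero_diag[OF A that(2), of n] that(1) by (simp add: d_def)
  have "A i j = (\<Sum>k<Suc n. u k i * cnj (u k j))" if ij: "i < Suc n" "j < Suc n" for i j
  proof -
    have last: "u n i * cnj (u n j) = A i n * cnj (A j n) / d"
      by (simp add: u_def rr)
    show ?thesis
    proof (cases "i = n \<or> j = n")
      case False
      then have "(\<Sum>k<n. u k i * cnj (u k j)) = A i j - A i n * cnj (A j n) / d"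
        using v[of i j] ij by (simp add: u_def)
      then show ?thesis using last by simp
    next
      case True
      then have "(\<Sum>k<n. u k i * cnj (u k j)) = 0"
        by (intro sum.neutral) (auto simp: u_def)
      moreover have "A i j = A i n * cnj (A j n) / d"
      proof (cases "d = 0")
        case True
        then show ?thesis using z ij \<open>i = n \<or> j = n\<close> psd_hermitian[OF A ij(2) ij(1)] by auto
      next
        case False
        then show ?thesis
          using \<open>i = n \<or> j = n\<close> psd_hermitian[OF A ij(1), of n] psd_hermitian[OF A ij(2), of n]
          by (auto simp: d_def)
      qed
      ultimately show ?thesis using last by simp
    qed
  qed
  then show ?case by blast
qed

text \<open>Schur's product theorem. Inner products of sums of elementary tensors are sums over entrywise
  products of two Gram matrices, so this is the source of all positivity on tensor products.\<close>

lemma psd_entrywise_sum: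
  assumes A: "psd n A" and B: "psd n B"
  shows "(\<Sum>i<n. \<Sum>j<n. A i j * B i j) \<in> \<real>\<^sub>\<ge>\<^sub>0"
proof -
  obtain v where v: "\<And>i j. i < n \<Longrightarrow> j < n \<Longrightarrow> A i j = (\<Sum>k<n. v k i * cnj (v k j))"
    using psd_gram[OF A] by blast
  have "(\<Sum>i<n. \<Sum>j<n. A i j * B i j) = (\<Sum>i<n. \<Sum>j<n. \<Sum>k<n. v k i * B i j * cnj (v k j))"
    by (intro sum.cong refl) (simp add: v sum_distrib_left algebra_simps)
  also have "\<dots> = (\<Sum>i<n. \<Sum>k<n. \<Sum>j<n. v k i * B i j * cnj (v k j))"
    by (rule sum.cong[OF refl], rule sum.swap)
  also have "\<dots> = (\<Sum>k<n. \<Sum>i<n. \<Sum>j<n. v k i * B i j * cnj (v k j))"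
    by (rule sum.swap)
  also have "\<dots> \<in> \<real>\<^sub>\<ge>\<^sub>0"
  proof -
    have "(\<Sum>i<n. \<Sum>j<n. v k i * B i j * cnj (v k j)) \<in> \<real>\<^sub>\<ge>\<^sub>0" for k
      using B[unfolded psd_def, rule_format, of "\<lambda>i. cnj (v k i)"] by simp
    then show ?thesis by (simp add: complex_nonneg_Reals_iff sum_nonneg)
  qed
  finally show ?thesis .
qed

section \<open>Finite sums and bounded operators\<close>

primrec hsum :: "'h inner_module \<Rightarrow> (nat \<Rightarrow> 'h) \<Rightarrow> nat \<Rightarrow> 'h" where
  "hsum H f 0 = \<zero>\<^bsub>H\<^esub>"
| "hsum H f (Suc n) = hsum H f n \<oplus>\<^bsub>H\<^esub> f n"

lemma hsum_cong: "(\<And>i. i < n \<Longrightarrow> f i = g i) \<Longrightarrow> hsum H f n = hsum H g n"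
  by (induction n) auto

definition sesquilinear :: "'h inner_module \<Rightarrow> ('h \<Rightarrow> 'h \<Rightarrow> complex) \<Rightarrow> bool" where
  "sesquilinear H q \<longleftrightarrow> (\<forall>x\<in>carrier H. \<forall>y\<in>carrier H. \<forall>z\<in>carrier H.
      q (x \<oplus>\<^bsub>H\<^esub> y) z = q x z + q y z \<and> q z (x \<oplus>\<^bsub>H\<^esub> y) = q z x + q z y) \<and>
    (\<forall>c. \<forall>x\<in>carrier H. \<forall>y\<in>carrier H. q (c \<odot>\<^bsub>H\<^esub> x) y = c * q x y \<and> q x (c \<odot>\<^bsub>H\<^esub> y) = cnj c * q x y)"

context hilbert_space begin

lemma diff_self [simp]: "x \<in> carrier H \<Longrightarrow> x \<ominus>\<^bsub>H\<^esub> x = \<zero>\<^bsub>H\<^esub>"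
  by simp

lemma hsum_in [simp]: "(\<And>i. i < n \<Longrightarrow> f i \<in> carrier H) \<Longrightarrow> hsum H f n \<in> carrier H"
  by (induction n) auto

lemma hsum_append:
  assumes "\<And>i. f i \<in> carrier H" "\<And>i. g i \<in> carrier H"
  shows "hsum H (\<lambda>i. if i < n then f i else g (i - n)) (n + m) = hsum H f n \<oplus>\<^bsub>H\<^esub> hsum H g m"
proof (induction m)
  case 0
  have "hsum H (\<lambda>i. if i < n then f i else g (i - n)) n = hsum H f n" by (rule hsum_cong) simp
  then show ?case using assms by simp
next
  case (Suc m) then show ?case using assms by (simp add: M.a_assoc)
qed

lemma hsum_smult:
  assumes "\<And>i. f i \<in> carrier H"
  shows "c \<odot>\<^bsub>H\<^esub> hsum H f n = hsum H (\<lambda>i. c \<odot>\<^bsub>H\<^esub> f i) n"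
  using assms by (induction n) (simp_all add: smult_r_distr smult_r_null)

lemma ip_hsum_left:
  "\<lbrakk>\<And>i. f i \<in> carrier H; z \<in> carrier H\<rbrakk> \<Longrightarrow> ip H (hsum H f n) z = (\<Sum>i<n. ip H (f i) z)"
  by (induction n) (simp_all add: ip_lin)

lemma ip_hsum_right:
  "\<lbrakk>\<And>i. f i \<in> carrier H; z \<in> carrier H\<rbrakk> \<Longrightarrow> ip H z (hsum H f n) = (\<Sum>i<n. ip H z (f i))"
  by (induction n) (simp_all add: ip_lin)

lemma sesquilinear_zero:
  assumes "sesquilinear H q" "z \<in> carrier H"
  shows "q \<zero>\<^bsub>H\<^esub> z = 0" "q z \<zero>\<^bsub>H\<^esub> = 0"
proof -
  have "0 \<odot>\<^bsub>H\<^esub> \<zero>\<^bsub>H\<^esub> = \<zero>\<^bsub>H\<^esub>" using smult_l_null[of "\<zero>\<^bsub>H\<^esub>"] by simp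
  moreover have "q (0 \<odot>\<^bsub>H\<^esub> \<zero>\<^bsub>H\<^esub>) z = 0 * q \<zero>\<^bsub>H\<^esub> z" "q z (0 \<odot>\<^bsub>H\<^esub> \<zero>\<^bsub>H\<^esub>) = cnj 0 * q z \<zero>\<^bsub>H\<^esub>"
    using assms M.zero_closed unfolding sesquilinear_def by blast+
  ultimately show "q \<zero>\<^bsub>H\<^esub> z = 0" "q z \<zero>\<^bsub>H\<^esub> = 0" by simp_all
qed

lemma sesquilinear_hsum:
  assumes q: "sesquilinear H q" and f: "\<And>i. f i \<in> carrier H" and z: "z \<in> carrier H"
  shows "q (hsum H f n) z = (\<Sum>i<n. q (f i) z)" "q z (hsum H f n) = (\<Sum>i<n. q z (f i))"
proof (induction n)
  case 0
  { case 1 then show ?case using sesquilinear_zero[OF q z] by simp }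
  { case 2 then show ?case using sesquilinear_zero[OF q z] by simp }
next
  case (Suc n)
  { case 1 then show ?case using Suc q f z unfolding sesquilinear_def by simp }
  { case 2 then show ?case using Suc q f z unfolding sesquilinear_def by simp }
qed

lemma psd_sesquilinear:
  assumes q: "sesquilinear H q" and pos: "\<And>x. x \<in> carrier H \<Longrightarrow> q x x \<in> \<real>\<^sub>\<ge>\<^sub>0"
    and a: "\<And>i. a i \<in> carrier H"
  shows "psd n (\<lambda>i j. q (a i) (a j))"
  unfolding psd_def
proof
  fix c :: "nat \<Rightarrow> complex"
  let ?x = "hsum H (\<lambda>i. cnj (c i) \<odot>\<^bsub>H\<^esub> a i) n"
  have x: "?x \<in> carrier H" using a by simp
  have sm: "q (cnj (c i) \<odot>\<^bsub>H\<^esub> a i) (cnj (c j) \<odot>\<^bsub>H\<^esub> a j) = cnj (c i) * q (a i) (a j) * c j" for i j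
    using q a unfolding sesquilinear_def by simp
  have "q ?x ?x = (\<Sum>i<n. q (cnj (c i) \<odot>\<^bsub>H\<^esub> a i) ?x)"
    using sesquilinear_hsum(1)[OF q, of "\<lambda>i. cnj (c i) \<odot>\<^bsub>H\<^esub> a i" ?x n] a x by simp
  also have "\<dots> = (\<Sum>i<n. \<Sum>j<n. q (cnj (c i) \<odot>\<^bsub>H\<^esub> a i) (cnj (c j) \<odot>\<^bsub>H\<^esub> a j))"
    using sesquilinear_hsum(2)[OF q, of "\<lambda>i. cnj (c i) \<odot>\<^bsub>H\<^esub> a i" _ n] a by simp
  finally show "(\<Sum>i<n. \<Sum>j<n. cnj (c i) * q (a i) (a j) * c j) \<in> \<real>\<^sub>\<ge>\<^sub>0"
    using pos[OF x] by (simp add: sm)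
qed

lemma bounded_op_in [simp]: "\<lbrakk>bounded_op H S; x \<in> carrier H\<rbrakk> \<Longrightarrow> S x \<in> carrier H"
  unfolding bounded_op_def linear_map_def by auto

lemma bounded_op_add: "\<lbrakk>bounded_op H S; x \<in> carrier H; y \<in> carrier H\<rbrakk> \<Longrightarrow> S (x \<oplus>\<^bsub>H\<^esub> y) = S x \<oplus>\<^bsub>H\<^esub> S y"
  unfolding bounded_op_def linear_map_def by auto

lemma bounded_op_smult: "\<lbrakk>bounded_op H S; x \<in> carrier H\<rbrakk> \<Longrightarrow> S (c \<odot>\<^bsub>H\<^esub> x) = c \<odot>\<^bsub>H\<^esub> S x"
  unfolding bounded_op_def linear_map_def by auto

lemma bounded_op_zero: "bounded_op H S \<Longrightarrow> S \<zero>\<^bsub>H\<^esub> = \<zero>\<^bsub>H\<^esub>"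
  using bounded_op_smult[of S "\<zero>\<^bsub>H\<^esub>" 0] smult_l_null by simp

lemma bounded_op_diff:
  assumes "bounded_op H S" "x \<in> carrier H" "y \<in> carrier H"
  shows "S (x \<ominus>\<^bsub>H\<^esub> y) = S x \<ominus>\<^bsub>H\<^esub> S y"
  using assms by (simp add: diff_conv_smult bounded_op_add bounded_op_smult)

lemma bounded_op_bound:
  assumes "bounded_op H S"
  obtains C where "C \<ge> 0" "\<And>x. x \<in> carrier H \<Longrightarrow> hnorm H (S x) \<le> C * hnorm H x"
proof -
  obtain C where C: "\<And>x. x \<in> carrier H \<Longrightarrow> hnorm H (S x) \<le> C * hnorm H x"
    using assms unfolding bounded_op_def by blast
  show thesis
  proof (rule that[of "\<bar>C\<bar>"])
    fix x assume x: "x \<in> carrier H"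
    have "C * hnorm H x \<le> \<bar>C\<bar> * hnorm H x" using x by (intro mult_right_mono) auto
    then show "hnorm H (S x) \<le> \<bar>C\<bar> * hnorm H x" using C[OF x] by linarith
  qed simp
qed

lemma bounded_op_hsum:
  "\<lbrakk>bounded_op H S; \<And>i. f i \<in> carrier H\<rbrakk> \<Longrightarrow> S (hsum H f n) = hsum H (\<lambda>i. S (f i)) n"
  by (induction n) (simp_all add: bounded_op_zero bounded_op_add)

lemma bounded_op_hlim:
  assumes S: "bounded_op H S" and x: "\<And>n. x n \<in> carrier H" "l \<in> carrier H" and lim: "hlim H x l"
  shows "hlim H (\<lambda>n. S (x n)) (S l)"
proof -
  obtain C where C: "\<And>x. x \<in> carrier H \<Longrightarrow> hnorm H (S x) \<le> C * hnorm H x"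
    using bounded_op_bound[OF S] by metis
  have "hnorm H (S (x n) \<ominus>\<^bsub>H\<^esub> S l) \<le> C * hnorm H (x n \<ominus>\<^bsub>H\<^esub> l)" for n
    using C[of "x n \<ominus>\<^bsub>H\<^esub> l"] x bounded_op_diff[OF S x(1) x(2)] by simp
  then have "\<forall>\<^sub>F n in sequentially. norm (hnorm H (S (x n) \<ominus>\<^bsub>H\<^esub> S l)) \<le> C * hnorm H (x n \<ominus>\<^bsub>H\<^esub> l)"
    using x S by simp
  moreover have "(\<lambda>n. C * hnorm H (x n \<ominus>\<^bsub>H\<^esub> l)) \<longlonglongrightarrow> 0"
    using tendsto_mult_left[OF lim[unfolded hlim_def], of C] by simp
  ultimately show ?thesis unfolding hlim_def by (rule Lim_null_comparison)
qed

lemma bounded_op_id: "bounded_op H (\<lambda>x\<in>carrier H. x)"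
  unfolding bounded_op_def linear_map_def by (auto intro!: exI[of _ 1])

text \<open>A bounded operator is constructed from a densely defined linear relation \<open>G\<close> that obeys the norm
  bound. The bound forces the closure of \<open>G\<close> to be single-valued, and completeness makes it defined
  everywhere. This spares a proof that an operator prescribed on representations of tensors does not
  depend on the representation.\<close>

lemma graph_extension:
  assumes sub: "\<And>x y. (x, y) \<in> G \<Longrightarrow> x \<in> carrier H \<and> y \<in> carrier H"
    and add: "\<And>x y x' y'. \<lbrakk>(x, y) \<in> G; (x', y') \<in> G\<rbrakk> \<Longrightarrow> (x \<oplus>\<^bsub>H\<^esub> x', y \<oplus>\<^bsub>H\<^esub> y') \<in> G"
    and smult: "\<And>c x y. (x, y) \<in> G \<Longrightarrow> (c \<odot>\<^bsub>H\<^esub> x, c \<odot>\<^bsub>H\<^esub> y) \<in> G"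
    and C: "C \<ge> 0" and bound: "\<And>x y. (x, y) \<in> G \<Longrightarrow> hnorm H y \<le> C * hnorm H x"
    and dense: "\<And>w. w \<in> carrier H \<Longrightarrow> \<exists>x. (\<forall>n. x n \<in> Domain G) \<and> hlim H x w"
  shows "\<exists>R. bounded_op H R \<and> (\<forall>(x, y)\<in>G. R x = y)"
proof -
  define L where "L = (\<lambda>w z. w \<in> carrier H \<and> z \<in> carrier H \<and>
    (\<exists>x y. (\<forall>n. (x n, y n) \<in> G) \<and> hlim H x w \<and> hlim H y z))"
  have Lin: "w \<in> carrier H" "z \<in> carrier H" if "L w z" for w z using that by (auto simp: L_def)
  have Lbound: "hnorm H z \<le> C * hnorm H w" if l: "L w z" for w z
  proof -
    obtain x y where xy: "\<And>n. (x n, y n) \<in> G" "hlim H x w" "hlim H y z" using l by (auto simp: L_def)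
    have c: "x n \<in> carrier H" "y n \<in> carrier H" for n using xy(1) sub by blast+
    show ?thesis
    proof (rule LIMSEQ_le)
      show "(\<lambda>n. hnorm H (y n)) \<longlonglongrightarrow> hnorm H z" using hlim_norm c xy(3) Lin[OF l] by blast
      show "(\<lambda>n. C * hnorm H (x n)) \<longlonglongrightarrow> C * hnorm H w"
        using hlim_norm[of x w] c xy(2) Lin[OF l] by (intro tendsto_intros) auto
      show "\<exists>N. \<forall>n\<ge>N. hnorm H (y n) \<le> C * hnorm H (x n)" using bound xy(1) by blast
    qed
  qed
  have Ladd: "L (w \<oplus>\<^bsub>H\<^esub> w') (z \<oplus>\<^bsub>H\<^esub> z')" if l: "L w z" "L w' z'" for w z w' z'
  proof -
    obtain x y where xy: "\<And>n. (x n, y n) \<in> G" "hlim H x w" "hlim H y z" using l by (auto simp: L_def)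
    obtain x' y' where xy': "\<And>n. (x' n, y' n) \<in> G" "hlim H x' w'" "hlim H y' z'" using l by (auto simp: L_def)
    have c: "x n \<in> carrier H" "y n \<in> carrier H" "x' n \<in> carrier H" "y' n \<in> carrier H" for n
      using xy(1) xy'(1) sub by blast+
    have g: "\<forall>n. (x n \<oplus>\<^bsub>H\<^esub> x' n, y n \<oplus>\<^bsub>H\<^esub> y' n) \<in> G" using add[OF xy(1) xy'(1)] by blast
    show ?thesis unfolding L_def
    proof (intro conjI exI)
      show "\<forall>n. (x n \<oplus>\<^bsub>H\<^esub> x' n, y n \<oplus>\<^bsub>H\<^esub> y' n) \<in> G" by (rule g)
      show "hlim H (\<lambda>n. x n \<oplus>\<^bsub>H\<^esub> x' n) (w \<oplus>\<^bsub>H\<^esub> w')"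
        by (rule hlim_add[OF c(1) Lin(1)[OF l(1)] xy(2) c(3) Lin(1)[OF l(2)] xy'(2)])
      show "hlim H (\<lambda>n. y n \<oplus>\<^bsub>H\<^esub> y' n) (z \<oplus>\<^bsub>H\<^esub> z')"
        by (rule hlim_add[OF c(2) Lin(2)[OF l(1)] xy(3) c(4) Lin(2)[OF l(2)] xy'(3)])
    qed (use Lin[OF l(1)] Lin[OF l(2)] in auto)
  qed
  have Lsmult: "L (a \<odot>\<^bsub>H\<^esub> w) (a \<odot>\<^bsub>H\<^esub> z)" if l: "L w z" for a w z
  proof -
    obtain x y where xy: "\<And>n. (x n, y n) \<in> G" "hlim H x w" "hlim H y z" using l by (auto simp: L_def)
    have c: "x n \<in> carrier H" "y n \<in> carrier H" for n
      using xy(1) sub by blast+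
    show ?thesis unfolding L_def
    proof (intro conjI exI)
      show "\<forall>n. (a \<odot>\<^bsub>H\<^esub> x n, a \<odot>\<^bsub>H\<^esub> y n) \<in> G" using smult[OF xy(1)] by blast
      show "hlim H (\<lambda>n. a \<odot>\<^bsub>H\<^esub> x n) (a \<odot>\<^bsub>H\<^esub> w)"
        by (rule hlim_smult[OF c(1) Lin(1)[OF l(1)] xy(2)])
      show "hlim H (\<lambda>n. a \<odot>\<^bsub>H\<^esub> y n) (a \<odot>\<^bsub>H\<^esub> z)"
        by (rule hlim_smult[OF c(2) Lin(2)[OF l(1)] xy(3)])
    qed (use Lin[OF l(1)] in auto)
  qed
  have Luniq: "z = z'" if l: "L w z" "L w z'" for w z z'
  proof -
    have "L (w \<ominus>\<^bsub>H\<^esub> w) (z \<ominus>\<^bsub>H\<^esub> z')"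
      using Ladd[OF l(1) Lsmult[OF l(2), of "-1"]] Lin[OF l(1)] Lin[OF l(2)] by (simp flip: diff_conv_smult)
    from Lbound[OF this] have "hnorm H (z \<ominus>\<^bsub>H\<^esub> z') \<le> 0" using Lin[OF l(1)] by simp
    moreover have "0 \<le> hnorm H (z \<ominus>\<^bsub>H\<^esub> z')" using Lin[OF l(1)] Lin[OF l(2)] by simp
    ultimately have "hnorm H (z \<ominus>\<^bsub>H\<^esub> z') = 0" by linarith
    then show ?thesis using Lin[OF l(1)] Lin[OF l(2)] by simp
  qed
  have Lex: "\<exists>z. L w z" if w: "w \<in> carrier H" for w
  proof -
    obtain x where x: "\<And>n. x n \<in> Domain G" "hlim H x w" using dense[OF w] by blast
    have "\<forall>n. \<exists>z. (x n, z) \<in> G" using x(1) by blast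
    then obtain y where y: "\<And>n. (x n, y n) \<in> G" by metis
    have c: "x n \<in> carrier H" "y n \<in> carrier H" for n using y sub by blast+
    have "(x n \<ominus>\<^bsub>H\<^esub> x m, y n \<ominus>\<^bsub>H\<^esub> y m) \<in> G" for n m
      using add[OF y[of n] smult[OF y[of m], of "-1"]] c by (simp flip: diff_conv_smult)
    then have yb: "hnorm H (y n \<ominus>\<^bsub>H\<^esub> y m) \<le> C * hnorm H (x n \<ominus>\<^bsub>H\<^esub> x m)" for n m
      using bound by blast
    have "\<exists>N. \<forall>n\<ge>N. \<forall>m\<ge>N. hnorm H (y n \<ominus>\<^bsub>H\<^esub> y m) < \<epsilon>" if "\<epsilon> > 0" for \<epsilon>
    proof -
      obtain N where N: "\<And>n m. n \<ge> N \<Longrightarrow> m \<ge> N \<Longrightarrow> hnorm H (x n \<ominus>\<^bsub>H\<^esub> x m) < \<epsilon> / (C + 1)"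
      proof -
        have "\<epsilon> / (C + 1) > 0" using \<open>\<epsilon> > 0\<close> C by simp
        from hlim_cauchy[OF c(1) w x(2) this] show thesis using that by blast
      qed
      have "hnorm H (y n \<ominus>\<^bsub>H\<^esub> y m) < \<epsilon>" if nm: "n \<ge> N" "m \<ge> N" for n m
      proof -
        have "C * hnorm H (x n \<ominus>\<^bsub>H\<^esub> x m) \<le> C * (\<epsilon> / (C + 1))"
          using N[OF nm] C by (intro mult_left_mono) auto
        also have "\<dots> < \<epsilon>" using C \<open>\<epsilon> > 0\<close> by (simp add: field_simps)
        finally show ?thesis using yb[of n m] by linarith
      qed
      then show ?thesis by blast
    qed
    then obtain z where "z \<in> carrier H" "hlim H y z" using hlim_ex[of y] c by blast
    then show ?thesis using w x(2) y unfolding L_def by (intro exI[of _ z] conjI exI[of _ x] exI[of _ y]) auto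
  qed
  define R where "R = (\<lambda>w\<in>carrier H. SOME z. L w z)"
  have RL: "L w (R w)" if "w \<in> carrier H" for w
    using someI_ex[OF Lex[OF that]] that by (simp add: R_def)
  have Req: "R w = z" if "L w z" for w z using Luniq[OF RL that] Lin[OF that] by blast
  have "bounded_op H R"
    unfolding bounded_op_def linear_map_def
  proof (intro conjI ballI allI)
    show "R \<in> extensional (carrier H)" by (simp add: R_def)
    show "R \<in> carrier H \<rightarrow> carrier H" using RL Lin by blast
    show "R (x \<oplus>\<^bsub>H\<^esub> y) = R x \<oplus>\<^bsub>H\<^esub> R y" if "x \<in> carrier H" "y \<in> carrier H" for x y
      by (rule Req[OF Ladd[OF RL RL]]) (use that in auto)
    show "R (c \<odot>\<^bsub>H\<^esub> x) = c \<odot>\<^bsub>H\<^esub> R x" if "x \<in> carrier H" for c x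
      by (rule Req[OF Lsmult[OF RL]]) (use that in auto)
    show "\<exists>C. \<forall>x\<in>carrier H. hnorm H (R x) \<le> C * hnorm H x" using Lbound RL by blast
  qed
  moreover have "R x = y" if "(x, y) \<in> G" for x y
  proof (rule Req)
    show "L x y" unfolding L_def 
      using that sub[OF that] hlim_const[of x] hlim_const[of y]
      by (intro conjI exI[of _ "\<lambda>_. x"] exI[of _ "\<lambda>_. y"]) auto
  qed
  ultimately show ?thesis by blast
qed

end

section \<open>Tensor products of operators\<close>

context hilbert_space begin

lemma sesquilinear_ip: "sesquilinear H (ip H)"
  unfolding sesquilinear_def by (simp add: ip_lin)

lemma sesquilinear_op: "bounded_op H S \<Longrightarrow> sesquilinear H (\<lambda>x y. ip H (S x) y)"
  unfolding sesquilinear_def by (simp add: ip_lin bounded_op_add bounded_op_smult)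

lemma sesquilinear_op_op: "bounded_op H S \<Longrightarrow> sesquilinear H (\<lambda>x y. ip H (S x) (S y))"
  unfolding sesquilinear_def by (simp add: ip_lin bounded_op_add bounded_op_smult)

lemma ip_self_pos: "x \<in> carrier H \<Longrightarrow> ip H x x \<in> \<real>\<^sub>\<ge>\<^sub>0"
  by (simp add: complex_nonneg_Reals_iff ip_nonneg)

text \<open>The form \<open>C\<^sup>2\<langle>x, y\<rangle> - \<langle>S x, S y\<rangle>\<close> is positive, which turns norm bounds into
  positivity statements accessible to Schur's theorem.\<close>

lemma bound_form_pos:
  assumes S: "bounded_op H S" and C: "\<And>x. x \<in> carrier H \<Longrightarrow> hnorm H (S x) \<le> C * hnorm H x"
    and x: "x \<in> carrier H"
  shows "(of_real C)\<^sup>2 * ip H x x - ip H (S x) (S x) \<in> \<real>\<^sub>\<ge>\<^sub>0"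
proof -
  have "(hnorm H (S x))\<^sup>2 \<le> (C * hnorm H x)\<^sup>2"
    using C[OF x] S x by (intro power_mono) auto
  moreover have "(of_real C)\<^sup>2 * ip H x x - ip H (S x) (S x)
      = of_real ((C * hnorm H x)\<^sup>2 - (hnorm H (S x))\<^sup>2)"
    using S x by (simp add: ip_self power_mult_distrib)
  ultimately show ?thesis by (simp del: of_real_diff of_real_mult of_real_power)
qed

end

lemma sesquilinear_minus:
  "\<lbrakk>sesquilinear H q; sesquilinear H q'\<rbrakk> \<Longrightarrow> sesquilinear H (\<lambda>x y. q x y - q' x y)"
  unfolding sesquilinear_def by (simp add: algebra_simps)

lemma sesquilinear_scale: "sesquilinear H q \<Longrightarrow> sesquilinear H (\<lambda>x y. c * q x y)"
  unfolding sesquilinear_def by (simp add: algebra_simps)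

lemma form_product_pos:
  fixes a :: "nat \<Rightarrow> 'h" and b :: "nat \<Rightarrow> 'k"
  assumes "hilbert_space H" "hilbert_space K" "sesquilinear H q" "sesquilinear K s"
    and "\<And>x. x \<in> carrier H \<Longrightarrow> q x x \<in> \<real>\<^sub>\<ge>\<^sub>0" "\<And>x. x \<in> carrier K \<Longrightarrow> s x x \<in> \<real>\<^sub>\<ge>\<^sub>0"
    and "\<And>i. a i \<in> carrier H" "\<And>i. b i \<in> carrier K"
  shows "(\<Sum>i<n. \<Sum>j<n. q (a i) (a j) * s (b i) (b j)) \<in> \<real>\<^sub>\<ge>\<^sub>0"
proof -
  have "psd n (\<lambda>i j. q (a i) (a j))" by (rule hilbert_space.psd_sesquilinear[OF assms(1,3,5,7)])
  moreover have "psd n (\<lambda>i j. s (b i) (b j))" by (rule hilbert_space.psd_sesquilinear[OF assms(2,4,6,8)])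
  ultimately show ?thesis by (rule psd_entrywise_sum)
qed

text \<open>Realizations of the tensor product, together with the finite sums of elementary tensors that
  are dense in it.\<close>

locale tensor_product =
  H: hilbert_space H + K: hilbert_space K + W: hilbert_space W
  for H :: "'h inner_module" and K :: "'k inner_module" and W :: "'w inner_module" +
  fixes t :: "'h \<Rightarrow> 'k \<Rightarrow> 'w"
  assumes tensor: "hilbert_tensor H K W t"
begin

lemma t_in [simp]: "\<lbrakk>h \<in> carrier H; k \<in> carrier K\<rbrakk> \<Longrightarrow> t h k \<in> carrier W"
  using tensor unfolding hilbert_tensor_def linear_map_def by auto

lemma t_add_left: "\<lbrakk>h \<in> carrier H; h' \<in> carrier H; k \<in> carrier K\<rbrakk>
    \<Longrightarrow> t (h \<oplus>\<^bsub>H\<^esub> h') k = t h k \<oplus>\<^bsub>W\<^esub> t h' k"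
  using tensor unfolding hilbert_tensor_def linear_map_def by auto

lemma t_add_right: "\<lbrakk>h \<in> carrier H; k \<in> carrier K; k' \<in> carrier K\<rbrakk>
    \<Longrightarrow> t h (k \<oplus>\<^bsub>K\<^esub> k') = t h k \<oplus>\<^bsub>W\<^esub> t h k'"
  using tensor unfolding hilbert_tensor_def linear_map_def by auto

lemma t_smult_left: "\<lbrakk>h \<in> carrier H; k \<in> carrier K\<rbrakk> \<Longrightarrow> t (c \<odot>\<^bsub>H\<^esub> h) k = c \<odot>\<^bsub>W\<^esub> t h k"
  using tensor unfolding hilbert_tensor_def linear_map_def by auto

lemma t_smult_right: "\<lbrakk>h \<in> carrier H; k \<in> carrier K\<rbrakk> \<Longrightarrow> t h (c \<odot>\<^bsub>K\<^esub> k) = c \<odot>\<^bsub>W\<^esub> t h k"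
  using tensor unfolding hilbert_tensor_def linear_map_def by auto

lemma ip_t: "\<lbrakk>h \<in> carrier H; k \<in> carrier K; h' \<in> carrier H; k' \<in> carrier K\<rbrakk>
    \<Longrightarrow> ip W (t h k) (t h' k') = ip H h h' * ip K k k'"
  using tensor unfolding hilbert_tensor_def by auto

definition tsum :: "(nat \<Rightarrow> 'h) \<Rightarrow> (nat \<Rightarrow> 'k) \<Rightarrow> nat \<Rightarrow> 'w" where
  "tsum a b n = hsum W (\<lambda>i. t (a i) (b i)) n"

definition tsums :: "'w set" where
  "tsums = {tsum a b n | a b n. (\<forall>i. a i \<in> carrier H) \<and> (\<forall>i. b i \<in> carrier K)}"

lemma tsumsI: "\<lbrakk>\<And>i. a i \<in> carrier H; \<And>i. b i \<in> carrier K\<rbrakk> \<Longrightarrow> tsum a b n \<in> tsums"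
  unfolding tsums_def by blast

lemma tsum_in [simp]: "\<lbrakk>\<And>i. a i \<in> carrier H; \<And>i. b i \<in> carrier K\<rbrakk> \<Longrightarrow> tsum a b n \<in> carrier W"
  by (simp add: tsum_def)

lemma ip_tsum:
  assumes "\<And>i. a i \<in> carrier H" "\<And>i. b i \<in> carrier K" "\<And>i. a' i \<in> carrier H" "\<And>i. b' i \<in> carrier K"
  shows "ip W (tsum a b n) (tsum a' b' m) = (\<Sum>i<n. \<Sum>j<m. ip H (a i) (a' j) * ip K (b i) (b' j))"
  using assms unfolding tsum_def by (subst W.ip_hsum_left) (simp_all add: W.ip_hsum_right ip_t)

lemma tsum_append:
  assumes "\<And>i. a i \<in> carrier H" "\<And>i. b i \<in> carrier K" "\<And>i. a' i \<in> carrier H" "\<And>i. b' i \<in> carrier K"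
  shows "tsum a b n \<oplus>\<^bsub>W\<^esub> tsum a' b' m =
    tsum (\<lambda>i. if i < n then a i else a' (i - n)) (\<lambda>i. if i < n then b i else b' (i - n)) (n + m)"
proof -
  have "(\<lambda>i. t (if i < n then a i else a' (i - n)) (if i < n then b i else b' (i - n)))
     = (\<lambda>i. if i < n then t (a i) (b i) else t (a' (i - n)) (b' (i - n)))" by auto
  then show ?thesis
    unfolding tsum_def using W.hsum_append[of "\<lambda>i. t (a i) (b i)" "\<lambda>i. t (a' i) (b' i)" n m] assms by simp
qed

lemma tsum_smult:
  assumes "\<And>i. a i \<in> carrier H" "\<And>i. b i \<in> carrier K"
  shows "c \<odot>\<^bsub>W\<^esub> tsum a b n = tsum (\<lambda>i. c \<odot>\<^bsub>H\<^esub> a i) b n"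
  unfolding tsum_def using assms by (simp add: W.hsum_smult t_smult_left)

lemma tsums_subset: "x \<in> tsums \<Longrightarrow> x \<in> carrier W"
  unfolding tsums_def by auto

lemma tsums_add: 
  assumes "x \<in> tsums" "y \<in> tsums" shows "x \<oplus>\<^bsub>W\<^esub> y \<in> tsums"
proof -
  obtain a b n where x: "x = tsum a b n" "\<And>i. a i \<in> carrier H" "\<And>i. b i \<in> carrier K"
    using assms(1) unfolding tsums_def by auto
  obtain a' b' m where y: "y = tsum a' b' m" "\<And>i. a' i \<in> carrier H" "\<And>i. b' i \<in> carrier K"
    using assms(2) unfolding tsums_def by auto
  show ?thesis
    unfolding x(1) y(1) tsum_append[OF x(2,3) y(2,3)]
    by (rule tsumsI) (use x y in auto)
qed

lemma tsums_smult:
  assumes "x \<in> tsums" shows "c \<odot>\<^bsub>W\<^esub> x \<in> tsums"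
proof -
  obtain a b n where x: "x = tsum a b n" "\<And>i. a i \<in> carrier H" "\<And>i. b i \<in> carrier K"
    using assms(1) unfolding tsums_def by auto
  show ?thesis
    unfolding x(1) tsum_smult[OF x(2,3)] by (rule tsumsI) (use x in auto)
qed

lemma span_subset_tsums: "linear_span W {t h k | h k. h \<in> carrier H \<and> k \<in> carrier K} \<subseteq> tsums"
proof -
  have "submodule tsums complex_ring W"
  proof (rule W.submoduleI)
    show "tsums \<subseteq> carrier W" using tsums_subset by blast
    have "tsum (\<lambda>_. \<zero>\<^bsub>H\<^esub>) (\<lambda>_. \<zero>\<^bsub>K\<^esub>) 0 \<in> tsums" by (rule tsumsI) auto
    then show "\<zero>\<^bsub>W\<^esub> \<in> tsums" by (simp add: tsum_def)
    show "\<ominus>\<^bsub>W\<^esub> x \<in> tsums" if x: "x \<in> tsums" for x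
      using tsums_smult[OF x] tsums_subset[OF x] by (simp add: W.neg_conv_smult)
  qed (use tsums_add tsums_smult in auto)
  moreover have "t h k \<in> tsums" if "h \<in> carrier H" "k \<in> carrier K" for h k
  proof -
    have "tsum (\<lambda>_. h) (\<lambda>_. k) 1 \<in> tsums" by (rule tsumsI) (use that in auto)
    then show ?thesis using that by (simp add: tsum_def)
  qed
  ultimately show ?thesis unfolding linear_span_def by (intro Inter_lower) auto
qed

lemma tsums_dense:
  assumes "w \<in> carrier W"
  shows "\<exists>x. (\<forall>n. x n \<in> tsums) \<and> hlim W x w"
proof -
  have "w \<in> norm_topology W closure_of linear_span W {t h k | h k. h \<in> carrier H \<and> k \<in> carrier K}"
    using tensor assms unfolding hilbert_tensor_def by blast
  from W.closure_hlim[OF this] show ?thesis using span_subset_tsums by blast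
qed

text \<open>The operator \<open>S \<otimes> T\<close> is bounded by \<open>C D\<close> on finite sums of elementary tensors. The factor
  \<open>S\<close> is removed by Schur's theorem for the form \<open>C\<^sup>2\<langle>x, y\<rangle> - \<langle>S x, S y\<rangle>\<close> on \<open>H\<close> and
  \<open>\<langle>T x, T y\<rangle>\<close> on \<open>K\<close>, then the factor \<open>T\<close> in the same way.\<close>

lemma tsum_bound:
  assumes S: "bounded_op H S" and T: "bounded_op K T"
    and C: "C \<ge> 0" "\<And>x. x \<in> carrier H \<Longrightarrow> hnorm H (S x) \<le> C * hnorm H x"
    and D: "D \<ge> 0" "\<And>x. x \<in> carrier K \<Longrightarrow> hnorm K (T x) \<le> D * hnorm K x"
    and a: "\<And>i. a i \<in> carrier H" and b: "\<And>i. b i \<in> carrier K"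
  shows "hnorm W (tsum (\<lambda>i. S (a i)) (\<lambda>i. T (b i)) n) \<le> C * D * hnorm W (tsum a b n)"
proof -
  define F where "F = (\<lambda>q s. \<Sum>i<n. \<Sum>j<n. (q (a i) (a j) :: complex) * s (b i) (b j))"
  let ?qS = "\<lambda>x y. ip H (S x) (S y)" and ?sT = "\<lambda>x y. ip K (T x) (T y)"
  have 1: "F (\<lambda>x y. of_real (C\<^sup>2) * ip H x y - ?qS x y) ?sT \<in> \<real>\<^sub>\<ge>\<^sub>0"
    unfolding F_def
  proof (rule form_product_pos[where q = "\<lambda>x y. of_real (C\<^sup>2) * ip H x y - ?qS x y" and s = ?sT,
        OF H.hilbert_space_axioms K.hilbert_space_axioms])
    show "sesquilinear H (\<lambda>x y. of_real (C\<^sup>2) * ip H x y - ?qS x y)"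
      by (intro sesquilinear_minus sesquilinear_scale H.sesquilinear_ip H.sesquilinear_op_op S)
    show "sesquilinear K ?sT" by (intro K.sesquilinear_op_op T)
  qed (use a b T in \<open>auto intro!: H.bound_form_pos[OF S C(2)] K.ip_self_pos\<close>)
  have 2: "F (ip H) (\<lambda>x y. of_real (D\<^sup>2) * ip K x y - ?sT x y) \<in> \<real>\<^sub>\<ge>\<^sub>0"
    unfolding F_def
  proof (rule form_product_pos[where q = "ip H" and s = "\<lambda>x y. of_real (D\<^sup>2) * ip K x y - ?sT x y",
        OF H.hilbert_space_axioms K.hilbert_space_axioms])
    show "sesquilinear K (\<lambda>x y. of_real (D\<^sup>2) * ip K x y - ?sT x y)"
      by (intro sesquilinear_minus sesquilinear_scale K.sesquilinear_ip K.sesquilinear_op_op T)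
    show "sesquilinear H (ip H)" by (rule H.sesquilinear_ip)
  qed (use a b in \<open>auto intro!: K.bound_form_pos[OF T D(2)] H.ip_self_pos\<close>)
  have e1: "F (\<lambda>x y. of_real (C\<^sup>2) * ip H x y - ?qS x y) ?sT = of_real (C\<^sup>2) * F (ip H) ?sT - F ?qS ?sT"
    unfolding F_def by (simp add: left_diff_distrib sum_subtractf sum_distrib_left mult.assoc)
  have e2: "F (ip H) (\<lambda>x y. of_real (D\<^sup>2) * ip K x y - ?sT x y) = of_real (D\<^sup>2) * F (ip H) (ip K) - F (ip H) ?sT"
    unfolding F_def by (simp add: right_diff_distrib sum_subtractf sum_distrib_left mult.left_commute)
  have "Re (F ?qS ?sT) \<le> C\<^sup>2 * Re (F (ip H) ?sT)"
    using 1 unfolding e1 by (simp add: complex_nonneg_Reals_iff)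
  also have "\<dots> \<le> C\<^sup>2 * (D\<^sup>2 * Re (F (ip H) (ip K)))"
    using 2 unfolding e2 by (intro mult_left_mono) (simp_all add: complex_nonneg_Reals_iff)
  finally have "(hnorm W (tsum (\<lambda>i. S (a i)) (\<lambda>i. T (b i)) n))\<^sup>2 \<le> C\<^sup>2 * (D\<^sup>2 * (hnorm W (tsum a b n))\<^sup>2)"
    using a b S T by (simp add: W.hnorm_sq ip_tsum F_def)
  then have "(hnorm W (tsum (\<lambda>i. S (a i)) (\<lambda>i. T (b i)) n))\<^sup>2 \<le> (C * D * hnorm W (tsum a b n))\<^sup>2"
    by (simp add: power_mult_distrib mult.assoc)
  moreover have "0 \<le> C * D * hnorm W (tsum a b n)" using C(1) D(1) a b by simp
  ultimately show ?thesis by (rule power2_le_imp_le)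
qed

lemma tensor_op_exists:
  assumes S: "bounded_op H S" and T: "bounded_op K T"
  shows "\<exists>R. bounded_op W R \<and> (\<forall>h\<in>carrier H. \<forall>k\<in>carrier K. R (t h k) = t (S h) (T k))"
proof -
  obtain C where C: "C \<ge> 0" "\<And>x. x \<in> carrier H \<Longrightarrow> hnorm H (S x) \<le> C * hnorm H x"
    using H.bounded_op_bound[OF S] by blast
  obtain D where D: "D \<ge> 0" "\<And>x. x \<in> carrier K \<Longrightarrow> hnorm K (T x) \<le> D * hnorm K x"
    using K.bounded_op_bound[OF T] by blast
  define G where "G = {(tsum a b n, tsum (\<lambda>i. S (a i)) (\<lambda>i. T (b i)) n) | a b n.
    (\<forall>i. a i \<in> carrier H) \<and> (\<forall>i. b i \<in> carrier K)}"
  have G: "\<exists>a b n. x = tsum a b n \<and> y = tsum (\<lambda>i. S (a i)) (\<lambda>i. T (b i)) n \<and>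
      (\<forall>i. a i \<in> carrier H) \<and> (\<forall>i. b i \<in> carrier K)" if "(x, y) \<in> G" for x y
    using that unfolding G_def by auto
  have GI: "(tsum a b n, tsum (\<lambda>i. S (a i)) (\<lambda>i. T (b i)) n) \<in> G"
    if "\<And>i. a i \<in> carrier H" "\<And>i. b i \<in> carrier K" for a b n using that unfolding G_def by blast
  have "\<exists>R. bounded_op W R \<and> (\<forall>(x, y)\<in>G. R x = y)"
  proof (rule W.graph_extension)
    show "x \<in> carrier W \<and> y \<in> carrier W" if "(x, y) \<in> G" for x y using G[OF that] S T by auto
    show "hnorm W y \<le> C * D * hnorm W x" if "(x, y) \<in> G" for x y
      using G[OF that] tsum_bound[OF S T C D] by blast
    show "0 \<le> C * D" using C D by simp
    show "\<exists>x. (\<forall>n. x n \<in> Domain G) \<and> hlim W x w" if "w \<in> carrier W" for w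
    proof -
      have "tsums \<subseteq> Domain G" unfolding tsums_def using GI by blast
      then show ?thesis using tsums_dense[OF that] by blast
    qed
    show "(c \<odot>\<^bsub>W\<^esub> x, c \<odot>\<^bsub>W\<^esub> y) \<in> G" if "(x, y) \<in> G" for c x y
    proof -
      obtain a b n where x: "x = tsum a b n" "y = tsum (\<lambda>i. S (a i)) (\<lambda>i. T (b i)) n"
        "\<And>i. a i \<in> carrier H" "\<And>i. b i \<in> carrier K" using G[OF \<open>(x, y) \<in> G\<close>] by blast
      show ?thesis unfolding x(1,2)
        using GI[of "\<lambda>i. c \<odot>\<^bsub>H\<^esub> a i" b n] x(3,4) S T
        by (simp add: tsum_smult H.bounded_op_smult)
    qed
    show "(x \<oplus>\<^bsub>W\<^esub> x', y \<oplus>\<^bsub>W\<^esub> y') \<in> G" if g: "(x, y) \<in> G" "(x', y') \<in> G" for x y x' y'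
    proof -
      obtain a b n where x: "x = tsum a b n" "y = tsum (\<lambda>i. S (a i)) (\<lambda>i. T (b i)) n"
        "\<And>i. a i \<in> carrier H" "\<And>i. b i \<in> carrier K" using G[OF g(1)] by blast
      obtain a' b' m where x': "x' = tsum a' b' m" "y' = tsum (\<lambda>i. S (a' i)) (\<lambda>i. T (b' i)) m"
        "\<And>i. a' i \<in> carrier H" "\<And>i. b' i \<in> carrier K" using G[OF g(2)] by blast
      show ?thesis unfolding x(1,2) x'(1,2)
        using GI[of "\<lambda>i. if i < n then a i else a' (i - n)" "\<lambda>i. if i < n then b i else b' (i - n)" "n + m"]
          x(3,4) x'(3,4) S T
        by (simp add: tsum_append if_distrib[of S] if_distrib[of T])
    qed
  qed
  then obtain R where R0: "bounded_op W R" "\<forall>(x, y)\<in>G. R x = y" by blast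
  then have R: "bounded_op W R" "\<And>x y. (x, y) \<in> G \<Longrightarrow> R x = y" by auto
  have "R (t h k) = t (S h) (T k)" if "h \<in> carrier H" "k \<in> carrier K" for h k
    using R(2)[OF GI[of "\<lambda>_. h" "\<lambda>_. k" 1]] that S T by (simp add: tsum_def)
  then show ?thesis using R(1) by blast
qed

lemma op_tsum:
  assumes R: "bounded_op W R" and RST: "\<And>h k. \<lbrakk>h \<in> carrier H; k \<in> carrier K\<rbrakk> \<Longrightarrow> R (t h k) = t (S h) (T k)"
    and "\<And>i. a i \<in> carrier H" "\<And>i. b i \<in> carrier K"
  shows "R (tsum a b n) = tsum (\<lambda>i. S (a i)) (\<lambda>i. T (b i)) n"
  using assms by (simp add: tsum_def W.bounded_op_hsum)

lemma op_eqI: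
  assumes R: "bounded_op W R" and R': "bounded_op W R'"
    and eq: "\<And>h k. \<lbrakk>h \<in> carrier H; k \<in> carrier K\<rbrakk> \<Longrightarrow> R (t h k) = R' (t h k)"
  shows "R = R'"
proof (rule extensionalityI)
  show "R \<in> extensional (carrier W)" "R' \<in> extensional (carrier W)"
    using R R' unfolding bounded_op_def by auto
  fix w assume w: "w \<in> carrier W"
  obtain x where x: "\<And>n. x n \<in> tsums" "hlim W x w" using tsums_dense[OF w] by blast
  have "R y = R' y" if y: "y \<in> tsums" for y
  proof -
    obtain a b n where y: "y = tsum a b n" "\<And>i. a i \<in> carrier H" "\<And>i. b i \<in> carrier K"
      using y unfolding tsums_def by auto
    show ?thesis unfolding y(1) tsum_def using y(2,3)
      by (simp add: W.bounded_op_hsum R R' eq)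
  qed
  then have e: "R (x n) = R' (x n)" for n using x by simp
  show "R w = R' w"
  proof (rule W.hlim_unique)
    show "hlim W (\<lambda>n. R (x n)) (R w)" using W.bounded_op_hlim[OF R] x w tsums_subset by blast
    show "hlim W (\<lambda>n. R (x n)) (R' w)" unfolding e using W.bounded_op_hlim[OF R'] x w tsums_subset by blast
  qed (use x tsums_subset w R R' in auto)
qed

text \<open>With existence and uniqueness at hand, the definite description in the definition of
  \<open>tensor_op\<close> denotes what it should.\<close>

lemma tensor_op:
  assumes "bounded_op H S" "bounded_op K T"
  shows "bounded_op W (tensor_op H K W t S T)"
    and "\<lbrakk>h \<in> carrier H; k \<in> carrier K\<rbrakk> \<Longrightarrow> tensor_op H K W t S T (t h k) = t (S h) (T k)"
proof -
  let ?P = "\<lambda>R. bounded_op W R \<and> (\<forall>h\<in>carrier H. \<forall>k\<in>carrier K. R (t h k) = t (S h) (T k))"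
  obtain R where R: "?P R" using tensor_op_exists[OF assms] by blast
  have "?P (THE R. ?P R)"
    by (rule theI[of ?P, OF R], rule op_eqI) (use R in auto)
  then have *: "?P (tensor_op H K W t S T)" unfolding tensor_op_def .
  show "bounded_op W (tensor_op H K W t S T)" using * by blast
  show "tensor_op H K W t S T (t h k) = t (S h) (T k)" if "h \<in> carrier H" "k \<in> carrier K"
    using * that by blast
qed

lemma tensor_op_tsum:
  assumes "bounded_op H S" "bounded_op K T" "\<And>i. a i \<in> carrier H" "\<And>i. b i \<in> carrier K"
  shows "tensor_op H K W t S T (tsum a b n) = tsum (\<lambda>i. S (a i)) (\<lambda>i. T (b i)) n"
  using assms by (intro op_tsum tensor_op)

end

section \<open>Spatial correlations cannot be diffuse\<close>

definition pos_op :: "'h inner_module \<Rightarrow> ('h \<Rightarrow> 'h) \<Rightarrow> bool" where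
  "pos_op H T \<longleftrightarrow> bounded_op H T \<and> (\<forall>x\<in>carrier H. ip H (T x) x \<in> \<real>\<^sub>\<ge>\<^sub>0)"

text \<open>Positive operator-valued measures with finitely many outcomes; the condition that the operators
  sum to the identity is stated weakly.\<close>

definition povm :: "'h inner_module \<Rightarrow> 'c set \<Rightarrow> ('c \<Rightarrow> 'h \<Rightarrow> 'h) \<Rightarrow> bool" where
  "povm H S P \<longleftrightarrow> (\<forall>s\<in>S. pos_op H (P s)) \<and>
     (\<forall>h\<in>carrier H. \<forall>h'\<in>carrier H. (\<Sum>s\<in>S. ip H (P s h) h') = ip H h h')"

text \<open>Parallelogram law for a positive form, with the term for \<open>x - y\<close> dropped.\<close>

lemma (in hilbert_space) form_sum_le:
  assumes R: "bounded_op H R" and pos: "\<And>x. x \<in> carrier H \<Longrightarrow> 0 \<le> Re (ip H (R x) x)"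
    and x: "x \<in> carrier H" and y: "y \<in> carrier H"
  shows "Re (ip H (R (x \<oplus>\<^bsub>H\<^esub> y)) (x \<oplus>\<^bsub>H\<^esub> y)) \<le> 2 * Re (ip H (R x) x) + 2 * Re (ip H (R y) y)"
proof -
  have "0 \<le> Re (ip H (R (x \<ominus>\<^bsub>H\<^esub> y)) (x \<ominus>\<^bsub>H\<^esub> y))" using pos x y by simp
  then show ?thesis using x y R by (simp add: bounded_op_add bounded_op_diff ip_lin)
qed

lemma (in hilbert_space) form_hsum_le:
  assumes R: "bounded_op H R" and pos: "\<And>x. x \<in> carrier H \<Longrightarrow> 0 \<le> Re (ip H (R x) x)"
    and x: "\<And>i. x i \<in> carrier H"
  shows "Re (ip H (R (hsum H x n)) (hsum H x n)) \<le> 2 ^ n * (\<Sum>i<n. Re (ip H (R (x i)) (x i)))"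
proof (induction n)
  case 0 then show ?case using R by (simp add: bounded_op_zero)
next
  case (Suc n)
  have "Re (ip H (R (hsum H x (Suc n))) (hsum H x (Suc n)))
      \<le> 2 * Re (ip H (R (hsum H x n)) (hsum H x n)) + 2 * Re (ip H (R (x n)) (x n))"
    using form_sum_le[OF R pos, of "hsum H x n" "x n"] x by simp
  also have "\<dots> \<le> 2 * (2 ^ n * (\<Sum>i<n. Re (ip H (R (x i)) (x i)))) + 2 ^ Suc n * Re (ip H (R (x n)) (x n))"
  proof (intro add_mono mult_left_mono mult_right_mono Suc)
    show "(2::real) \<le> 2 ^ Suc n" using one_le_power[of "2::real" n] by simp
  qed (use pos x in auto)
  also have "\<dots> = 2 ^ Suc n * (\<Sum>i<Suc n. Re (ip H (R (x i)) (x i)))"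
    by (simp add: algebra_simps)
  finally show ?case .
qed

context tensor_product begin

lemma t_zero_right: "h \<in> carrier H \<Longrightarrow> t h \<zero>\<^bsub>K\<^esub> = \<zero>\<^bsub>W\<^esub>"
  by (rule W.ip_definite) (simp_all add: ip_t)

lemma t_hsum: "\<lbrakk>h \<in> carrier H; \<And>i. f i \<in> carrier K\<rbrakk> \<Longrightarrow> t h (hsum K f n) = hsum W (\<lambda>i. t h (f i)) n"
  by (induction n) (simp_all add: t_zero_right t_add_right)

lemma tsum_add:
  assumes "\<And>i. a i \<in> carrier H" "\<And>i. a' i \<in> carrier H" "\<And>i. b i \<in> carrier K"
  shows "tsum (\<lambda>i. a i \<oplus>\<^bsub>H\<^esub> a' i) b n = tsum a b n \<oplus>\<^bsub>W\<^esub> tsum a' b n"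
  using assms unfolding tsum_def by (induction n) (simp_all add: t_add_left W.a_ac)

lemma tsum_cong: "(\<And>i. i < n \<Longrightarrow> t (a i) (b i) = t (a' i) (b' i)) \<Longrightarrow> tsum a b n = tsum a' b' n"
  unfolding tsum_def by (rule hsum_cong)

text \<open>Gram-Schmidt orthonormalization of the second legs. A new second leg \<open>v\<close> is split into its
  projection \<open>u\<close>, which is absorbed by changing the first legs, and the remainder \<open>e\<close>.\<close>

lemma tsum_orthonormal:
  assumes a: "\<And>i. a i \<in> carrier H" and b: "\<And>i. b i \<in> carrier K"
  shows "\<exists>r a' k. (\<forall>i. a' i \<in> carrier H) \<and> (\<forall>i. k i \<in> carrier K) \<and>
    (\<forall>i<r. \<forall>j<r. ip K (k i) (k j) = (if i = j then 1 else 0)) \<and> tsum a b n = tsum a' k r"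
proof (induction n)
  case 0
  show ?case by (rule exI[of _ 0], rule exI[of _ a], rule exI[of _ b]) (simp add: a b tsum_def)
next
  case (Suc n)
  then obtain r a' k where IH0: "\<forall>i. a' i \<in> carrier H" "\<forall>i. k i \<in> carrier K"
    "\<forall>i<r. \<forall>j<r. ip K (k i) (k j) = (if i = j then 1 else 0)"
    "tsum a b n = tsum a' k r" by blast
  then have IH: "\<And>i. a' i \<in> carrier H" "\<And>i. k i \<in> carrier K"
    "\<And>i j. i < r \<Longrightarrow> j < r \<Longrightarrow> ip K (k i) (k j) = (if i = j then 1 else 0)"
    "tsum a b n = tsum a' k r" by simp_all
  define v where "v = b n"
  have v: "v \<in> carrier K" by (simp add: v_def b)
  define u where "u = hsum K (\<lambda>i. ip K v (k i) \<odot>\<^bsub>K\<^esub> k i) r"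
  have u: "u \<in> carrier K" unfolding u_def using IH by simp
  define e where "e = v \<ominus>\<^bsub>K\<^esub> u"
  have e: "e \<in> carrier K" using u v by (simp add: e_def)
  have e_orth: "ip K e (k j) = 0" if j: "j < r" for j
  proof -
    have "ip K u (k j) = (\<Sum>i<r. ip K v (k i) * (if i = j then 1 else 0))"
      unfolding u_def using IH j by (simp add: K.ip_hsum_left K.ip_lin)
    also have "\<dots> = (\<Sum>i<r. if i = j then ip K v (k i) else 0)" by (intro sum.cong) auto
    also have "\<dots> = ip K v (k j)" using j by simp
    finally show ?thesis using u v IH by (simp add: e_def K.ip_lin)
  qed
  define c where "c = (\<lambda>i. a' i \<oplus>\<^bsub>H\<^esub> ip K v (k i) \<odot>\<^bsub>H\<^esub> a n)"
  have c: "c i \<in> carrier H" for i using IH a by (simp add: c_def)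
  have "v = u \<oplus>\<^bsub>K\<^esub> e"
    by (rule K.ip_ext) (simp_all add: e_def u v K.ip_lin)
  then have "t (a n) v = t (a n) u \<oplus>\<^bsub>W\<^esub> t (a n) e" using u e a by (simp add: t_add_right)
  moreover have "t (a n) u = tsum (\<lambda>i. ip K v (k i) \<odot>\<^bsub>H\<^esub> a n) k r"
    unfolding u_def tsum_def using a IH by (subst t_hsum) (simp_all add: t_smult_left t_smult_right)
  ultimately have split: "tsum a b (Suc n) = tsum c k r \<oplus>\<^bsub>W\<^esub> t (a n) e"
    using IH a b e unfolding c_def
    by (subst tsum_add) (simp_all add: tsum_def[of a b "Suc n"] tsum_def[of a b n, symmetric] v_def W.a_assoc)
  show ?case
  proof (cases "e = \<zero>\<^bsub>K\<^esub>")
    case True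
    then have "tsum a b (Suc n) = tsum c k r" using split a c IH by (simp add: t_zero_right)
    then show ?thesis using c IH by blast
  next
    case False
    define N where "N = hnorm K e"
    have N: "N > 0" using False e K.hnorm_nonneg[OF e] by (simp add: N_def order_less_le)
    define k' where "k' = k(r := of_real (1 / N) \<odot>\<^bsub>K\<^esub> e)"
    define c' where "c' = c(r := of_real N \<odot>\<^bsub>H\<^esub> a n)"
    have k': "k' i \<in> carrier K" for i using IH e by (simp add: k'_def)
    have c': "c' i \<in> carrier H" for i using c a by (simp add: c'_def)
    have ee: "ip K e e = of_real (N\<^sup>2)" using e by (simp add: K.ip_self N_def)
    have "tsum c' k' (Suc r) = tsum c k r \<oplus>\<^bsub>W\<^esub> t (of_real N \<odot>\<^bsub>H\<^esub> a n) (of_real (1 / N) \<odot>\<^bsub>K\<^esub> e)"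
    proof -
      have "tsum c' k' r = tsum c k r" by (rule tsum_cong) (simp add: c'_def k'_def)
      then show ?thesis by (simp add: tsum_def c'_def k'_def)
    qed
    also have "t (of_real N \<odot>\<^bsub>H\<^esub> a n) (of_real (1 / N) \<odot>\<^bsub>K\<^esub> e) = t (a n) e"
      by (rule W.ip_ext) (use a e N in \<open>simp_all add: t_smult_left t_smult_right W.ip_lin\<close>)
    finally have "tsum a b (Suc n) = tsum c' k' (Suc r)" using split by simp
    moreover have "ip K (k' i) (k' j) = (if i = j then 1 else 0)" if ij: "i < Suc r" "j < Suc r" for i j
    proof -
      have e_orth': "ip K (k j) e = 0" if "j < r" for j
        using e_orth[OF that] K.ip_cnj[OF e IH(2)[of j]] by simp
      show ?thesis using ij IH e N
        by (auto simp: k'_def less_Suc_eq K.ip_lin e_orth e_orth' ee power2_eq_square)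
    qed
    ultimately show ?thesis using c' k' by blast
  qed
qed

lemma form_nonneg_by_density:
  assumes cont: "\<And>x l. \<lbrakk>\<And>n. x n \<in> carrier W; l \<in> carrier W; hlim W x l\<rbrakk> \<Longrightarrow> (\<lambda>n. \<phi> (x n)) \<longlonglongrightarrow> (\<phi> l :: real)"
    and nonneg: "\<And>a b n. \<lbrakk>\<And>i. a i \<in> carrier H; \<And>i. b i \<in> carrier K\<rbrakk> \<Longrightarrow> 0 \<le> \<phi> (tsum a b n)"
    and w: "w \<in> carrier W"
  shows "0 \<le> \<phi> w"
proof -
  obtain x where x: "\<And>n. x n \<in> tsums" "hlim W x w" using tsums_dense[OF w] by blast
  have "(\<lambda>n. \<phi> (x n)) \<longlonglongrightarrow> \<phi> w" using cont x w tsums_subset by blast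
  moreover have "0 \<le> \<phi> y" if "y \<in> tsums" for y using that nonneg unfolding tsums_def by auto
  then have "\<exists>N. \<forall>n\<ge>N. 0 \<le> \<phi> (x n)" using x(1) by blast
  ultimately show ?thesis by (rule LIMSEQ_le_const)
qed

text \<open>The heart of the argument. Two measurements that, in the state \<open>\<xi>\<close>, are perfectly correlated
  and uniformly distributed over \<open>N\<close> outcomes force \<open>N\<close> to be bounded by a constant that depends only
  on \<open>\<xi>\<close>.

  Choose \<open>\<eta> = \<Sum>\<^sub>i\<^sub><\<^sub>r a\<^sub>i \<otimes> k\<^sub>i\<close> close to \<open>\<xi>\<close> with orthonormal \<open>k\<^sub>i\<close>, and put
  \<open>\<delta> = \<eta> - \<xi>\<close>. For an outcome \<open>s\<close> let \<open>w\<^sub>s\<close> and \<open>p\<^sub>s\<close> be the quadratic forms of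
  \<open>P\<^sub>s \<otimes> Q\<^sub>s\<close> and \<open>P\<^sub>s \<otimes> 1\<close>, so that \<open>0 \<le> w\<^sub>s \<le> p\<^sub>s\<close>, and let
  \<open>\<tau>\<^sub>s = \<Sum>\<^sub>i \<langle>Q\<^sub>s k\<^sub>i, k\<^sub>i\<rangle>\<close>. Finite rank gives \<open>w\<^sub>s(\<eta>) \<le> 2\<^sup>r p\<^sub>s(\<eta>) \<tau>\<^sub>s\<close>, and
  \<open>p\<^sub>s(\<eta>)\<close> is of order \<open>1/N\<close> unless \<open>p\<^sub>s(\<delta>)\<close> is at least of that order. As
  \<open>w\<^sub>s(\<xi>) = 1/N\<close>, every outcome therefore has \<open>p\<^sub>s(\<delta>)\<close> of order \<open>1/N\<close> or \<open>\<tau>\<^sub>s\<close>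
  bounded below. But \<open>\<Sum>\<^sub>s p\<^sub>s(\<delta>) \<le> \<parallel>\<delta>\<parallel>\<^sup>2\<close> is small and \<open>\<Sum>\<^sub>s \<tau>\<^sub>s = r\<close> is fixed, so
  there cannot be many outcomes.\<close>

lemma uniform_correlation_bound:
  assumes xi: "\<xi> \<in> carrier W"
  shows "\<exists>B. \<forall>(S :: 'c set) P Q. finite S \<longrightarrow> S \<noteq> {} \<longrightarrow> povm H S P \<longrightarrow> povm K S Q \<longrightarrow>
      (\<forall>s\<in>S. ip W (tensor_op H K W t (P s) (Q s) \<xi>) \<xi> = of_real (1 / real (card S))) \<longrightarrow>
      (\<forall>s\<in>S. ip W (tensor_op H K W t (P s) (\<lambda>k\<in>carrier K. k) \<xi>) \<xi> = of_real (1 / real (card S))) \<longrightarrow>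
      real (card S) \<le> B"
proof -
  obtain x where x: "\<And>n. x n \<in> tsums" "hlim W x \<xi>" using tsums_dense[OF xi] by blast
  \<comment> \<open>Small enough that \<open>4 \<parallel>\<delta>\<parallel>\<^sup>2 < 1\<close> at the end.\<close>
  have "\<forall>\<^sub>F n in sequentially. hnorm W (x n \<ominus>\<^bsub>W\<^esub> \<xi>) < 1/4"
    using x(2) unfolding hlim_def by (rule order_tendstoD) simp
  then obtain n0 where n0: "hnorm W (x n0 \<ominus>\<^bsub>W\<^esub> \<xi>) < 1/4" by (auto simp: eventually_sequentially)
  obtain a0 b0 m where "x n0 = tsum a0 b0 m" "\<And>i. a0 i \<in> carrier H" "\<And>i. b0 i \<in> carrier K"
    using x(1)[of n0] unfolding tsums_def by auto
  then obtain r a k where "(\<forall>i. a i \<in> carrier H) \<and> (\<forall>i. k i \<in> carrier K) \<and>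
      (\<forall>i<r. \<forall>j<r. ip K (k i) (k j) = (if i = j then 1 else 0)) \<and> x n0 = tsum a k r"
    using tsum_orthonormal[of a0 b0 m] by metis
  then have ak: "\<And>i. a i \<in> carrier H" "\<And>i. k i \<in> carrier K"
      "\<And>i j. i < r \<Longrightarrow> j < r \<Longrightarrow> ip K (k i) (k j) = (if i = j then 1 else 0)"
      and xeta: "x n0 = tsum a k r" by auto
  define \<eta> where "\<eta> = tsum a k r"
  have eta: "\<eta> \<in> carrier W" using ak by (simp add: \<eta>_def)
  define \<delta> where "\<delta> = \<eta> \<ominus>\<^bsub>W\<^esub> \<xi>"
  have delta: "\<delta> \<in> carrier W" using eta xi by (simp add: \<delta>_def)
  have dn: "hnorm W \<delta> < 1/4" using n0 by (simp add: \<delta>_def \<eta>_def xeta)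
  have dn2: "(hnorm W \<delta>)\<^sup>2 \<le> 1/16"
    using power_mono[of "hnorm W \<delta>" "1/4" 2] dn delta by (simp add: power2_eq_square)
  \<comment> \<open>The constant for which the estimates in \<open>key\<close> below close up.\<close>
  define D :: real where "D = 10 * 2 ^ r"
  show ?thesis
  proof (rule exI[of _ "2 * D * real r"], intro allI impI)
    fix S :: "'c set" and P Q
    assume S: "finite S" "S \<noteq> {}"
      and P: "povm H S P" and Q: "povm K S Q"
      and wxi: "\<forall>s\<in>S. ip W (tensor_op H K W t (P s) (Q s) \<xi>) \<xi> = of_real (1 / real (card S))"
      and pxi: "\<forall>s\<in>S. ip W (tensor_op H K W t (P s) (\<lambda>k\<in>carrier K. k) \<xi>) \<xi> = of_real (1 / real (card S))"
    have sumP: "\<forall>h\<in>carrier H. \<forall>h'\<in>carrier H. (\<Sum>s\<in>S. ip H (P s h) h') = ip H h h'"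
      and sumQ: "\<forall>h\<in>carrier K. \<forall>h'\<in>carrier K. (\<Sum>s\<in>S. ip K (Q s h) h') = ip K h h'"
      using P Q by (auto simp: povm_def)
    define N where "N = real (card S)"
    have N: "N > 0" using S by (simp add: N_def card_gt_0_iff)
    define I where "I = (\<lambda>k\<in>carrier K. k)"
    have I: "bounded_op K I" unfolding I_def by (rule K.bounded_op_id)
    have Iv: "I v = v" if "v \<in> carrier K" for v using that by (simp add: I_def)
    have Pb: "bounded_op H (P s)" and Pp: "\<And>v. v \<in> carrier H \<Longrightarrow> ip H (P s v) v \<in> \<real>\<^sub>\<ge>\<^sub>0" if "s \<in> S" for s
      using P that unfolding povm_def pos_op_def by auto
    have Qb: "bounded_op K (Q s)" and Qp: "\<And>v. v \<in> carrier K \<Longrightarrow> ip K (Q s v) v \<in> \<real>\<^sub>\<ge>\<^sub>0" if "s \<in> S" for s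
      using Q that unfolding povm_def pos_op_def by auto
    define PQ where "PQ = (\<lambda>s. tensor_op H K W t (P s) (Q s))"
    define P1 where "P1 = (\<lambda>s. tensor_op H K W t (P s) I)"
    have PQb: "bounded_op W (PQ s)" if "s \<in> S" for s unfolding PQ_def using tensor_op(1) Pb Qb that by blast
    have P1b: "bounded_op W (P1 s)" if "s \<in> S" for s unfolding P1_def using tensor_op(1) Pb I that by blast
    define w where "w = (\<lambda>s z. Re (ip W (PQ s z) z))"
    define p where "p = (\<lambda>s z. Re (ip W (P1 s z) z))"
    have cont: "(\<lambda>n. Re (ip W (R (x n)) (x n))) \<longlonglongrightarrow> Re (ip W (R l) l)"
      if R: "bounded_op W R" and x: "\<And>n. x n \<in> carrier W" "l \<in> carrier W" "hlim W x l" for R x l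
      by (rule tendsto_Re[OF W.hlim_ip[OF _ _ W.bounded_op_hlim[OF R x] x]]) (use R x in auto)
    have w_tsum: "ip W (PQ s (tsum a b n)) (tsum a b n) = (\<Sum>i<n. \<Sum>j<n. ip H (P s (a i)) (a j) * ip K (Q s (b i)) (b j))"
      if "s \<in> S" "\<And>i. a i \<in> carrier H" "\<And>i. b i \<in> carrier K" for s n and a :: "nat \<Rightarrow> 'h" and b :: "nat \<Rightarrow> 'k"
      using that Pb[OF that(1)] Qb[OF that(1)] unfolding PQ_def by (simp add: tensor_op_tsum ip_tsum)
    have p_tsum: "ip W (P1 s (tsum a b n)) (tsum a b n) = (\<Sum>i<n. \<Sum>j<n. ip H (P s (a i)) (a j) * ip K (b i) (b j))"
      if "s \<in> S" "\<And>i. a i \<in> carrier H" "\<And>i. b i \<in> carrier K" for s n and a :: "nat \<Rightarrow> 'h" and b :: "nat \<Rightarrow> 'k"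
      using that Pb[OF that(1)] I unfolding P1_def by (simp add: tensor_op_tsum ip_tsum Iv)
    have w_nonneg: "0 \<le> w s z" if s: "s \<in> S" and z: "z \<in> carrier W" for s z
    proof (rule form_nonneg_by_density[OF _ _ z])
      show "(\<lambda>n. w s (x n)) \<longlonglongrightarrow> w s l" if "\<And>n. x n \<in> carrier W" "l \<in> carrier W" "hlim W x l" for x l
        unfolding w_def using cont[OF PQb[OF s]] that by blast
      fix a :: "nat \<Rightarrow> 'h" and b :: "nat \<Rightarrow> 'k" and n
      assume ab: "\<And>i. a i \<in> carrier H" "\<And>i. b i \<in> carrier K"
      have "ip W (PQ s (tsum a b n)) (tsum a b n) \<in> \<real>\<^sub>\<ge>\<^sub>0"
        unfolding w_tsum[OF s ab]
        by (rule form_product_pos[where q = "\<lambda>x y. ip H (P s x) y" and s = "\<lambda>x y. ip K (Q s x) y",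
              OF H.hilbert_space_axioms K.hilbert_space_axioms H.sesquilinear_op[OF Pb[OF s]]
                K.sesquilinear_op[OF Qb[OF s]] Pp[OF s] Qp[OF s] ab])
      then show "0 \<le> w s (tsum a b n)" by (simp add: w_def complex_nonneg_Reals_iff)
    qed
    have w_le_p: "w s z \<le> p s z" if s: "s \<in> S" and z: "z \<in> carrier W" for s z
    proof -
      have "0 \<le> p s z - w s z"
      proof (rule form_nonneg_by_density[OF _ _ z, of "\<lambda>z. p s z - w s z"])
        show "(\<lambda>n. p s (x n) - w s (x n)) \<longlonglongrightarrow> p s l - w s l"
          if "\<And>n. x n \<in> carrier W" "l \<in> carrier W" "hlim W x l" for x l
          unfolding w_def p_def by (intro tendsto_diff cont PQb P1b s that)
        fix a :: "nat \<Rightarrow> 'h" and b :: "nat \<Rightarrow> 'k" and n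
      assume ab: "\<And>i. a i \<in> carrier H" "\<And>i. b i \<in> carrier K"
        have Qc: "ip K v v - ip K (Q s v) v \<in> \<real>\<^sub>\<ge>\<^sub>0" if v: "v \<in> carrier K" for v
        proof -
          \<comment> \<open>\<open>1 - Q\<^sub>s\<close> is the sum of the other \<open>Q\<^sub>u\<close>.\<close>
          have "ip K v v - ip K (Q s v) v = (\<Sum>u\<in>S - {s}. ip K (Q u v) v)"
            using sumQ v s S by (simp add: sum_diff1 flip: sumQ)
          then show ?thesis using Qp v by (auto simp: complex_nonneg_Reals_iff intro!: sum_nonneg)
        qed
        have "(\<Sum>i<n. \<Sum>j<n. ip H (P s (a i)) (a j) * (ip K (b i) (b j) - ip K (Q s (b i)) (b j))) \<in> \<real>\<^sub>\<ge>\<^sub>0"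
          by (rule form_product_pos[where q = "\<lambda>x y. ip H (P s x) y" and s = "\<lambda>x y. ip K x y - ip K (Q s x) y",
              OF H.hilbert_space_axioms K.hilbert_space_axioms H.sesquilinear_op[OF Pb[OF s]]
                sesquilinear_minus[OF K.sesquilinear_ip K.sesquilinear_op[OF Qb[OF s]]] Pp[OF s] Qc ab])
        also have "(\<Sum>i<n. \<Sum>j<n. ip H (P s (a i)) (a j) * (ip K (b i) (b j) - ip K (Q s (b i)) (b j)))
            = ip W (P1 s (tsum a b n)) (tsum a b n) - ip W (PQ s (tsum a b n)) (tsum a b n)"
          unfolding w_tsum[OF s ab] p_tsum[OF s ab] by (simp add: right_diff_distrib sum_subtractf)
        finally show "0 \<le> p s (tsum a b n) - w s (tsum a b n)"
          by (simp add: w_def p_def complex_nonneg_Reals_iff)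
      qed
      then show ?thesis by simp
    qed
    have p_nonneg: "0 \<le> p s z" if "s \<in> S" "z \<in> carrier W" for s z
      using w_nonneg[OF that] w_le_p[OF that] by linarith
    have p_sum: "(\<Sum>s\<in>S. p s z) \<le> (hnorm W z)\<^sup>2" if z: "z \<in> carrier W" for z
    proof -
      have "0 \<le> (hnorm W z)\<^sup>2 - (\<Sum>s\<in>S. p s z)"
      proof (rule form_nonneg_by_density[OF _ _ z, of "\<lambda>z. (hnorm W z)\<^sup>2 - (\<Sum>s\<in>S. p s z)"])
        show "(\<lambda>n. (hnorm W (x n))\<^sup>2 - (\<Sum>s\<in>S. p s (x n))) \<longlonglongrightarrow> (hnorm W l)\<^sup>2 - (\<Sum>s\<in>S. p s l)"
          if "\<And>n. x n \<in> carrier W" "l \<in> carrier W" "hlim W x l" for x l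
          unfolding p_def by (intro tendsto_diff tendsto_sum cont P1b tendsto_power W.hlim_norm that)
        fix a :: "nat \<Rightarrow> 'h" and b :: "nat \<Rightarrow> 'k" and n
      assume ab: "\<And>i. a i \<in> carrier H" "\<And>i. b i \<in> carrier K"
        have "(\<Sum>s\<in>S. ip W (P1 s (tsum a b n)) (tsum a b n))
            = (\<Sum>s\<in>S. \<Sum>i<n. \<Sum>j<n. ip H (P s (a i)) (a j) * ip K (b i) (b j))"
          by (intro sum.cong refl) (simp add: p_tsum ab)
        also have "\<dots> = (\<Sum>i<n. \<Sum>s\<in>S. \<Sum>j<n. ip H (P s (a i)) (a j) * ip K (b i) (b j))"
          by (rule sum.swap)
        also have "\<dots> = (\<Sum>i<n. \<Sum>j<n. \<Sum>s\<in>S. ip H (P s (a i)) (a j) * ip K (b i) (b j))"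
          by (rule sum.cong[OF refl], rule sum.swap)
        also have "\<dots> = ip W (tsum a b n) (tsum a b n)"
          using sumP ab by (simp add: ip_tsum flip: sum_distrib_right)
        finally have "(\<Sum>s\<in>S. p s (tsum a b n)) = (hnorm W (tsum a b n))\<^sup>2"
          using ab by (simp add: p_def W.hnorm_sq flip: Re_sum)
        then show "0 \<le> (hnorm W (tsum a b n))\<^sup>2 - (\<Sum>s\<in>S. p s (tsum a b n))" by simp
      qed
      then show ?thesis by simp
    qed
    define \<tau> where "\<tau> = (\<lambda>s. \<Sum>i<r. Re (ip K (Q s (k i)) (k i)))"
    have tau_sum: "(\<Sum>s\<in>S. \<tau> s) = r"
    proof -
      have "(\<Sum>s\<in>S. \<tau> s) = (\<Sum>i<r. \<Sum>s\<in>S. Re (ip K (Q s (k i)) (k i)))"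
        unfolding \<tau>_def by (rule sum.swap)
      also have "\<dots> = (\<Sum>i<r. Re (ip K (k i) (k i)))"
        using sumQ ak by (simp flip: Re_sum)
      also have "\<dots> = r" using ak by simp
      finally show ?thesis .
    qed
    \<comment> \<open>A sum of \<open>r\<close> vectors costs a factor \<open>2\<^sup>r\<close>; on each elementary tensor the form factorizes.\<close>
    have w_eta: "w s \<eta> \<le> 2 ^ r * (p s \<eta> * \<tau> s)" if s: "s \<in> S" for s
    proof -
      define \<alpha> where "\<alpha> = (\<lambda>i. Re (ip H (P s (a i)) (a i)))"
      define \<beta> where "\<beta> = (\<lambda>i. Re (ip K (Q s (k i)) (k i)))"
      have al: "0 \<le> \<alpha> i" for i using Pp[OF s] ak by (simp add: \<alpha>_def complex_nonneg_Reals_iff)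
      have be: "0 \<le> \<beta> i" for i using Qp[OF s] ak by (simp add: \<beta>_def complex_nonneg_Reals_iff)
      \<comment> \<open>Only the diagonal survives because the \<open>k\<^sub>i\<close> are orthonormal.\<close>
      have p_eta: "p s \<eta> = (\<Sum>i<r. \<alpha> i)"
      proof -
        have "ip W (P1 s \<eta>) \<eta> = (\<Sum>i<r. \<Sum>j<r. ip H (P s (a i)) (a j) * (if i = j then 1 else 0))"
          unfolding \<eta>_def by (subst p_tsum[OF s]) (auto simp: ak intro!: sum.cong)
        also have "\<dots> = (\<Sum>i<r. \<Sum>j<r. if i = j then ip H (P s (a i)) (a j) else 0)"
          by (intro sum.cong) auto
        also have "\<dots> = (\<Sum>i<r. ip H (P s (a i)) (a i))" by simp
        finally show ?thesis by (simp add: p_def \<alpha>_def)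
      qed
      have "w s \<eta> \<le> 2 ^ r * (\<Sum>i<r. w s (t (a i) (k i)))"
        unfolding w_def \<eta>_def tsum_def
        by (rule W.form_hsum_le[OF PQb[OF s]]) (use w_nonneg[OF s] ak in \<open>auto simp: w_def\<close>)
      also have "(\<Sum>i<r. w s (t (a i) (k i))) = (\<Sum>i<r. \<alpha> i * \<beta> i)"
      proof (rule sum.cong[OF refl])
        fix i
        have "PQ s (t (a i) (k i)) = t (P s (a i)) (Q s (k i))"
          unfolding PQ_def using tensor_op(2)[OF Pb[OF s] Qb[OF s]] ak by blast
        then show "w s (t (a i) (k i)) = \<alpha> i * \<beta> i"
          using Pb[OF s] Qb[OF s] ak Pp[OF s, of "a i"]
          by (simp add: w_def \<alpha>_def \<beta>_def ip_t complex_nonneg_Reals_iff)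
      qed
      also have "(\<Sum>i<r. \<alpha> i * \<beta> i) \<le> (\<Sum>i<r. p s \<eta> * \<beta> i)"
      proof (intro sum_mono mult_right_mono be)
        show "\<alpha> i \<le> p s \<eta>" if "i \<in> {..<r}" for i
          unfolding p_eta using that al by (intro member_le_sum) auto
      qed
      also have "\<dots> = p s \<eta> * \<tau> s" by (simp add: \<tau>_def \<beta>_def sum_distrib_left)
      finally show ?thesis by simp
    qed
    have tau_nonneg: "0 \<le> \<tau> s" if "s \<in> S" for s
      unfolding \<tau>_def using Qp[OF that] ak by (intro sum_nonneg) (simp add: complex_nonneg_Reals_iff)
    \<comment> \<open>If both terms on the right were small, \<open>w\<^sub>s(\<xi>)\<close> would be smaller than \<open>1/N\<close>.\<close>
    have key: "1 / N \<le> 4 * p s \<delta> + D * \<tau> s / N" if s: "s \<in> S" for s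
    proof (rule ccontr)
      assume "\<not> ?thesis"
      then have less: "4 * p s \<delta> + D * \<tau> s / N < 1 / N" by simp
      have D: "D > 0" by (simp add: D_def)
      have p1: "4 * p s \<delta> < 1 / N" using less tau_nonneg[OF s] D N
        by (smt (verit) divide_nonneg_pos mult_nonneg_nonneg)
      have "D * \<tau> s / N < 1 / N" using less p_nonneg[OF s delta] by linarith
      then have p2: "D * \<tau> s < 1" using N by (simp add: divide_less_cancel)
      have wx: "w s \<xi> = 1 / N" "p s \<xi> = 1 / N"
        using wxi pxi s by (simp_all add: w_def p_def PQ_def P1_def I_def N_def)
      have "\<xi> = \<eta> \<oplus>\<^bsub>W\<^esub> (\<ominus>\<^bsub>W\<^esub> \<delta>)"
        by (rule W.ip_ext) (simp_all add: \<delta>_def xi eta W.ip_lin)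
      then have "1 / N \<le> 2 * w s \<eta> + 2 * w s (\<ominus>\<^bsub>W\<^esub> \<delta>)"
        using W.form_sum_le[OF PQb[OF s] _ eta, of "\<ominus>\<^bsub>W\<^esub> \<delta>"] w_nonneg[OF s] delta wx(1)
        by (simp add: w_def)
      moreover have "w s (\<ominus>\<^bsub>W\<^esub> \<delta>) = w s \<delta>"
        using PQb[OF s] delta by (simp add: w_def W.neg_conv_smult W.bounded_op_smult W.ip_lin)
      ultimately have A: "1 / N \<le> 2 * w s \<eta> + 2 * p s \<delta>" using w_le_p[OF s delta] by linarith
      have "\<eta> = \<xi> \<oplus>\<^bsub>W\<^esub> \<delta>" by (rule W.ip_ext) (simp_all add: \<delta>_def xi eta W.ip_lin)
      then have "p s \<eta> \<le> 2 / N + 2 * p s \<delta>"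
        using W.form_sum_le[OF P1b[OF s] _ xi delta] p_nonneg[OF s] wx(2) by (simp add: p_def)
      then have B: "p s \<eta> \<le> (5/2) * (1 / N)" using p1 by simp
      have "2 ^ r * (p s \<eta> * \<tau> s) \<le> 2 ^ r * ((5/2) * (1 / N) * \<tau> s)"
        using B tau_nonneg[OF s] by (intro mult_left_mono mult_right_mono) auto
      also have "\<dots> = (1 / 4) * (1 / N) * (D * \<tau> s)" by (simp add: D_def)
      also have "\<dots> < (1 / 4) * (1 / N) * 1" using p2 N by (intro mult_strict_left_mono) auto
      finally have "w s \<eta> < 1 / 4 * (1 / N)" using w_eta[OF s] by linarith
      then show False using A p1 by linarith
    qed
    have "1 = (\<Sum>s\<in>S. 1 / N)" using N by (simp add: N_def)
    also have "\<dots> \<le> (\<Sum>s\<in>S. 4 * p s \<delta> + D * \<tau> s / N)" by (rule sum_mono[OF key])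
    also have "\<dots> = 4 * (\<Sum>s\<in>S. p s \<delta>) + D * (\<Sum>s\<in>S. \<tau> s) / N"
      by (simp add: sum.distrib sum_distrib_left sum_divide_distrib)
    also have "\<dots> \<le> 4 * (1/16) + D * r / N"
      using p_sum[OF delta] dn2 tau_sum by simp
    finally have "1 / 2 \<le> D * r / N" by simp
    then show "real (card S) \<le> 2 * D * real r" using N by (simp add: N_def field_simps)
  qed
qed

end

lemma (in pre_hilbert) one_smult [simp]: "x \<in> carrier H \<Longrightarrow> 1 \<odot>\<^bsub>H\<^esub> x = x"
  using smult_one[of x] by simp

section \<open>Finite-dimensional Hilbert spaces\<close>

text \<open>A record that coordinates identify with \<open>\<complex>\<^sup>I\<close> is a Hilbert space. The locale serves both the
  spaces \<open>\<complex>\<^sup>n\<close> and \<open>L\<^sup>2\<close> of a point, whose elements are classes of functions.\<close>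

locale finite_coordinates =
  fixes H :: "'h inner_module" and \<phi> :: "'h \<Rightarrow> nat \<Rightarrow> complex" and I :: "nat set"
  assumes fin: "finite I"
    and bij: "bij_betw \<phi> (carrier H) {f. \<forall>i. i \<notin> I \<longrightarrow> f i = 0}"
    and add_in: "\<lbrakk>x \<in> carrier H; y \<in> carrier H\<rbrakk> \<Longrightarrow> x \<oplus>\<^bsub>H\<^esub> y \<in> carrier H"
    and coord_add: "\<lbrakk>x \<in> carrier H; y \<in> carrier H\<rbrakk> \<Longrightarrow> \<phi> (x \<oplus>\<^bsub>H\<^esub> y) i = \<phi> x i + \<phi> y i"
    and smult_in: "x \<in> carrier H \<Longrightarrow> c \<odot>\<^bsub>H\<^esub> x \<in> carrier H"
    and coord_smult: "x \<in> carrier H \<Longrightarrow> \<phi> (c \<odot>\<^bsub>H\<^esub> x) i = c * \<phi> x i"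
    and zero_in: "\<zero>\<^bsub>H\<^esub> \<in> carrier H"
    and coord_zero: "\<phi> \<zero>\<^bsub>H\<^esub> i = 0"
    and coord_ip: "\<lbrakk>x \<in> carrier H; y \<in> carrier H\<rbrakk> \<Longrightarrow> ip H x y = (\<Sum>i\<in>I. \<phi> x i * cnj (\<phi> y i))"
begin

lemma coord_eqI: "\<lbrakk>x \<in> carrier H; y \<in> carrier H; \<And>i. \<phi> x i = \<phi> y i\<rbrakk> \<Longrightarrow> x = y"
  using bij unfolding bij_betw_def inj_on_def by blast

lemma coord_outside: "\<lbrakk>x \<in> carrier H; i \<notin> I\<rbrakk> \<Longrightarrow> \<phi> x i = 0"
  using bij unfolding bij_betw_def by blast

lemma coord_surj: "(\<And>i. i \<notin> I \<Longrightarrow> f i = 0) \<Longrightarrow> \<exists>x\<in>carrier H. \<phi> x = f"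
proof -
  assume "\<And>i. i \<notin> I \<Longrightarrow> f i = 0"
  then have "f \<in> \<phi> ` carrier H" using bij unfolding bij_betw_def by simp
  then show ?thesis by blast
qed

lemma pre_hilbert: "pre_hilbert H"
proof (rule pre_hilbert.intro)
  show "module complex_ring H"
  proof (rule moduleI)
    show "cring complex_ring" by (rule cring_complex_ring)
    show "abelian_group H"
    proof (rule abelian_groupI)
      fix x assume x: "x \<in> carrier H"
      obtain y where y: "y \<in> carrier H" "\<phi> y = (\<lambda>i. - \<phi> x i)"
        using coord_surj[of "\<lambda>i. - \<phi> x i"] coord_outside[OF x] by auto
      have "y \<oplus>\<^bsub>H\<^esub> x = \<zero>\<^bsub>H\<^esub>"
        by (rule coord_eqI) (simp_all add: x y zero_in add_in coord_add coord_zero)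
      with y show "\<exists>y\<in>carrier H. y \<oplus>\<^bsub>H\<^esub> x = \<zero>\<^bsub>H\<^esub>" by blast
    qed (auto intro!: coord_eqI simp: add_in zero_in coord_add coord_zero)
  qed (auto intro!: coord_eqI simp: add_in smult_in coord_add coord_smult algebra_simps)
  show "pre_hilbert_axioms H"
  proof
    fix x y z c assume x: "x \<in> carrier H"
    show "0 \<le> Re (ip H x x)"
      using x by (simp add: coord_ip sum_nonneg flip: complex_norm_square)
    show "x = \<zero>\<^bsub>H\<^esub>" if "ip H x x = 0"
    proof (rule coord_eqI)
      have "(\<Sum>i\<in>I. (cmod (\<phi> x i))\<^sup>2) = Re (ip H x x)"
        using x by (simp add: coord_ip flip: complex_norm_square)
      then have "(\<Sum>i\<in>I. (cmod (\<phi> x i))\<^sup>2) = 0" using that by simp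
      then have "\<And>i. i \<in> I \<Longrightarrow> \<phi> x i = 0" using fin by (simp add: sum_nonneg_eq_0_iff)
      then show "\<phi> x i = \<phi> \<zero>\<^bsub>H\<^esub> i" for i using coord_outside[OF x] coord_zero by (cases "i \<in> I") auto
    qed (use x zero_in in auto)
    assume y: "y \<in> carrier H"
    show "ip H (c \<odot>\<^bsub>H\<^esub> x) y = c * ip H x y"
      using x y by (simp add: coord_ip smult_in coord_smult sum_distrib_left mult.assoc)
    show "ip H y x = cnj (ip H x y)"
      using x y by (simp add: coord_ip mult.commute)
    assume z: "z \<in> carrier H"
    show "ip H (x \<oplus>\<^bsub>H\<^esub> y) z = ip H x z + ip H y z"
      using x y z by (simp add: coord_ip add_in coord_add sum.distrib ring_distribs)
  qed
qed

sublocale P: pre_hilbert H by (rule pre_hilbert)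

lemma hnorm_coord: "x \<in> carrier H \<Longrightarrow> (hnorm H x)\<^sup>2 = (\<Sum>i\<in>I. (cmod (\<phi> x i))\<^sup>2)"
  by (simp add: P.hnorm_sq coord_ip flip: complex_norm_square)

lemma coord_diff: "\<lbrakk>x \<in> carrier H; y \<in> carrier H\<rbrakk> \<Longrightarrow> \<phi> (x \<ominus>\<^bsub>H\<^esub> y) i = \<phi> x i - \<phi> y i"
proof -
  assume xy: "x \<in> carrier H" "y \<in> carrier H"
  then show ?thesis by (simp add: P.diff_conv_smult coord_add coord_smult smult_in)
qed

lemma coord_le_hnorm: "x \<in> carrier H \<Longrightarrow> cmod (\<phi> x i) \<le> hnorm H x"
proof (cases "i \<in> I")
  case True
  assume x: "x \<in> carrier H"
  have "(cmod (\<phi> x i))\<^sup>2 \<le> (hnorm H x)\<^sup>2"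
    unfolding hnorm_coord[OF x] using True fin
    by (rule member_le_sum[where f = "\<lambda>i. (cmod (\<phi> x i))\<^sup>2", OF _ zero_le_power2])
  then show ?thesis by (rule power2_le_imp_le) (use x in simp)
qed (simp add: coord_outside)

lemma hlim_coord:
  assumes x: "\<And>n. x n \<in> carrier H" "l \<in> carrier H"
    and lim: "\<And>i. i \<in> I \<Longrightarrow> (\<lambda>n. \<phi> (x n) i) \<longlonglongrightarrow> \<phi> l i"
  shows "hlim H x l"
proof -
  have "(\<lambda>n. \<Sum>i\<in>I. (cmod (\<phi> (x n) i - \<phi> l i))\<^sup>2) \<longlonglongrightarrow> (\<Sum>i\<in>I. (cmod (\<phi> l i - \<phi> l i))\<^sup>2)"
    by (intro tendsto_sum tendsto_power tendsto_norm tendsto_diff lim tendsto_const)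
  then have "(\<lambda>n. (hnorm H (x n \<ominus>\<^bsub>H\<^esub> l))\<^sup>2) \<longlonglongrightarrow> 0"
    using x by (simp add: hnorm_coord coord_diff)
  then have "(\<lambda>n. sqrt ((hnorm H (x n \<ominus>\<^bsub>H\<^esub> l))\<^sup>2)) \<longlonglongrightarrow> sqrt 0" by (rule tendsto_real_sqrt)
  then show ?thesis using x by (simp add: hlim_def)
qed

lemma hilbert: "hilbert_space H"
proof (rule hilbert_space.intro)
  show "module complex_ring H" by (rule P.module_axioms)
  show "hilbert_space_axioms H"
  proof
    interpret Metric_space "carrier H" "hdist H" by (rule P.metric)
    show "mcomplete" unfolding mcomplete_def
    proof (intro allI impI)
      fix x assume "MCauchy x"
      then have x: "\<And>n. x n \<in> carrier H"
        and c: "\<And>e. e > 0 \<Longrightarrow> \<exists>N. \<forall>n m. N \<le> n \<longrightarrow> N \<le> m \<longrightarrow> hdist H (x n) (x m) < e"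
        unfolding MCauchy_def by auto
      have "\<exists>l. (\<lambda>n. \<phi> (x n) i) \<longlonglongrightarrow> l" for i
      proof -
        have "Cauchy (\<lambda>n. \<phi> (x n) i)"
        proof (rule CauchyI)
          fix e :: real assume "e > 0"
          from c[OF this] obtain N where N: "\<And>n m. N \<le> n \<Longrightarrow> N \<le> m \<Longrightarrow> hdist H (x n) (x m) < e" by blast
          have "norm (\<phi> (x m) i - \<phi> (x n) i) < e" if "m \<ge> N" "n \<ge> N" for m n
            using N[OF that] coord_le_hnorm[of "x m \<ominus>\<^bsub>H\<^esub> x n" i] x by (simp add: hdist_def coord_diff)
          then show "\<exists>M. \<forall>m\<ge>M. \<forall>n\<ge>M. norm (\<phi> (x m) i - \<phi> (x n) i) < e" by blast
        qed
        then show ?thesis using convergent_def Cauchy_convergent_iff by blast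
      qed
      then obtain f where f: "\<And>i. (\<lambda>n. \<phi> (x n) i) \<longlonglongrightarrow> f i" by metis
      have "f i = 0" if "i \<notin> I" for i
        using f[of i] coord_outside[OF x that] by (simp add: LIMSEQ_const_iff)
      then obtain l where l: "l \<in> carrier H" "\<phi> l = f" using coord_surj by blast
      have lim: "hlim H x l" by (rule hlim_coord[OF x l(1)]) (simp add: l f)
      have "limitin mtopology x l sequentially"
        unfolding limitin_metric
      proof (intro conjI l allI impI)
        fix e :: real assume "e > 0"
        with lim[unfolded hlim_def] have "\<forall>\<^sub>F n in sequentially. hnorm H (x n \<ominus>\<^bsub>H\<^esub> l) < e"
          by (rule order_tendstoD)
        then show "\<forall>\<^sub>F n in sequentially. x n \<in> carrier H \<and> hdist H (x n) l < e"
          using x l by (simp add: hdist_def)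
      qed
      then show "\<exists>x'. limitin mtopology x x' sequentially" by blast
    qed
  qed (fact P.ip_add P.ip_smult P.ip_cnj P.ip_nonneg P.ip_definite)+
qed

end

section \<open>Measures carried by a single point\<close>

text \<open>On a one-point probability space all functions are measurable, integration is evaluation, and
  \<open>L\<^sup>2\<close> is one-dimensional.\<close>

locale point_measure = prob_space M for M :: "'x measure" +
  fixes p :: 'x
  assumes space_eq: "space M = {p}"
begin

lemma measurable_all [simp]: "f \<in> borel_measurable M"
proof (rule measurableI)
  fix A
  have "f -` A \<inter> space M = {} \<or> f -` A \<inter> space M = space M" by (auto simp: space_eq)
  then show "f -` A \<inter> space M \<in> sets M" by auto
qed simp

lemma AE_point [simp]: "(AE x in M. P x) \<longleftrightarrow> P p"
proof -
  have "(AE x in M. P x) \<longleftrightarrow> (AE x in M. P p)"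
    by (rule AE_cong) (simp add: space_eq)
  then show ?thesis by simp
qed

lemma integral_point [simp]: "(LINT x|M. f x) = (f p :: complex)"
proof -
  have "(LINT x|M. f x) = (LINT x|M. f p)"
    by (rule Bochner_Integration.integral_cong) (simp_all add: space_eq)
  then show ?thesis by (simp add: prob_space)
qed

lemma integrable_point [simp]: "integrable M (f :: 'x \<Rightarrow> 'b :: {banach, second_countable_topology})"
proof -
  have "integrable M f \<longleftrightarrow> integrable M (\<lambda>x. f p)"
    by (rule Bochner_Integration.integrable_cong) (simp_all add: space_eq)
  then show ?thesis by simp
qed

text \<open>The class of functions with value \<open>c\<close> at the point; it identifies \<open>L\<^sup>2\<close> and \<open>L\<^sup>\<infinity>\<close> with
  \<open>\<complex>\<close>.\<close>

definition cls :: "complex \<Rightarrow> ('x \<Rightarrow> complex) set" where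
  "cls c = {g. g p = c}"

lemma ae_class_point [simp]: "ae_class M f = cls (f p)"
  unfolding ae_class_def cls_def by simp

lemma rep_cls [simp]: "rep (cls c) p = c"
proof -
  have "(\<lambda>_. c) \<in> cls c" by (simp add: cls_def)
  then have "(SOME f. f \<in> cls c) \<in> cls c" by (rule someI[of "\<lambda>f. f \<in> cls c"])
  then show ?thesis by (simp add: rep_def cls_def)
qed

lemma cls_inject [simp]: "cls c = cls d \<longleftrightarrow> c = d"
  using rep_cls by metis

lemma ess_bounded_point [simp]: "ess_bounded M = UNIV"
  unfolding ess_bounded_def by auto

lemma L2_point:
  "carrier (L2 M) = range cls" "\<zero>\<^bsub>L2 M\<^esub> = cls 0" "u \<oplus>\<^bsub>L2 M\<^esub> v = cls (rep u p + rep v p)"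
  "c \<odot>\<^bsub>L2 M\<^esub> u = cls (c * rep u p)" "ip (L2 M) u v = rep u p * cnj (rep v p)"
proof -
  have "cls c \<in> ae_class M ` {f \<in> borel_measurable M. integrable M (\<lambda>x. (norm (f x))\<^sup>2)}" for c
    by (rule image_eqI[of _ _ "\<lambda>_. c"]) auto
  then show "carrier (L2 M) = range cls" unfolding L2_def by auto
qed (simp_all add: L2_def)

lemma hilbert_L2: "hilbert_space (L2 M)"
proof -
  interpret finite_coordinates "L2 M" "\<lambda>u i. if i = 0 then rep u p else 0" "{0}"
  proof
    show "bij_betw (\<lambda>u i. if i = (0::nat) then rep u p else 0) (carrier (L2 M)) {f. \<forall>i. i \<notin> {0} \<longrightarrow> f i = 0}"
    proof (rule bij_betwI[of _ _ _ "\<lambda>f. cls (f 0)"])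
      show "(\<lambda>i. if i = (0::nat) then rep (cls (f 0)) p else 0) = f" if "f \<in> {f. \<forall>i. i \<notin> {0} \<longrightarrow> f i = 0}" for f
        using that by auto
    qed (auto simp: L2_point)
  qed (auto simp: L2_point)
  show ?thesis by (rule hilbert)
qed

end

text \<open>Over a point, \<open>L\<^sup>2(M) \<otimes> H\<close> is a copy of \<open>H\<close>: the map \<open>V\<close> below, \<open>h \<mapsto> 1 \<otimes> h\<close>, is unitary with
  inverse \<open>U\<close>. Hence the von Neumann tensor product consists of all bounded operators and the slice
  map of \<open>g\<close> is \<open>R \<mapsto> g(p) U R V\<close>.\<close>

locale point_tensor = point_measure M p + tensor_product "L2 M" H W t
  for M :: "'x measure" and p and H :: "'h inner_module" and W :: "'w inner_module" and t
begin

definition V :: "'h \<Rightarrow> 'w" where "V h = t (cls 1) h"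

lemma cls_in [simp]: "cls c \<in> carrier (L2 M)" by (simp add: L2_point)

lemma V_in [simp]: "h \<in> carrier H \<Longrightarrow> V h \<in> carrier W" by (simp add: V_def)

lemma t_eq_V: "\<lbrakk>u \<in> carrier (L2 M); h \<in> carrier H\<rbrakk> \<Longrightarrow> t u h = rep u p \<odot>\<^bsub>W\<^esub> V h"
  unfolding V_def by (subst t_smult_left[symmetric]) (auto simp: L2_point)

lemma ip_V: "\<lbrakk>h \<in> carrier H; h' \<in> carrier H\<rbrakk> \<Longrightarrow> ip W (V h) (V h') = ip H h h'"
  unfolding V_def by (simp add: ip_t) (simp add: L2_point)

lemma V_add: "\<lbrakk>h \<in> carrier H; h' \<in> carrier H\<rbrakk> \<Longrightarrow> V (h \<oplus>\<^bsub>H\<^esub> h') = V h \<oplus>\<^bsub>W\<^esub> V h'"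
  unfolding V_def by (simp add: t_add_right)

lemma V_smult: "h \<in> carrier H \<Longrightarrow> V (c \<odot>\<^bsub>H\<^esub> h) = c \<odot>\<^bsub>W\<^esub> V h"
  unfolding V_def by (simp add: t_smult_right)

lemma hnorm_V: "h \<in> carrier H \<Longrightarrow> hnorm W (V h) = hnorm H h"
  unfolding hnorm_def by (simp add: ip_V)

lemma V_diff: "\<lbrakk>h \<in> carrier H; h' \<in> carrier H\<rbrakk> \<Longrightarrow> V (h \<ominus>\<^bsub>H\<^esub> h') = V h \<ominus>\<^bsub>W\<^esub> V h'"
  by (simp add: K.diff_conv_smult W.diff_conv_smult V_add V_smult)

lemma V_zero: "V \<zero>\<^bsub>H\<^esub> = \<zero>\<^bsub>W\<^esub>"
  by (rule W.ip_definite) (simp_all add: ip_V)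

lemma tsums_V: "x \<in> tsums \<Longrightarrow> \<exists>h\<in>carrier H. x = V h"
proof -
  assume "x \<in> tsums"
  then obtain a b n where x: "x = tsum a b n" and a: "\<And>i. a i \<in> carrier (L2 M)" and b: "\<And>i. b i \<in> carrier H"
    unfolding tsums_def by auto
  have "tsum a b n = V (hsum H (\<lambda>i. rep (a i) p \<odot>\<^bsub>H\<^esub> b i) n)"
    unfolding tsum_def using a b by (induction n) (simp_all add: V_zero V_add V_smult t_eq_V)
  then show ?thesis using x b by auto
qed

text \<open>The range of the isometry \<open>V\<close> is closed by completeness of \<open>H\<close> and contains the dense set of
  finite sums of elementary tensors.\<close>

lemma V_surj:
  assumes w: "w \<in> carrier W"
  shows "\<exists>h\<in>carrier H. V h = w"
proof -
  obtain x where x: "\<And>n. x n \<in> tsums" "hlim W x w" using tsums_dense[OF w] by blast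
  have "\<forall>n. \<exists>h. h \<in> carrier H \<and> x n = V h" using tsums_V x by blast
  then obtain h where h: "\<And>n. h n \<in> carrier H" "\<And>n. x n = V (h n)" by metis
  have cauchy: "\<exists>N. \<forall>n\<ge>N. \<forall>m\<ge>N. hnorm H (h n \<ominus>\<^bsub>H\<^esub> h m) < e" if "e > 0" for e
  proof -
    have eq: "hnorm H (h n \<ominus>\<^bsub>H\<^esub> h m) = hnorm W (x n \<ominus>\<^bsub>W\<^esub> x m)" for n m
      unfolding h(2) using h(1) by (simp add: hnorm_V flip: V_diff)
    have "x n \<in> carrier W" for n unfolding h(2) using h(1) by simp
    from W.hlim_cauchy[OF this w x(2) that] show ?thesis unfolding eq .
  qed
  then obtain l where l: "l \<in> carrier H" "hlim H h l" 
    using K.hlim_ex[OF h(1) cauchy] by blast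
  have "hlim W x (V l)"
    using l h(1) unfolding hlim_def h(2) by (simp add: hnorm_V flip: V_diff)
  moreover have "x n \<in> carrier W" for n unfolding h(2) using h(1) by simp
  ultimately have "V l = w" using W.hlim_unique[of x "V l" w] x(2) l(1) w V_in by blast
  then show ?thesis using l by blast
qed

definition U :: "'w \<Rightarrow> 'h" where "U = inv_into (carrier H) V"

lemma U_in [simp]: "w \<in> carrier W \<Longrightarrow> U w \<in> carrier H"
  unfolding U_def using V_surj[of w] by (intro inv_into_into) auto

lemma V_U [simp]: "w \<in> carrier W \<Longrightarrow> V (U w) = w"
  unfolding U_def using V_surj[of w] by (intro f_inv_into_f) auto

lemma ip_U: "\<lbrakk>w \<in> carrier W; h \<in> carrier H\<rbrakk> \<Longrightarrow> ip H (U w) h = ip W w (V h)"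
  using ip_V[of "U w" h] by simp

lemma hnorm_U: "w \<in> carrier W \<Longrightarrow> hnorm H (U w) = hnorm W w"
  using hnorm_V[of "U w"] by simp

definition compress :: "complex \<Rightarrow> ('w \<Rightarrow> 'w) \<Rightarrow> 'h \<Rightarrow> 'h" where
  "compress c R = (\<lambda>h\<in>carrier H. c \<odot>\<^bsub>H\<^esub> U (R (V h)))"

lemma ip_compress:
  "\<lbrakk>bounded_op W R; h \<in> carrier H; h' \<in> carrier H\<rbrakk> \<Longrightarrow> ip H (compress c R h) h' = c * ip W (R (V h)) (V h')"
  by (simp add: compress_def K.ip_lin ip_U)

lemma bounded_compress:
  assumes R: "bounded_op W R"
  shows "bounded_op H (compress c R)"
proof -
  obtain C where C: "C \<ge> 0" "\<And>x. x \<in> carrier W \<Longrightarrow> hnorm W (R x) \<le> C * hnorm W x"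
    using W.bounded_op_bound[OF R] by blast
  have in_H: "compress c R h \<in> carrier H" if "h \<in> carrier H" for h
    using R that by (simp add: compress_def)
  show ?thesis
    unfolding bounded_op_def linear_map_def
  proof (intro conjI ballI allI)
    show "compress c R \<in> extensional (carrier H)" by (simp add: compress_def)
    show "compress c R \<in> carrier H \<rightarrow> carrier H" using in_H by blast
    show "compress c R (x \<oplus>\<^bsub>H\<^esub> y) = compress c R x \<oplus>\<^bsub>H\<^esub> compress c R y"
      if "x \<in> carrier H" "y \<in> carrier H" for x y
      by (rule K.ip_ext)
        (use that R in \<open>simp_all add: in_H ip_compress K.ip_lin V_add W.bounded_op_add W.ip_lin ring_distribs\<close>)
    show "compress c R (d \<odot>\<^bsub>H\<^esub> x) = d \<odot>\<^bsub>H\<^esub> compress c R x" if "x \<in> carrier H" for d x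
      by (rule K.ip_ext)
        (use that R in \<open>simp_all add: in_H ip_compress K.ip_lin V_smult W.bounded_op_smult W.ip_lin\<close>)
    show "\<exists>C. \<forall>x\<in>carrier H. hnorm H (compress c R x) \<le> C * hnorm H x"
    proof (intro exI ballI)
      fix x assume x: "x \<in> carrier H"
      have "hnorm H (compress c R x) = cmod c * hnorm W (R (V x))"
        using x R by (simp add: compress_def K.hnorm_smult hnorm_U)
      also have "\<dots> \<le> cmod c * (C * hnorm H x)"
        using C(2)[of "V x"] x by (intro mult_left_mono) (simp_all add: hnorm_V)
      finally show "hnorm H (compress c R x) \<le> cmod c * C * hnorm H x" by simp
    qed
  qed
qed

lemma mult_op_point: "u \<in> carrier (L2 M) \<Longrightarrow> mult_op M f u = cls (f p * rep u p)"
  by (simp add: mult_op_def)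

lemma bounded_mult_op: "bounded_op (L2 M) (mult_op M f)"
  unfolding bounded_op_def linear_map_def
proof (intro conjI ballI allI)
  show "mult_op M f \<in> extensional (carrier (L2 M))" by (simp add: mult_op_def)
  show "mult_op M f \<in> carrier (L2 M) \<rightarrow> carrier (L2 M)" by (auto simp: mult_op_point)
  show "mult_op M f (x \<oplus>\<^bsub>L2 M\<^esub> y) = mult_op M f x \<oplus>\<^bsub>L2 M\<^esub> mult_op M f y"
    if "x \<in> carrier (L2 M)" "y \<in> carrier (L2 M)" for x y
    using that by (auto simp: mult_op_point L2_point algebra_simps)
  show "mult_op M f (c \<odot>\<^bsub>L2 M\<^esub> x) = c \<odot>\<^bsub>L2 M\<^esub> mult_op M f x" if "x \<in> carrier (L2 M)" for c x
    using that by (auto simp: mult_op_point L2_point)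
  show "\<exists>C. \<forall>x\<in>carrier (L2 M). hnorm (L2 M) (mult_op M f x) \<le> C * hnorm (L2 M) x"
  proof (intro exI ballI)
    fix x assume x: "x \<in> carrier (L2 M)"
    have "mult_op M f x = f p \<odot>\<^bsub>L2 M\<^esub> x" using x by (simp add: mult_op_point L2_point)
    then show "hnorm (L2 M) (mult_op M f x) \<le> cmod (f p) * hnorm (L2 M) x"
      using x by (simp add: H.hnorm_smult)
  qed
qed

lemma elementary_op:
  assumes T: "bounded_op H T"
  shows "bounded_op W (tensor_op (L2 M) H W t (mult_op M f) T)"
    and "h \<in> carrier H \<Longrightarrow> tensor_op (L2 M) H W t (mult_op M f) T (V h) = f p \<odot>\<^bsub>W\<^esub> V (T h)"
proof -
  show "bounded_op W (tensor_op (L2 M) H W t (mult_op M f) T)"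
    by (rule tensor_op(1)[OF bounded_mult_op T])
  assume h: "h \<in> carrier H"
  show "tensor_op (L2 M) H W t (mult_op M f) T (V h) = f p \<odot>\<^bsub>W\<^esub> V (T h)"
    unfolding V_def[of h] using T h
    by (subst tensor_op(2)[OF bounded_mult_op T]) (simp_all add: mult_op_point t_eq_V)
qed

lemma compress_elementary:
  assumes T: "bounded_op H T"
  shows "compress c (tensor_op (L2 M) H W t (mult_op M f) T) = (\<lambda>h\<in>carrier H. (f p * c) \<odot>\<^bsub>H\<^esub> T h)"
proof
  fix h
  show "compress c (tensor_op (L2 M) H W t (mult_op M f) T) h = (\<lambda>h\<in>carrier H. (f p * c) \<odot>\<^bsub>H\<^esub> T h) h"
  proof (cases "h \<in> carrier H")
    case True
    show ?thesis
      by (rule K.ip_ext)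
        (use True T K.bounded_op_in[OF bounded_compress[OF elementary_op(1)[OF T]] True]
         in \<open>simp_all add: ip_compress elementary_op W.ip_lin K.ip_lin ip_V\<close>)
  qed (simp add: compress_def)
qed

text \<open>Every bounded operator is an elementary tensor \<open>1 \<otimes> T\<close>. Therefore the values of a slice map
  on elementary tensors determine it.\<close>

lemma op_eq_elementary:
  assumes R: "bounded_op W R"
  shows "R = tensor_op (L2 M) H W t (mult_op M (\<lambda>_. 1)) (compress 1 R)"
proof (rule op_eqI[OF R elementary_op(1)[OF bounded_compress[OF R]]])
  fix u h assume u: "u \<in> carrier (L2 M)" and h: "h \<in> carrier H"
  have "V (compress 1 R h) = R (V h)" using R h by (simp add: compress_def V_smult)
  then show "R (t u h) = tensor_op (L2 M) H W t (mult_op M (\<lambda>_. 1)) (compress 1 R) (t u h)"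
    using u h R bounded_compress[OF R]
    by (simp add: t_eq_V W.bounded_op_smult elementary_op(1) elementary_op(2))
qed

lemma carrier_vN: "carrier (vN_tensor M H W t) = {R. bounded_op W R}"
proof -
  let ?S = "linear_span (bounded_ops W)
     {tensor_op (L2 M) H W t (mult_op M f) T | f T. f \<in> ess_bounded M \<and> T \<in> carrier (bounded_ops H)}"
  have c: "carrier (vN_tensor M H W t) = ultraweak W closure_of ?S" by (simp add: vN_tensor_def)
  have top: "topspace (ultraweak W) = {R. bounded_op W R}"
    by (simp add: ultraweak_def topspace_pullback_topology bounded_ops_def) auto
  have "{R. bounded_op W R} \<subseteq> ?S"
  proof
    fix R assume "R \<in> {R. bounded_op W R}"
    then have R: "bounded_op W R" by simp
    have "R \<in> {tensor_op (L2 M) H W t (mult_op M f) T | f T. f \<in> ess_bounded M \<and> T \<in> carrier (bounded_ops H)}"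
      using op_eq_elementary[OF R] bounded_compress[OF R] by (auto simp: bounded_ops_def)
    then show "R \<in> ?S" unfolding linear_span_def by blast
  qed
  then have "{R. bounded_op W R} \<subseteq> ultraweak W closure_of ?S"
    using closure_of_subset_Int[of "ultraweak W" ?S] top by blast
  moreover have "ultraweak W closure_of ?S \<subseteq> {R. bounded_op W R}"
    using closure_of_subset_topspace[of "ultraweak W" ?S] top by simp
  ultimately show ?thesis using c by blast
qed

lemma square_summable_V:
  "\<xi> \<in> square_summable H \<Longrightarrow> (\<lambda>n. V (\<xi> n)) \<in> square_summable W"
  unfolding square_summable_def by (auto simp: hnorm_V image_subset_iff)

lemma summable_form:
  assumes R: "bounded_op W R" and \<xi>: "\<xi> \<in> square_summable W" and \<eta>: "\<eta> \<in> square_summable W"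
  shows "summable (\<lambda>n. ip W (R (\<xi> n)) (\<eta> n))"
proof -
  have c: "\<xi> n \<in> carrier W" "\<eta> n \<in> carrier W" for n using \<xi> \<eta> by (auto simp: square_summable_def)
  obtain C where C: "C \<ge> 0" "\<And>x. x \<in> carrier W \<Longrightarrow> hnorm W (R x) \<le> C * hnorm W x"
    using W.bounded_op_bound[OF R] by blast
  show ?thesis
  proof (rule summable_comparison_test', rule summable_mult)
    show "summable (\<lambda>n. (hnorm W (\<xi> n))\<^sup>2 + (hnorm W (\<eta> n))\<^sup>2)"
      using \<xi> \<eta> by (intro summable_add) (auto simp: square_summable_def)
    fix n assume "(0::nat) \<le> n"
    have "cmod (ip W (R (\<xi> n)) (\<eta> n)) \<le> hnorm W (R (\<xi> n)) * hnorm W (\<eta> n)"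
      using c R by (intro W.cauchy_schwarz) auto
    also have "\<dots> \<le> (C * hnorm W (\<xi> n)) * hnorm W (\<eta> n)"
      using c C by (intro mult_right_mono) auto
    also have "\<dots> = C * (hnorm W (\<xi> n) * hnorm W (\<eta> n))" by simp
    also have "\<dots> \<le> C * ((hnorm W (\<xi> n))\<^sup>2 + (hnorm W (\<eta> n))\<^sup>2)"
    proof (rule mult_left_mono[OF _ C(1)])
      have "0 \<le> (hnorm W (\<xi> n))\<^sup>2 + (hnorm W (\<eta> n))\<^sup>2" by simp
      moreover have "2 * hnorm W (\<xi> n) * hnorm W (\<eta> n) \<le> (hnorm W (\<xi> n))\<^sup>2 + (hnorm W (\<eta> n))\<^sup>2"
        by (rule sum_squares_bound)
      ultimately show "hnorm W (\<xi> n) * hnorm W (\<eta> n) \<le> (hnorm W (\<xi> n))\<^sup>2 + (hnorm W (\<eta> n))\<^sup>2"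
        by linarith
    qed
    finally show "norm (ip W (R (\<xi> n)) (\<eta> n)) \<le> C * ((hnorm W (\<xi> n))\<^sup>2 + (hnorm W (\<eta> n))\<^sup>2)" .
  qed
qed

text \<open>Conjugation by \<open>V\<close> carries the normal functional of the sequences \<open>\<xi>, \<eta>\<close> to that of
  \<open>V \<xi>, V \<eta>\<close>.\<close>

lemma continuous_compress:
  "continuous_map (subtopology (ultraweak W) (carrier (vN_tensor M H W t))) (ultraweak H)
     (\<lambda>R\<in>carrier (vN_tensor M H W t). compress c R)"
proof -
  let ?T = "subtopology (ultraweak W) (carrier (vN_tensor M H W t))"
  let ?L = "\<lambda>R\<in>carrier (vN_tensor M H W t). compress c R"
  let ?J = "square_summable H \<times> square_summable H"
  let ?FW = "\<lambda>T. \<lambda>(\<xi>, \<eta>)\<in>square_summable W \<times> square_summable W. \<Sum>n. ip W (T (\<xi> n)) (\<eta> n)"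
  let ?FH = "\<lambda>T. \<lambda>(\<xi>, \<eta>)\<in>?J. \<Sum>n. ip H (T (\<xi> n)) (\<eta> n)"
  have top: "topspace ?T = {R. bounded_op W R}"
    by (auto simp: ultraweak_def topspace_pullback_topology bounded_ops_def carrier_vN)
  show ?thesis
    unfolding ultraweak_def[of H]
  proof (rule continuous_map_pullback')
    show "topspace ?T \<subseteq> ?L -` carrier (bounded_ops H)"
      by (auto simp: top carrier_vN bounded_ops_def bounded_compress)
    show "continuous_map ?T (product_topology (\<lambda>_. euclidean) ?J) (?FH \<circ> ?L)"
      unfolding continuous_map_componentwise
    proof (intro conjI ballI)
      show "(?FH \<circ> ?L) ` topspace ?T \<subseteq> extensional ?J" by auto
      fix k assume k: "k \<in> ?J"
      obtain \<xi> \<eta> where k_eq: "k = (\<xi>, \<eta>)" and \<xi>: "\<xi> \<in> square_summable H" and \<eta>: "\<eta> \<in> square_summable H"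
        using k by auto
      have in_H: "\<xi> n \<in> carrier H" "\<eta> n \<in> carrier H" for n using \<xi> \<eta> by (auto simp: square_summable_def)
      let ?k' = "(\<lambda>n. V (\<xi> n), \<lambda>n. V (\<eta> n))"
      have k': "?k' \<in> square_summable W \<times> square_summable W"
        using \<xi> \<eta> by (simp add: square_summable_V)
      have "continuous_map (ultraweak W) euclidean ((\<lambda>x. x ?k') \<circ> ?FW)"
        unfolding ultraweak_def
        by (rule continuous_map_pullback, rule continuous_map_product_projection[OF k'])
      then have "continuous_map ?T euclidean ((\<lambda>x. x ?k') \<circ> ?FW)"
        by (rule continuous_map_from_subtopology)
      moreover have "continuous_map euclidean euclidean (\<lambda>z::complex. c * z)"
        unfolding continuous_map_iff_continuous2 by (intro continuous_intros)
      ultimately have "continuous_map ?T euclidean ((\<lambda>z. c * z) \<circ> ((\<lambda>x. x ?k') \<circ> ?FW))"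
        by (rule continuous_map_compose)
      then have "continuous_map ?T euclidean (\<lambda>R. c * ((\<lambda>x. x ?k') \<circ> ?FW) R)"
        by (simp add: comp_def)
      then show "continuous_map ?T euclidean (\<lambda>R. (?FH \<circ> ?L) R k)"
      proof (rule continuous_map_eq)
        fix R assume "R \<in> topspace ?T"
        then have R: "bounded_op W R" unfolding top by simp
        have "(?FH \<circ> ?L) R k = (\<Sum>n. ip H (compress c R (\<xi> n)) (\<eta> n))"
          using k R by (simp add: k_eq carrier_vN)
        also have "\<dots> = (\<Sum>n. c * ip W (R (V (\<xi> n))) (V (\<eta> n)))"
          using R in_H by (simp add: ip_compress)
        also have "\<dots> = c * (\<Sum>n. ip W (R (V (\<xi> n))) (V (\<eta> n)))"
          using summable_form[OF R] k' by (intro suminf_mult) simp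
        finally show "c * ((\<lambda>x. x ?k') \<circ> ?FW) R = (?FH \<circ> ?L) R k" using k' by simp
      qed
    qed
  qed
qed

lemma slice_map_eq:
  assumes R: "bounded_op W R"
  shows "slice_map M H W t g R = compress (g p) R"
proof -
  define L where "L = (\<lambda>R\<in>carrier (vN_tensor M H W t). compress (g p) R)"
  let ?Q = "\<lambda>L. L \<in> extensional (carrier (vN_tensor M H W t)) \<and>
     linear_map (vN_tensor M H W t) (bounded_ops H) L \<and>
     continuous_map (subtopology (ultraweak W) (carrier (vN_tensor M H W t))) (ultraweak H) L \<and>
     (\<forall>f\<in>ess_bounded M. \<forall>T\<in>carrier (bounded_ops H).
        L (tensor_op (L2 M) H W t (mult_op M f) T) = (LINT x|M. f x * g x) \<odot>\<^bsub>bounded_ops H\<^esub> T)"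
  have L_eq: "L R = compress (g p) R" if "bounded_op W R" for R
    using that by (simp add: L_def carrier_vN)
  have bop: "carrier (bounded_ops H) = {T. bounded_op H T}" by (simp add: bounded_ops_def)
  have QL: "?Q L"
  proof (intro conjI ballI)
    show "L \<in> extensional (carrier (vN_tensor M H W t))" by (simp add: L_def)
    show "continuous_map (subtopology (ultraweak W) (carrier (vN_tensor M H W t))) (ultraweak H) L"
      unfolding L_def by (rule continuous_compress)
    fix f T assume "T \<in> carrier (bounded_ops H)"
    then have T: "bounded_op H T" by (simp add: bop)
    show "L (tensor_op (L2 M) H W t (mult_op M f) T) = (LINT x|M. f x * g x) \<odot>\<^bsub>bounded_ops H\<^esub> T"
      using T by (simp add: L_eq elementary_op(1) compress_elementary bounded_ops_def)
  next
    have sum_op: "bounded_op W (\<lambda>x\<in>carrier W. R x \<oplus>\<^bsub>W\<^esub> R' x)" if R: "bounded_op W R" and R': "bounded_op W R'" for R R'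
    proof -
      obtain C where C: "C \<ge> 0" "\<And>x. x \<in> carrier W \<Longrightarrow> hnorm W (R x) \<le> C * hnorm W x"
        using W.bounded_op_bound[OF R] by blast
      obtain C' where C': "C' \<ge> 0" "\<And>x. x \<in> carrier W \<Longrightarrow> hnorm W (R' x) \<le> C' * hnorm W x"
        using W.bounded_op_bound[OF R'] by blast
      have "hnorm W (R x \<oplus>\<^bsub>W\<^esub> R' x) \<le> (C + C') * hnorm W x" if "x \<in> carrier W" for x
        using W.hnorm_triangle[of "R x" "R' x"] C(2)[OF that] C'(2)[OF that] R R' that
        by (simp add: ring_distribs)
      then show ?thesis
        unfolding bounded_op_def linear_map_def using R R'
        by (auto simp: W.bounded_op_add W.bounded_op_smult W.a_ac W.smult_r_distr)
    qed
    have scale_op: "bounded_op W (\<lambda>x\<in>carrier W. d \<odot>\<^bsub>W\<^esub> R x)" if R: "bounded_op W R" for R d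
    proof -
      obtain C where C: "C \<ge> 0" "\<And>x. x \<in> carrier W \<Longrightarrow> hnorm W (R x) \<le> C * hnorm W x"
        using W.bounded_op_bound[OF R] by blast
      have "hnorm W (d \<odot>\<^bsub>W\<^esub> R x) \<le> (cmod d * C) * hnorm W x" if "x \<in> carrier W" for x
        using mult_left_mono[OF C(2)[OF that], of "cmod d"] R that by (simp add: W.hnorm_smult)
      moreover have "d \<odot>\<^bsub>W\<^esub> (e \<odot>\<^bsub>W\<^esub> z) = e \<odot>\<^bsub>W\<^esub> (d \<odot>\<^bsub>W\<^esub> z)" if "z \<in> carrier W" for e z
        by (rule W.ip_ext) (simp_all add: that W.ip_lin)
      ultimately show ?thesis
        unfolding bounded_op_def linear_map_def using R
        by (auto simp: W.bounded_op_add W.bounded_op_smult W.smult_r_distr)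
    qed
    have cin: "compress (g p) R h \<in> carrier H" if "bounded_op W R" "h \<in> carrier H" for R h
      using K.bounded_op_in[OF bounded_compress[OF that(1)] that(2)] .
    have ops: "\<And>R R'. R \<oplus>\<^bsub>vN_tensor M H W t\<^esub> R' = (\<lambda>x\<in>carrier W. R x \<oplus>\<^bsub>W\<^esub> R' x)"
      "\<And>d R. d \<odot>\<^bsub>vN_tensor M H W t\<^esub> R = (\<lambda>x\<in>carrier W. d \<odot>\<^bsub>W\<^esub> R x)"
      "\<And>R R'. R \<oplus>\<^bsub>bounded_ops H\<^esub> R' = (\<lambda>x\<in>carrier H. R x \<oplus>\<^bsub>H\<^esub> R' x)"
      "\<And>d R. d \<odot>\<^bsub>bounded_ops H\<^esub> R = (\<lambda>x\<in>carrier H. d \<odot>\<^bsub>H\<^esub> R x)"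
      by (simp_all add: vN_tensor_def bounded_ops_def)
    show "linear_map (vN_tensor M H W t) (bounded_ops H) L"
      unfolding linear_map_def
    proof (intro conjI ballI allI)
      show "L \<in> carrier (vN_tensor M H W t) \<rightarrow> carrier (bounded_ops H)"
        by (auto simp: carrier_vN bop L_eq bounded_compress)
      fix R assume "R \<in> carrier (vN_tensor M H W t)"
      then have R: "bounded_op W R" by (simp add: carrier_vN)
      show "L (d \<odot>\<^bsub>vN_tensor M H W t\<^esub> R) = d \<odot>\<^bsub>bounded_ops H\<^esub> L R" for d
        unfolding ops L_eq[OF R] L_eq[OF scale_op[OF R]]
      proof (rule extensionalityI[of _ "carrier H"])
        fix h assume h: "h \<in> carrier H"
        show "compress (g p) (\<lambda>x\<in>carrier W. d \<odot>\<^bsub>W\<^esub> R x) h = (\<lambda>x\<in>carrier H. d \<odot>\<^bsub>H\<^esub> compress (g p) R x) h"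
          by (rule K.ip_ext)
            (use h R in \<open>simp_all add: cin scale_op ip_compress K.ip_lin W.ip_lin\<close>)
      qed (simp_all add: compress_def)
      fix R' assume "R' \<in> carrier (vN_tensor M H W t)"
      then have R': "bounded_op W R'" by (simp add: carrier_vN)
      show "L (R \<oplus>\<^bsub>vN_tensor M H W t\<^esub> R') = L R \<oplus>\<^bsub>bounded_ops H\<^esub> L R'"
        unfolding ops L_eq[OF R] L_eq[OF R'] L_eq[OF sum_op[OF R R']]
      proof (rule extensionalityI[of _ "carrier H"])
        fix h assume h: "h \<in> carrier H"
        show "compress (g p) (\<lambda>x\<in>carrier W. R x \<oplus>\<^bsub>W\<^esub> R' x) h
            = (\<lambda>x\<in>carrier H. compress (g p) R x \<oplus>\<^bsub>H\<^esub> compress (g p) R' x) h"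
          by (rule K.ip_ext)
            (use h R R' in \<open>simp_all add: cin sum_op ip_compress K.ip_lin W.ip_lin ring_distribs\<close>)
      qed (simp_all add: compress_def)
    qed
  qed
  moreover have "L' = L" if Q': "?Q L'" for L'
  proof (rule extensionalityI[of _ "carrier (vN_tensor M H W t)"])
    show "L' \<in> extensional (carrier (vN_tensor M H W t))" using Q' by blast
    show "L \<in> extensional (carrier (vN_tensor M H W t))" by (simp add: L_def)
    fix R assume "R \<in> carrier (vN_tensor M H W t)"
    then have R: "bounded_op W R" by (simp add: carrier_vN)
    have T: "compress 1 R \<in> carrier (bounded_ops H)" using bounded_compress[OF R] by (simp add: bop)
    have "L' (tensor_op (L2 M) H W t (mult_op M (\<lambda>_. 1)) (compress 1 R))
        = L (tensor_op (L2 M) H W t (mult_op M (\<lambda>_. 1)) (compress 1 R))"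
      using Q' QL T by simp
    then show "L' R = L R" using op_eq_elementary[OF R] by simp
  qed
  ultimately have "slice_map M H W t g = L" unfolding slice_map_def by (rule the_equality)
  then show ?thesis using L_eq[OF R] by simp
qed

end

section \<open>Constant inductive families\<close>

text \<open>The exponent is \<open>n - 1\<close> because the first set of a family has index \<open>1\<close>.\<close>

definition const_fam :: "nat \<Rightarrow> family" where
  "const_fam c n = ((\<lambda>S. times_upto S c) ^^ (n - 1)) (Atom ` {..<c})"

lemma const_fam_1: "const_fam c 1 = Atom ` {..<c}"
  by (simp add: const_fam_def)

lemma const_fam_Suc: "n \<ge> 1 \<Longrightarrow> const_fam c (Suc n) = times_upto (const_fam c n) c"
  by (cases n) (simp_all add: const_fam_def)

lemma const_fam_nonempty: "c \<ge> 1 \<Longrightarrow> n \<ge> 1 \<Longrightarrow> finite (const_fam c n) \<and> const_fam c n \<noteq> {}"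
proof (induction n)
  case (Suc n)
  show ?case
  proof (cases "n = 0")
    case True then show ?thesis using Suc const_fam_1[of c] by (auto simp: lessThan_empty_iff)
  next
    case False
    then show ?thesis using Suc by (auto simp: const_fam_Suc times_upto_def)
  qed
qed simp

lemma inductive_family_const: "c \<ge> 1 \<Longrightarrow> inductive_family (const_fam c)"
  unfolding inductive_family_def using const_fam_nonempty const_fam_Suc by blast

lemma times_upto_inject:
  assumes "S \<noteq> {}" "times_upto S c = times_upto S d"
  shows "c = d"
proof -
  obtain x where x: "x \<in> S" using assms(1) by blast
  have *: "Ext x k \<in> times_upto S e \<longleftrightarrow> k \<in> {1..e}" for k e
    using x by (auto simp: times_upto_def)
  have "{1..c} = {1..d}" using *[of _ c] *[of _ d] assms(2) by blast
  then have "card {1..c} = card {1..d}" by (rule arg_cong)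
  then show ?thesis by simp
qed

lemma mult_seq_const: "c \<ge> 1 \<Longrightarrow> mult_seq (const_fam c) i = c"
proof -
  assume c: "c \<ge> 1"
  show ?thesis
  proof (cases "i = 0")
    case True
    have "card (Atom ` {..<c}) = c" by (subst card_image) (auto simp: inj_on_def)
    then show ?thesis using True const_fam_1[of c] by (simp add: mult_seq_def)
  next
    case False
    have "(THE d. const_fam c (Suc i) = times_upto (const_fam c i) d) = c"
    proof (rule the_equality)
      show "const_fam c (Suc i) = times_upto (const_fam c i) c" using False by (simp add: const_fam_Suc)
      fix d assume "const_fam c (Suc i) = times_upto (const_fam c i) d"
      then show "d = c"
        using times_upto_inject[of "const_fam c i" d c] const_fam_nonempty[OF c, of i] False
        by (simp add: const_fam_Suc)
    qed
    then show ?thesis using False by (simp add: mult_seq_def)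
  qed
qed

text \<open>The spaces of questions are points, since \<open>pt_fam\<close> has one element at every level, and the
  spaces of answers are Cantor sets, since \<open>bin_fam\<close> doubles at every level.\<close>

definition "pt_fam = const_fam 1"
abbreviation "bin_fam \<equiv> const_fam 2"
definition base_pt :: seq where "base_pt = (\<lambda>_. 1)"
abbreviation "mu_XY \<equiv> mu pt_fam \<Otimes>\<^sub>M mu pt_fam"
abbreviation "Omega_AB \<equiv> prod_topology (Omega bin_fam) (Omega bin_fam)"

lemma topspace_Omega: "c \<ge> 1 \<Longrightarrow> topspace (Omega (const_fam c)) = {a. \<forall>i. a i \<in> {1..c}}"
  by (auto simp: Omega_def mult_seq_const)

lemma space_mu: "c \<ge> 1 \<Longrightarrow> space (mu (const_fam c)) = {a. \<forall>i. a i \<in> {1..c}}"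
  by (auto simp: mu_def mult_seq_const space_PiM space_uniform_count_measure PiE_iff)

lemma prob_space_mu: "c \<ge> 1 \<Longrightarrow> prob_space (mu (const_fam c))"
  unfolding mu_def
  by (intro prob_space_PiM prob_space_uniform_count_measure) (auto simp: mult_seq_const)

lemma point_measure_mu: "point_measure (mu pt_fam) base_pt"
proof -
  interpret prob_space "mu pt_fam" unfolding pt_fam_def by (rule prob_space_mu) simp
  show ?thesis
    by unfold_locales (auto simp: pt_fam_def base_pt_def space_mu fun_eq_iff)
qed

lemma point_measure_mu_XY: "point_measure mu_XY (base_pt, base_pt)"
proof -
  interpret P: pair_prob_space "mu pt_fam" "mu pt_fam"
    unfolding pair_prob_space_def pair_sigma_finite_def
    using prob_space_mu[of 1] by (simp add: prob_space_imp_sigma_finite pt_fam_def)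
  have "space (mu pt_fam) = {base_pt}" using point_measure_mu by (rule point_measure.space_eq)
  then show ?thesis
    by unfold_locales (simp add: space_pair_measure)
qed

lemma continuous_map_times:
  fixes f g :: "'x \<Rightarrow> complex"
  assumes "continuous_map T euclidean f" "continuous_map T euclidean g"
  shows "continuous_map T euclidean (\<lambda>x. f x * g x)"
  using assms by (simp add: continuous_map_atin tendsto_mult)

text \<open>Indicator functions of cylinder sets, written as products of functions of one coordinate so that
  continuity is evident.\<close>

definition cylinder :: "nat \<Rightarrow> (nat \<Rightarrow> nat) \<Rightarrow> seq \<Rightarrow> complex" where
  "cylinder n s = (\<lambda>a\<in>topspace (Omega bin_fam). \<Prod>i<n. if a i = s i then 1 else 0)"

definition words :: "nat \<Rightarrow> (nat \<Rightarrow> nat) set" where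
  "words n = {..<n} \<rightarrow>\<^sub>E {1..2}"

lemma finite_words: "finite (words n)" unfolding words_def by (intro finite_PiE) auto

lemma card_words: "card (words n) = 2 ^ n" unfolding words_def by (simp add: card_PiE)

lemma cylinder_eq: "a \<in> topspace (Omega bin_fam) \<Longrightarrow> cylinder n s a = of_bool (\<forall>i<n. a i = s i)"
  unfolding cylinder_def by (auto simp: prod_zero_iff intro!: prod.neutral)

lemma cylinder_cont: "cylinder n s \<in> carrier (cont_fun (Omega bin_fam))"
proof -
  have "continuous_map (Omega bin_fam) euclidean (\<lambda>a. (if a i = s i then 1 else 0) :: complex)" for i
  proof -
    have "continuous_map (Omega bin_fam) (discrete_topology {1..mult_seq bin_fam i}) (\<lambda>a. a i)"
      unfolding Omega_def by (rule continuous_map_product_projection) simp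
    moreover have "continuous_map (discrete_topology {1..mult_seq bin_fam i}) euclidean (\<lambda>k. (if k = s i then 1 else 0) :: complex)"
      by simp
    ultimately have "continuous_map (Omega bin_fam) euclidean ((\<lambda>k. (if k = s i then 1 else 0) :: complex) \<circ> (\<lambda>a. a i))"
      by (rule continuous_map_compose)
    then show ?thesis by (simp add: comp_def)
  qed
  then have "continuous_map (Omega bin_fam) euclidean (\<lambda>a. \<Prod>i<n. (if a i = s i then 1 else 0) :: complex)"
    by (induction n) (simp_all add: continuous_map_times)
  then have "continuous_map (Omega bin_fam) euclidean (cylinder n s)"
    by (rule continuous_map_eq) (simp add: cylinder_def)
  then show ?thesis by (simp add: cont_fun_def cylinder_def)
qed

text \<open>Exactly one cylinder of length \<open>n\<close> contains \<open>a\<close>, namely that of the first \<open>n\<close> digits of \<open>a\<close>.\<close>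

lemma cylinder_expansion:
  assumes a: "a \<in> topspace (Omega bin_fam)"
  shows "(\<Sum>s\<in>words n. cylinder n s a * g s) = g (restrict a {..<n})"
proof -
  define s0 where "s0 = restrict a {..<n}"
  have s0: "s0 \<in> words n" using a by (auto simp: s0_def words_def topspace_Omega)
  have "cylinder n s a * g s = (if s = s0 then g s else 0)" if s: "s \<in> words n" for s
  proof -
    have "(\<forall>i<n. a i = s i) \<longleftrightarrow> s = s0"
      using s by (auto simp: s0_def words_def PiE_def extensional_def fun_eq_iff)
    then show ?thesis using a by (simp add: cylinder_eq)
  qed
  then have "(\<Sum>s\<in>words n. cylinder n s a * g s) = (\<Sum>s\<in>words n. if s = s0 then g s else 0)"
    by (rule sum.cong[OF refl])
  also have "\<dots> = g s0" using s0 finite_words by simp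
  finally show ?thesis by (simp add: s0_def)
qed

lemma cylinder_sum: "a \<in> topspace (Omega bin_fam) \<Longrightarrow> (\<Sum>s\<in>words n. cylinder n s a) = 1"
  using cylinder_expansion[of a n "\<lambda>_. 1"] by simp

lemma cylinder_integral:
  assumes s: "s \<in> words n"
  shows "(LINT a|mu bin_fam. cylinder n s a * cylinder n s a) = of_real (1 / 2 ^ n)"
    "(LINT a|mu bin_fam. cylinder n s a) = of_real (1 / 2 ^ n)"
    "integrable (mu bin_fam) (cylinder n s)"
proof -
  interpret P: prob_space "mu bin_fam" by (rule prob_space_mu) simp
  let ?N = "\<lambda>i::nat. uniform_count_measure {1..mult_seq bin_fam i}"
  interpret prod: product_prob_space ?N UNIV
    by (intro product_prob_spaceI prob_space_uniform_count_measure) (auto simp: mult_seq_const)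
  have sp: "topspace (Omega bin_fam) = space (mu bin_fam)" by (simp add: topspace_Omega space_mu)
  define E where "E = prod_emb UNIV ?N {..<n} (Pi\<^sub>E {..<n} (\<lambda>i. {s i}))"
  have si: "s i \<in> {1..2}" if "i < n" for i
    using PiE_mem[OF s[unfolded words_def]] that by simp
  have sN: "{s i} \<in> sets (?N i)" if "i < n" for i
    using si[OF that] by (simp add: sets_uniform_count_measure mult_seq_const)
  have Emeas: "E \<in> sets (mu bin_fam)"
    unfolding E_def mu_def by (rule sets_PiM_I) (use sN in auto)
  have "measure (mu bin_fam) E = (\<Prod>i<n. measure (?N i) {s i})"
    unfolding E_def mu_def by (rule prod.measure_PiM_emb) (use sN in auto)
  also have "\<dots> = (\<Prod>i<n. 1 / 2)"
  proof (rule prod.cong[OF refl])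
    fix i assume "i \<in> {..<n}"
    then have "s i \<in> {1..2}" using si by simp
    then show "measure (?N i) {s i} = 1 / 2"
      by (subst measure_uniform_count_measure) (auto simp: mult_seq_const)
  qed
  also have "\<dots> = 1 / 2 ^ n" by (simp add: power_one_over)
  finally have m: "measure (mu bin_fam) E = 1 / 2 ^ n" .
  have ind: "cylinder n s a = indicator E a" if a: "a \<in> space (mu bin_fam)" for a
  proof -
    have "a \<in> E \<longleftrightarrow> (\<forall>i<n. a i = s i)"
    proof -
      have "a \<in> space (Pi\<^sub>M UNIV ?N)" using a by (simp add: mu_def)
      then have "a \<in> E \<longleftrightarrow> restrict a {..<n} \<in> Pi\<^sub>E {..<n} (\<lambda>i. {s i})"
        by (simp only: E_def prod_emb_iff space_PiM PiE_iff) simp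
      then show ?thesis by (auto simp: restrict_PiE_iff)
    qed
    then show ?thesis using a by (simp add: cylinder_eq sp indicator_def)
  qed
  have hbi: "has_bochner_integral (mu bin_fam) (\<lambda>a. indicator E a *\<^sub>R (1 :: complex)) (measure (mu bin_fam) E *\<^sub>R 1)"
    by (rule has_bochner_integral_indicator[OF Emeas]) (simp add: P.emeasure_finite less_top[symmetric])
  have "integrable (mu bin_fam) (cylinder n s) \<longleftrightarrow> integrable (mu bin_fam) (\<lambda>a. indicator E a *\<^sub>R (1 :: complex))"
    by (rule Bochner_Integration.integrable_cong[OF refl]) (simp add: ind indicator_def)
  then show "integrable (mu bin_fam) (cylinder n s)" using hbi integrable.intros by blast
  have "(LINT a|mu bin_fam. indicator E a *\<^sub>R (1 :: complex)) = measure (mu bin_fam) E *\<^sub>R 1"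
    by (rule has_bochner_integral_integral_eq[OF hbi])
  moreover have "indicator E a *\<^sub>R (1 :: complex) = indicator E a" for a by (simp add: indicator_def)
  ultimately have "(LINT a|mu bin_fam. indicator E a :: complex) = of_real (measure (mu bin_fam) E)"
    by (simp only: of_real_def)
  then have I: "(LINT a|mu bin_fam. indicator E a :: complex) = of_real (1 / 2 ^ n)" using m by simp
  show "(LINT a|mu bin_fam. cylinder n s a) = of_real (1 / 2 ^ n)"
    using I by (subst Bochner_Integration.integral_cong[OF refl ind]) auto
  have "cylinder n s a * cylinder n s a = indicator E a" if a: "a \<in> space (mu bin_fam)" for a
    using ind[OF a] by (simp add: indicator_def)
  then show "(LINT a|mu bin_fam. cylinder n s a * cylinder n s a) = of_real (1 / 2 ^ n)"
    using I by (subst Bochner_Integration.integral_cong[OF refl]) auto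
qed

text \<open>Both parties output \<open>\<pi> a\<close> for the same uniformly random \<open>a\<close> in the Cantor set. As the questions
  are trivial, a correlation is just a law of the pair of answers.\<close>

definition diagonal_corr :: "(seq \<Rightarrow> seq) \<Rightarrow> (seq \<times> seq \<Rightarrow> complex) \<Rightarrow> (seq \<times> seq \<Rightarrow> complex) set" where
  "diagonal_corr \<pi> = (\<lambda>h\<in>carrier (cont_fun Omega_AB). ae_class mu_XY (\<lambda>_. LINT a|mu bin_fam. h (\<pi> a, \<pi> a)))"

lemma cont_fun_carrier: "f \<in> carrier (cont_fun T) \<longleftrightarrow> f \<in> extensional (topspace T) \<and> continuous_map T euclidean f"
  by (simp add: cont_fun_def)

lemma cont_fun_add: "f \<oplus>\<^bsub>cont_fun T\<^esub> g = (\<lambda>x\<in>topspace T. f x + g x)"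
  by (simp add: cont_fun_def)

lemma restrict_cont: "continuous_map T euclidean f \<Longrightarrow> (\<lambda>x\<in>topspace T. f x) \<in> carrier (cont_fun T)"
  unfolding cont_fun_carrier by (auto intro: continuous_map_eq)

lemma cont_fun_add_in:
  "\<lbrakk>f \<in> carrier (cont_fun T); g \<in> carrier (cont_fun T)\<rbrakk> \<Longrightarrow> f \<oplus>\<^bsub>cont_fun T\<^esub> g \<in> carrier (cont_fun T)"
  unfolding cont_fun_add by (rule restrict_cont) (simp add: cont_fun_carrier continuous_map_add)

lemma cont_fun_one_in: "\<one>\<^bsub>cont_fun T\<^esub> \<in> carrier (cont_fun T)"
  using restrict_cont[of T "\<lambda>_. 1"] by (simp add: cont_fun_def)

lemma tensor_cont:
  assumes f: "f \<in> carrier (cont_fun (Omega bin_fam))" and g: "g \<in> carrier (cont_fun (Omega bin_fam))"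
  shows "(\<lambda>(a, b)\<in>topspace Omega_AB. f a * g b) \<in> carrier (cont_fun Omega_AB)"
proof -
  have "continuous_map Omega_AB euclidean (f \<circ> fst)" "continuous_map Omega_AB euclidean (g \<circ> snd)"
    using f g by (auto simp: cont_fun_def intro!: continuous_map_compose[OF continuous_map_fst] continuous_map_compose[OF continuous_map_snd])
  then have "continuous_map Omega_AB euclidean (\<lambda>z. (f \<circ> fst) z * (g \<circ> snd) z)"
    by (rule continuous_map_times)
  then have "(\<lambda>z\<in>topspace Omega_AB. (f \<circ> fst) z * (g \<circ> snd) z) \<in> carrier (cont_fun Omega_AB)"
    by (rule restrict_cont)
  also have "(\<lambda>z\<in>topspace Omega_AB. (f \<circ> fst) z * (g \<circ> snd) z) = (\<lambda>(a, b)\<in>topspace Omega_AB. f a * g b)"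
    by (auto simp: restrict_def)
  finally show ?thesis .
qed

text \<open>Additivity of the forms of a linear map into operators, for finitely many summands.\<close>

lemma ucp_sum_forms:
  assumes lin: "linear_map (cont_fun T) V \<Phi>" and V: "carrier V = {R. bounded_op W R}"
    and addV: "\<And>R R'. R \<oplus>\<^bsub>V\<^esub> R' = (\<lambda>x\<in>carrier W. R x \<oplus>\<^bsub>W\<^esub> R' x)"
    and smultV: "\<And>c R. c \<odot>\<^bsub>V\<^esub> R = (\<lambda>x\<in>carrier W. c \<odot>\<^bsub>W\<^esub> R x)"
    and W: "hilbert_space W" and S: "finite S"
    and f: "\<And>s. s \<in> S \<Longrightarrow> f s \<in> carrier (cont_fun T)" and w: "w \<in> carrier W" "w' \<in> carrier W"
  shows "(\<lambda>x\<in>topspace T. \<Sum>s\<in>S. f s x) \<in> carrier (cont_fun T) \<and>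
    ip W (\<Phi> (\<lambda>x\<in>topspace T. \<Sum>s\<in>S. f s x) w) w' = (\<Sum>s\<in>S. ip W (\<Phi> (f s) w) w')"
  using S f
proof (induction S)
  case empty
  interpret W: hilbert_space W by (rule W)
  let ?z = "\<lambda>x\<in>topspace T. 0 :: complex"
  have z: "?z \<in> carrier (cont_fun T)" by (rule restrict_cont) simp
  have "0 \<odot>\<^bsub>cont_fun T\<^esub> ?z = ?z" by (auto simp: cont_fun_def)
  then have "\<Phi> ?z = 0 \<odot>\<^bsub>V\<^esub> \<Phi> ?z" using lin z unfolding linear_map_def by metis
  then have "\<Phi> ?z w = (0 \<odot>\<^bsub>V\<^esub> \<Phi> ?z) w" by (rule fun_cong)
  moreover have "bounded_op W (\<Phi> ?z)" using lin z V unfolding linear_map_def by blast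
  ultimately have "ip W (\<Phi> ?z w) w' = ip W (0 \<odot>\<^bsub>W\<^esub> \<Phi> ?z w) w'" using w by (simp add: smultV)
  also have "\<dots> = 0" using \<open>bounded_op W (\<Phi> ?z)\<close> w by (subst W.ip_smult) simp_all
  finally show ?case unfolding sum.empty using z by blast
next
  case (insert s S)
  interpret W: hilbert_space W by (rule W)
  let ?g = "\<lambda>x\<in>topspace T. \<Sum>s\<in>S. f s x"
  have "?g \<in> carrier (cont_fun T) \<and> ip W (\<Phi> ?g w) w' = (\<Sum>s\<in>S. ip W (\<Phi> (f s) w) w')"
    by (rule insert.IH) (simp add: insert.prems)
  then have g: "?g \<in> carrier (cont_fun T)" and IH: "ip W (\<Phi> ?g w) w' = (\<Sum>s\<in>S. ip W (\<Phi> (f s) w) w')"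
    by (rule conjunct1, rule conjunct2)
  have fs: "f s \<in> carrier (cont_fun T)" using insert by simp
  have eq: "(\<lambda>x\<in>topspace T. \<Sum>s\<in>insert s S. f s x) = f s \<oplus>\<^bsub>cont_fun T\<^esub> ?g"
    using insert(1,2) by (auto simp: cont_fun_def)
  have in_C: "f s \<oplus>\<^bsub>cont_fun T\<^esub> ?g \<in> carrier (cont_fun T)" by (rule cont_fun_add_in[OF fs g])
  have "bounded_op W (\<Phi> (f s))" "bounded_op W (\<Phi> ?g)" using lin fs g V unfolding linear_map_def by blast+
  moreover have "\<Phi> (f s \<oplus>\<^bsub>cont_fun T\<^esub> ?g) = (\<lambda>x\<in>carrier W. \<Phi> (f s) x \<oplus>\<^bsub>W\<^esub> \<Phi> ?g x)"
    using lin fs g unfolding linear_map_def addV by blast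
  ultimately show ?case
    unfolding eq using in_C IH insert(1,2) w by (simp add: W.ip_lin)
qed

lemma (in point_tensor) compress_ucp:
  assumes ucp: "ucp (cont_fun T) (vN_tensor M H W t) \<Phi>" and f: "f \<in> carrier (cont_fun T)"
  shows "bounded_op W (\<Phi> f)"
    and "(\<And>x. x \<in> topspace T \<Longrightarrow> f x \<in> \<real>\<^sub>\<ge>\<^sub>0) \<Longrightarrow> pos_op H (compress 1 (\<Phi> f))"
proof -
  show b: "bounded_op W (\<Phi> f)"
    using ucp f carrier_vN unfolding ucp_def linear_map_def by blast
  assume pos: "\<And>x. x \<in> topspace T \<Longrightarrow> f x \<in> \<real>\<^sub>\<ge>\<^sub>0"
  have "psd 1 (\<lambda>i j. f x)" if "x \<in> topspace T" for x
  proof -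
    have "cnj c * f x * c \<in> \<real>\<^sub>\<ge>\<^sub>0" for c
    proof -
      have "cnj c * f x * c = f x * (c * cnj c)" by simp
      also have "\<dots> = f x * of_real ((cmod c)\<^sup>2)" by (simp only: complex_norm_square)
      also have "\<dots> \<in> \<real>\<^sub>\<ge>\<^sub>0"
        using pos[OF that] by (rule nonneg_Reals_mult_I) (simp only: nonneg_Reals_of_real_iff zero_le_power2)
      finally show ?thesis .
    qed
    then show ?thesis by (simp add: psd_def)
  qed
  then have "mpos (cont_fun T) 1 (\<lambda>i j. f)" by (simp add: cont_fun_def)
  then have "mpos (vN_tensor M H W t) 1 (\<lambda>i j. \<Phi> f)"
    using ucp[unfolded ucp_def, THEN conjunct2, THEN conjunct2, rule_format, of 1 "\<lambda>i j. f"] f by simp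
  then have p: "\<And>\<xi>. \<xi> (0::nat) \<in> carrier W \<Longrightarrow> ip W (\<Phi> f (\<xi> 0)) (\<xi> 0) \<in> \<real>\<^sub>\<ge>\<^sub>0"
    by (simp add: vN_tensor_def bounded_ops_def)
  have "ip W (\<Phi> f w) w \<in> \<real>\<^sub>\<ge>\<^sub>0" if "w \<in> carrier W" for w using p[of "\<lambda>_. w"] that by simp
  then show "pos_op H (compress 1 (\<Phi> f))"
    unfolding pos_op_def using bounded_compress[OF b] b by (simp add: ip_compress)
qed

lemma (in point_tensor) compress_one:
  "compress 1 (\<one>\<^bsub>vN_tensor M H W t\<^esub>) = (\<lambda>h\<in>carrier H. h)"
proof (rule extensionalityI[of _ "carrier H"])
  fix h assume h: "h \<in> carrier H"
  have b: "bounded_op W (\<lambda>x\<in>carrier W. x)" by (rule W.bounded_op_id)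
  show "compress 1 (\<one>\<^bsub>vN_tensor M H W t\<^esub>) h = (\<lambda>h\<in>carrier H. h) h"
    unfolding vN_tensor_def bounded_ops_def using h b K.bounded_op_in[OF bounded_compress[OF b] h]
    by (auto intro!: K.ip_ext simp: ip_compress ip_V)
qed (simp_all add: compress_def)

lemma (in point_tensor) compress_povm:
  assumes ucp: "ucp (cont_fun (Omega bin_fam)) (vN_tensor M H W t) \<Phi>"
  shows "povm H (words n) (\<lambda>s. compress 1 (\<Phi> (cylinder n s)))"
  unfolding povm_def
proof (intro conjI ballI)
  show "pos_op H (compress 1 (\<Phi> (cylinder n s)))" for s
    by (rule compress_ucp(2)[OF ucp cylinder_cont]) (simp add: cylinder_eq)
  fix h h' assume h: "h \<in> carrier H" "h' \<in> carrier H"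
  have "linear_map (cont_fun (Omega bin_fam)) (vN_tensor M H W t) \<Phi>" using ucp by (simp add: ucp_def)
  from ucp_sum_forms[OF this carrier_vN _ _ W.hilbert_space_axioms finite_words[of n] cylinder_cont[of n], of "V h" "V h'"]
  have "ip W (\<Phi> (\<lambda>x\<in>topspace (Omega bin_fam). \<Sum>s\<in>words n. cylinder n s x) (V h)) (V h')
      = (\<Sum>s\<in>words n. ip W (\<Phi> (cylinder n s) (V h)) (V h'))"
    using h by (simp add: vN_tensor_def bounded_ops_def)
  moreover have "(\<lambda>x\<in>topspace (Omega bin_fam). \<Sum>s\<in>words n. cylinder n s x) = \<one>\<^bsub>cont_fun (Omega bin_fam)\<^esub>"
    unfolding cont_fun_def using cylinder_sum by (auto simp: fun_eq_iff)
  ultimately have "(\<Sum>s\<in>words n. ip W (\<Phi> (cylinder n s) (V h)) (V h'))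
      = ip W (\<Phi> \<one>\<^bsub>cont_fun (Omega bin_fam)\<^esub> (V h)) (V h')" by simp
  also have "\<Phi> \<one>\<^bsub>cont_fun (Omega bin_fam)\<^esub> = \<one>\<^bsub>vN_tensor M H W t\<^esub>" using ucp by (simp add: ucp_def)
  also have "ip W (\<one>\<^bsub>vN_tensor M H W t\<^esub> (V h)) (V h') = ip H h h'"
    using h by (simp add: vN_tensor_def bounded_ops_def ip_V)
  finally show "(\<Sum>s\<in>words n. ip H (compress 1 (\<Phi> (cylinder n s)) h) h') = ip H h h'"
    using h compress_ucp(1)[OF ucp cylinder_cont] by (simp add: ip_compress)
qed

lemma point_tensorI:
  assumes "point_measure M p" "hilbert_space H" "hilbert_tensor (L2 M) H W t"
  shows "point_tensor M p H W t"
proof -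
  interpret point_measure M p by fact
  interpret H: hilbert_space H by fact
  interpret W: hilbert_space W using assms(3) by (simp add: hilbert_tensor_def)
  interpret L: hilbert_space "L2 M" by (rule hilbert_L2)
  show ?thesis by unfold_locales fact
qed

section \<open>The diffuse diagonal correlation is not spatial\<close>

text \<open>For every \<open>n\<close> the cylinders of length \<open>n\<close> give two measurements with \<open>2\<^sup>n\<close> outcomes which would
  be perfectly correlated and uniform in one and the same state, contradicting the bound above.\<close>

lemma diagonal_not_spatial: "diagonal_corr id \<notin> C_qs pt_fam pt_fam bin_fam bin_fam"
proof
  assume "diagonal_corr id \<in> C_qs pt_fam pt_fam bin_fam bin_fam"
  then obtain H K HK :: "universe inner_module" and t and XH :: "universe inner_module" and tX
    and YK :: "universe inner_module" and tY \<xi> \<Phi> \<Psi> where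
    H: "separable_hilbert_space H" and K: "separable_hilbert_space K" and
    t: "hilbert_tensor H K HK t" and tX: "hilbert_tensor (L2 (mu pt_fam)) H XH tX"
    and tY: "hilbert_tensor (L2 (mu pt_fam)) K YK tY" and
    \<xi>: "\<xi> \<in> carrier HK" "hnorm HK \<xi> = 1" and
    \<Phi>: "ucp (cont_fun (Omega bin_fam)) (vN_tensor (mu pt_fam) H XH tX) \<Phi>" and
    \<Psi>: "ucp (cont_fun (Omega bin_fam)) (vN_tensor (mu pt_fam) K YK tY) \<Psi>" and
    corr: "\<forall>f\<^sub>1\<in>carrier (cont_fun (Omega bin_fam)). \<forall>f\<^sub>2\<in>carrier (cont_fun (Omega bin_fam)).
        \<forall>g\<^sub>1 g\<^sub>2. integrable (mu pt_fam) g\<^sub>1 \<and> integrable (mu pt_fam) g\<^sub>2 \<longrightarrow>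
          pairing mu_XY (\<lambda>(x, y). g\<^sub>1 x * g\<^sub>2 y)
            (diagonal_corr id (\<lambda>(a, b)\<in>topspace Omega_AB. f\<^sub>1 a * f\<^sub>2 b))
          = ip HK (tensor_op H K HK t (slice_map (mu pt_fam) H XH tX g\<^sub>1 (\<Phi> f\<^sub>1))
                                      (slice_map (mu pt_fam) K YK tY g\<^sub>2 (\<Psi> f\<^sub>2)) \<xi>) \<xi>"
    unfolding C_qs_def mem_Collect_eq by (elim conjE exE) (rule that, assumption+)
  interpret mu_XY: point_measure mu_XY "(base_pt, base_pt)" by (rule point_measure_mu_XY)
  interpret PX: point_tensor "mu pt_fam" base_pt H XH tX
    using H tX by (intro point_tensorI point_measure_mu) (simp_all add: separable_hilbert_space_def)
  interpret PY: point_tensor "mu pt_fam" base_pt K YK tY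
    using K tY by (intro point_tensorI point_measure_mu) (simp_all add: separable_hilbert_space_def)
  interpret HK: hilbert_space HK using t by (simp add: hilbert_tensor_def)
  interpret T: tensor_product H K HK t by unfold_locales (rule t)
  have corr': "ip HK (tensor_op H K HK t (PX.compress 1 (\<Phi> f)) (PY.compress 1 (\<Psi> g)) \<xi>) \<xi>
      = (LINT a|mu bin_fam. f a * g a)"
    if f: "f \<in> carrier (cont_fun (Omega bin_fam))" and g: "g \<in> carrier (cont_fun (Omega bin_fam))" for f g
  proof -
    have "ip HK (tensor_op H K HK t (PX.compress 1 (\<Phi> f)) (PY.compress 1 (\<Psi> g)) \<xi>) \<xi>
      = ip HK (tensor_op H K HK t (slice_map (mu pt_fam) H XH tX (\<lambda>_. 1) (\<Phi> f))
                                      (slice_map (mu pt_fam) K YK tY (\<lambda>_. 1) (\<Psi> g)) \<xi>) \<xi>"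
      by (simp only: PX.slice_map_eq[OF PX.compress_ucp(1)[OF \<Phi> f]]
            PY.slice_map_eq[OF PY.compress_ucp(1)[OF \<Psi> g]])
    also have "\<dots> = pairing mu_XY (\<lambda>(x, y). 1 * 1) (diagonal_corr id (\<lambda>(a, b)\<in>topspace Omega_AB. f a * g b))"
      by (rule corr[rule_format, OF f g, of "\<lambda>_. 1" "\<lambda>_. 1", symmetric])
        (intro conjI PX.integrable_point)
    also have "\<dots> = (LINT a|mu bin_fam. (\<lambda>(a, b)\<in>topspace Omega_AB. f a * g b) (a, a))"
      unfolding diagonal_corr_def using tensor_cont[OF f g] by (simp add: pairing_def)
    also have "\<dots> = (LINT a|mu bin_fam. f a * g a)"
      by (rule Bochner_Integration.integral_cong) (auto simp: topspace_Omega space_mu)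
    finally show ?thesis .
  qed
  \<comment> \<open>Taking the unit as second function yields the marginal law of the first party.\<close>
  have \<Psi>1: "PY.compress 1 (\<Psi> \<one>\<^bsub>cont_fun (Omega bin_fam)\<^esub>) = (\<lambda>k\<in>carrier K. k)"
    using \<Psi> PY.compress_one by (simp add: ucp_def)
  obtain B where B: "\<forall>(S :: (nat \<Rightarrow> nat) set) P Q. finite S \<longrightarrow> S \<noteq> {} \<longrightarrow> povm H S P \<longrightarrow> povm K S Q \<longrightarrow>
      (\<forall>s\<in>S. ip HK (tensor_op H K HK t (P s) (Q s) \<xi>) \<xi> = of_real (1 / real (card S))) \<longrightarrow>
      (\<forall>s\<in>S. ip HK (tensor_op H K HK t (P s) (\<lambda>k\<in>carrier K. k) \<xi>) \<xi> = of_real (1 / real (card S))) \<longrightarrow>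
      real (card S) \<le> B"
    using T.uniform_correlation_bound[OF \<xi>(1)] by blast
  have "real (card (words n)) \<le> B" for n
  proof (rule B[rule_format, of "words n" "\<lambda>s. PX.compress 1 (\<Phi> (cylinder n s))"
        "\<lambda>s. PY.compress 1 (\<Psi> (cylinder n s))"])
    show "finite (words n)" by (rule finite_words)
    show "words n \<noteq> {}" using card_words[of n] by auto
    show "povm H (words n) (\<lambda>s. PX.compress 1 (\<Phi> (cylinder n s)))" by (rule PX.compress_povm[OF \<Phi>])
    show "povm K (words n) (\<lambda>s. PY.compress 1 (\<Psi> (cylinder n s)))" by (rule PY.compress_povm[OF \<Psi>])
    fix s assume s: "s \<in> words n"
    show "ip HK (tensor_op H K HK t (PX.compress 1 (\<Phi> (cylinder n s))) (PY.compress 1 (\<Psi> (cylinder n s))) \<xi>) \<xi>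
        = of_real (1 / real (card (words n)))"
      unfolding corr'[OF cylinder_cont cylinder_cont] using cylinder_integral(1)[OF s] by (simp add: card_words)
    have "ip HK (tensor_op H K HK t (PX.compress 1 (\<Phi> (cylinder n s))) (\<lambda>k\<in>carrier K. k) \<xi>) \<xi>
        = (LINT a|mu bin_fam. cylinder n s a * \<one>\<^bsub>cont_fun (Omega bin_fam)\<^esub> a)"
      using corr'[OF cylinder_cont cont_fun_one_in, of n s] by (simp only: \<Psi>1)
    also have "\<dots> = (LINT a|mu bin_fam. cylinder n s a)"
      by (rule Bochner_Integration.integral_cong) (auto simp: cont_fun_def topspace_Omega space_mu)
    finally show "ip HK (tensor_op H K HK t (PX.compress 1 (\<Phi> (cylinder n s))) (\<lambda>k\<in>carrier K. k) \<xi>) \<xi>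
        = of_real (1 / real (card (words n)))"
      using cylinder_integral(2)[OF s] by (simp add: card_words)
  qed
  then have "2 ^ n \<le> B" for n :: nat using card_words by (metis of_nat_numeral of_nat_power)
  then show False using real_arch_pow[of 2 B] by (metis not_less one_less_numeral_iff semiring_norm(76))
qed

section \<open>Finitely supported diagonal correlations are spatial\<close>

text \<open>The space \<open>\<complex>\<^sup>I\<close> inside the common carrier type, as functions vanishing outside \<open>I\<close>.\<close>

definition fin_sp :: "nat set \<Rightarrow> universe inner_module" where
  "fin_sp I = \<lparr>carrier = {f. \<forall>i. i \<notin> I \<longrightarrow> f i = 0}, mult = undefined, one = undefined,
     zero = (\<lambda>_. 0), add = (\<lambda>f g i. f i + g i), smult = (\<lambda>c f i. c * f i),
     ip = (\<lambda>f g. \<Sum>i\<in>I. f i * cnj (g i))\<rparr>"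

lemma fin_sp_simps:
  "carrier (fin_sp I) = {f. \<forall>i. i \<notin> I \<longrightarrow> f i = 0}" "\<zero>\<^bsub>fin_sp I\<^esub> = (\<lambda>_. 0)"
  "f \<oplus>\<^bsub>fin_sp I\<^esub> g = (\<lambda>i. f i + g i)" "c \<odot>\<^bsub>fin_sp I\<^esub> f = (\<lambda>i. c * f i)"
  "ip (fin_sp I) f g = (\<Sum>i\<in>I. f i * cnj (g i))"
  by (simp_all add: fin_sp_def)

lemma finite_coordinates_fin_sp: "finite I \<Longrightarrow> finite_coordinates (fin_sp I) (\<lambda>f. f) I"
  by unfold_locales (auto simp: fin_sp_simps bij_betw_def)

lemma hilbert_fin_sp: "finite I \<Longrightarrow> hilbert_space (fin_sp I)"
  using finite_coordinates.hilbert finite_coordinates_fin_sp by blast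

text \<open>A countable dense set of the product space \<open>\<complex>\<^sup>\<nat>\<close> stays dense when its elements are truncated
  to \<open>I\<close>.\<close>

lemma separable_fin_sp:
  assumes I: "finite I"
  shows "separable_hilbert_space (fin_sp I)"
proof -
  interpret F: finite_coordinates "fin_sp I" "\<lambda>f. f" I by (rule finite_coordinates_fin_sp[OF I])
  interpret hilbert_space "fin_sp I" by (rule hilbert_fin_sp[OF I])
  interpret MS: Metric_space "carrier (fin_sp I)" "hdist (fin_sp I)" by (rule F.P.metric)
  define tr where "tr = (\<lambda>(f :: universe) i. if i \<in> I then f i else 0)"
  have tr: "tr f \<in> carrier (fin_sp I)" for f by (simp add: tr_def fin_sp_simps)
  obtain D :: "universe set" where D: "countable D" "\<And>X. open X \<Longrightarrow> X \<noteq> {} \<Longrightarrow> \<exists>d\<in>D. d \<in> X"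
    using countable_dense_setE by blast
  have "x \<in> MS.mtopology closure_of (tr ` D)" if x: "x \<in> carrier (fin_sp I)" for x
    unfolding MS.metric_closure_of
  proof (intro CollectI conjI x allI impI)
    fix r :: real assume r: "r > 0"
    let ?X = "{f :: universe. (\<Sum>i\<in>I. (cmod (x i - f i))\<^sup>2) < r\<^sup>2}"
    have "open ?X"
      by (intro open_Collect_less continuous_intros continuous_on_product_coordinates)
    moreover have "x \<in> ?X" using r by simp
    ultimately obtain d where d: "d \<in> D" "d \<in> ?X" using D(2)[of ?X] by blast
    have "(hnorm (fin_sp I) (x \<ominus>\<^bsub>fin_sp I\<^esub> tr d))\<^sup>2 = (\<Sum>i\<in>I. (cmod (x i - tr d i))\<^sup>2)"
      using x tr by (simp add: F.hnorm_coord F.coord_diff)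
    also have "\<dots> = (\<Sum>i\<in>I. (cmod (x i - d i))\<^sup>2)" by (simp add: tr_def)
    also have "\<dots> < r\<^sup>2" using d(2) by simp
    finally have "hnorm (fin_sp I) (x \<ominus>\<^bsub>fin_sp I\<^esub> tr d) < r"
      by (rule power2_less_imp_less) (simp add: less_imp_le[OF r])
    then show "\<exists>y\<in>tr ` D. y \<in> MS.mball x r"
      using x tr[of d] d(1) by (intro bexI[of _ "tr d"]) (simp_all add: hdist_def)
  qed
  then have "norm_topology (fin_sp I) closure_of (tr ` D) = carrier (fin_sp I)"
    using closure_of_subset_topspace[of "norm_topology (fin_sp I)" "tr ` D"]
    by (auto simp: norm_topology_def)
  then have "separable_space (norm_topology (fin_sp I))"
    unfolding separable_space_def using D(1) tr by (intro exI[of _ "tr ` D"]) auto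
  then show ?thesis unfolding separable_hilbert_space_def using hilbert_fin_sp[OF I] by blast
qed

text \<open>Pairs of indices are coded as natural numbers to stay in the same carrier type.\<close>

definition fin_sp_prod :: "nat set \<Rightarrow> nat set \<Rightarrow> universe inner_module" where
  "fin_sp_prod I J = fin_sp (prod_encode ` (I \<times> J))"

definition fin_sp_tensor :: "universe \<Rightarrow> universe \<Rightarrow> universe" where
  "fin_sp_tensor h k m = h (fst (prod_decode m)) * k (snd (prod_decode m))"

lemma span_closure:
  assumes W: "hilbert_space W" and S: "carrier W \<subseteq> linear_span W S"
  shows "norm_topology W closure_of linear_span W S = carrier W"
proof -
  interpret hilbert_space W by fact
  have "topspace (norm_topology W) \<inter> linear_span W S \<subseteq> norm_topology W closure_of linear_span W S"
    by (rule closure_of_subset_Int)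
  then show ?thesis
    using closure_of_subset_topspace[of "norm_topology W" "linear_span W S"] S by auto
qed

lemma prod_index: "m \<notin> prod_encode ` (I \<times> J) \<Longrightarrow> fst (prod_decode m) \<notin> I \<or> snd (prod_decode m) \<notin> J"
proof (rule ccontr)
  assume m: "m \<notin> prod_encode ` (I \<times> J)"
  assume "\<not> ?thesis"
  then have "prod_decode m \<in> I \<times> J" by (simp add: mem_Times_iff)
  then have "prod_encode (prod_decode m) \<in> prod_encode ` (I \<times> J)" by (rule imageI)
  with m show False by simp
qed

lemma hilbert_tensor_fin_sp:
  assumes I: "finite I" and J: "finite J"
  shows "hilbert_tensor (fin_sp I) (fin_sp J) (fin_sp_prod I J) fin_sp_tensor"
proof -
  let ?P = "prod_encode ` (I \<times> J)"
  let ?W = "fin_sp_prod I J"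
  have P: "finite ?P" using I J by simp
  interpret W: hilbert_space ?W unfolding fin_sp_prod_def by (rule hilbert_fin_sp[OF P])
  have t_in: "fin_sp_tensor h k \<in> carrier ?W" if "h \<in> carrier (fin_sp I)" "k \<in> carrier (fin_sp J)" for h k
    unfolding fin_sp_prod_def fin_sp_simps mem_Collect_eq
  proof (intro allI impI)
    fix m assume "m \<notin> ?P"
    from prod_index[OF this] that show "fin_sp_tensor h k m = 0" by (auto simp: fin_sp_tensor_def fin_sp_simps)
  qed
  have ip: "ip ?W (fin_sp_tensor h k) (fin_sp_tensor h' k') = ip (fin_sp I) h h' * ip (fin_sp J) k k'" for h k h' k'
  proof -
    have "ip ?W (fin_sp_tensor h k) (fin_sp_tensor h' k') = (\<Sum>(i, j)\<in>I \<times> J. (h i * k j) * cnj (h' i * k' j))"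
      unfolding fin_sp_prod_def fin_sp_simps by (subst sum.reindex[OF inj_prod_encode]) (simp add: fin_sp_tensor_def case_prod_beta)
    also have "\<dots> = (\<Sum>i\<in>I. \<Sum>j\<in>J. (h i * cnj (h' i)) * (k j * cnj (k' j)))"
      by (subst sum.cartesian_product[symmetric]) (simp add: mult_ac)
    finally show ?thesis by (simp add: fin_sp_simps sum_product)
  qed
  let ?S = "{fin_sp_tensor h k | h k. h \<in> carrier (fin_sp I) \<and> k \<in> carrier (fin_sp J)}"
  have "f \<in> linear_span ?W ?S" if f: "f \<in> carrier ?W" for f
    unfolding linear_span_def
  proof (rule InterI)
    fix U assume "U \<in> {U. submodule U complex_ring ?W \<and> ?S \<subseteq> U}"
    then have U: "submodule U complex_ring ?W" and SU: "?S \<subseteq> U" by auto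
    note sub = W.submoduleE[OF U]
    \<comment> \<open>Induction on the support, splitting off one coordinate at a time.\<close>
    have "g \<in> U" if "finite F" "F \<subseteq> ?P" "\<And>m. m \<notin> F \<Longrightarrow> g m = 0" for F and g :: universe
      using that
    proof (induction F arbitrary: g)
      case empty
      have "fin_sp_tensor (\<lambda>_. 0) (\<lambda>_. 0) \<in> ?S"
        by (intro CollectI exI conjI refl) (auto simp: fin_sp_simps)
      then have "fin_sp_tensor (\<lambda>_. 0) (\<lambda>_. 0) \<in> U" using SU by blast
      moreover have "g = fin_sp_tensor (\<lambda>_. 0) (\<lambda>_. 0)" using empty by (auto simp: fin_sp_tensor_def)
      ultimately show ?case by simp
    next
      case (insert m F)
      obtain i j where ij: "m = prod_encode (i, j)" "i \<in> I" "j \<in> J" using insert.prems(1) by auto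
      define u where "u = fin_sp_tensor (\<lambda>l. if l = i then 1 else 0) (\<lambda>l. if l = j then 1 else 0)"
      have u: "u l = (if l = m then 1 else 0)" for l
      proof -
        have "l = m \<longleftrightarrow> fst (prod_decode l) = i \<and> snd (prod_decode l) = j"
          using ij(1) by (metis prod.collapse prod.sel prod_decode_inverse prod_encode_inverse)
        then show ?thesis by (simp add: u_def fin_sp_tensor_def)
      qed
      have "u \<in> ?S" unfolding u_def using ij(2,3)
        by (intro CollectI exI conjI refl) (auto simp: fin_sp_simps)
      then have uU: "u \<in> U" using SU by blast
      have "g(m := 0) \<in> U" by (rule insert.IH) (use insert.prems in auto)
      moreover have "g m \<odot>\<^bsub>?W\<^esub> u \<in> U" using sub(4)[of "g m" u] uU by simp
      ultimately have "g(m := 0) \<oplus>\<^bsub>?W\<^esub> g m \<odot>\<^bsub>?W\<^esub> u \<in> U" by (rule sub(5))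
      moreover have "g(m := 0) \<oplus>\<^bsub>?W\<^esub> g m \<odot>\<^bsub>?W\<^esub> u = g" by (auto simp: fin_sp_prod_def fin_sp_simps u)
      ultimately show ?case by simp
    qed
    then show "f \<in> U" using P f by (auto simp: fin_sp_prod_def fin_sp_simps)
  qed
  then have "norm_topology ?W closure_of linear_span ?W ?S = carrier ?W"
    by (intro span_closure W.hilbert_space_axioms) blast
  moreover have "linear_map (fin_sp I) ?W (\<lambda>h. fin_sp_tensor h k)" if "k \<in> carrier (fin_sp J)" for k
    unfolding linear_map_def
  proof (intro conjI ballI allI)
    show "(\<lambda>h. fin_sp_tensor h k) \<in> carrier (fin_sp I) \<rightarrow> carrier ?W" using t_in that by blast
  qed (simp_all add: fin_sp_prod_def fin_sp_simps fin_sp_tensor_def fun_eq_iff algebra_simps)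
  moreover have "linear_map (fin_sp J) ?W (\<lambda>k. fin_sp_tensor h k)" if "h \<in> carrier (fin_sp I)" for h
    unfolding linear_map_def
  proof (intro conjI ballI allI)
    show "(\<lambda>k. fin_sp_tensor h k) \<in> carrier (fin_sp J) \<rightarrow> carrier ?W" using t_in that by blast
  qed (simp_all add: fin_sp_prod_def fin_sp_simps fin_sp_tensor_def fun_eq_iff algebra_simps)
  ultimately show ?thesis
    unfolding hilbert_tensor_def using W.hilbert_space_axioms ip by blast
qed

lemma (in point_measure) hilbert_tensor_L2_fin_sp:
  assumes I: "finite I"
  shows "hilbert_tensor (L2 M) (fin_sp I) (fin_sp I) (\<lambda>u h i. rep u p * h i)"
proof -
  let ?t = "\<lambda>u (h :: universe) i. rep u p * h i"
  interpret W: hilbert_space "fin_sp I" by (rule hilbert_fin_sp[OF I])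
  have "carrier (fin_sp I) \<subseteq> linear_span (fin_sp I) {?t u h | u h. u \<in> carrier (L2 M) \<and> h \<in> carrier (fin_sp I)}"
  proof
    fix h assume h: "h \<in> carrier (fin_sp I)"
    have "?t (cls 1) h = h" by simp
    then have "h \<in> {?t u h | u h. u \<in> carrier (L2 M) \<and> h \<in> carrier (fin_sp I)}"
      using h by (intro CollectI exI[of _ "cls 1"] exI[of _ h]) (auto simp: L2_point)
    then show "h \<in> linear_span (fin_sp I) {?t u h | u h. u \<in> carrier (L2 M) \<and> h \<in> carrier (fin_sp I)}"
      unfolding linear_span_def by blast
  qed
  from span_closure[OF W.hilbert_space_axioms this]
  have cl: "norm_topology (fin_sp I) closure_of linear_span (fin_sp I)
      {?t u h | u h. u \<in> carrier (L2 M) \<and> h \<in> carrier (fin_sp I)} = carrier (fin_sp I)" .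
  show ?thesis
    unfolding hilbert_tensor_def
  proof (intro conjI ballI cl W.hilbert_space_axioms)
    show "linear_map (L2 M) (fin_sp I) (\<lambda>u. ?t u h)" if "h \<in> carrier (fin_sp I)" for h
      unfolding linear_map_def using that by (simp add: L2_point fin_sp_simps fun_eq_iff ring_distribs)
    show "linear_map (fin_sp I) (fin_sp I) (\<lambda>h. ?t u h)" for u
      unfolding linear_map_def by (simp add: fin_sp_simps fun_eq_iff ring_distribs)
    show "ip (fin_sp I) (?t u h) (?t u' h') = ip (L2 M) u u' * ip (fin_sp I) h h'" for u h u' h'
      by (simp add: L2_point fin_sp_simps sum_distrib_left mult_ac)
  qed
qed

definition diag_op :: "nat set \<Rightarrow> (nat \<Rightarrow> complex) \<Rightarrow> universe \<Rightarrow> universe" where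
  "diag_op I d = (\<lambda>h\<in>carrier (fin_sp I). \<lambda>i. d i * h i)"

lemma bounded_diag_op:
  assumes I: "finite I"
  shows "bounded_op (fin_sp I) (diag_op I d)"
proof -
  interpret F: finite_coordinates "fin_sp I" "\<lambda>f. f" I by (rule finite_coordinates_fin_sp[OF I])
  interpret W: hilbert_space "fin_sp I" by (rule hilbert_fin_sp[OF I])
  define C where "C = (\<Sum>i\<in>I. cmod (d i))"
  have C: "0 \<le> C" by (simp add: C_def sum_nonneg)
  have in_fin_sp: "diag_op I d h \<in> carrier (fin_sp I)" if "h \<in> carrier (fin_sp I)" for h
    using that by (simp add: diag_op_def fin_sp_simps)
  have "hnorm (fin_sp I) (diag_op I d h) \<le> C * hnorm (fin_sp I) h" if h: "h \<in> carrier (fin_sp I)" for h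
  proof -
    have "(hnorm (fin_sp I) (diag_op I d h))\<^sup>2 = (\<Sum>i\<in>I. (cmod (d i))\<^sup>2 * (cmod (h i))\<^sup>2)"
      unfolding F.hnorm_coord[OF in_fin_sp[OF h]] using h
      by (simp add: diag_op_def norm_mult power_mult_distrib)
    also have "\<dots> \<le> (\<Sum>i\<in>I. C\<^sup>2 * (cmod (h i))\<^sup>2)"
    proof (intro sum_mono mult_right_mono power_mono)
      show "cmod (d i) \<le> C" if "i \<in> I" for i
        unfolding C_def using that I by (intro member_le_sum) auto
    qed auto
    also have "\<dots> = (C * hnorm (fin_sp I) h)\<^sup>2"
      by (simp add: power_mult_distrib F.hnorm_coord[OF h] sum_distrib_left)
    finally show ?thesis by (rule power2_le_imp_le) (simp add: C h)
  qed
  then show ?thesis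
    unfolding bounded_op_def linear_map_def using in_fin_sp
    by (auto simp: diag_op_def fin_sp_simps algebra_simps)
qed

text \<open>Shared randomness with finitely many values is implemented by the state
  \<open>\<Sum>\<^sub>s \<surd>w\<^sub>s e\<^sub>s \<otimes> e\<^sub>s\<close>: both parties measure in the basis \<open>e\<^sub>s\<close> and answer \<open>x\<^sub>s\<close>.\<close>

lemma atomic_correlation_spatial:
  fixes x :: "nat \<Rightarrow> seq"
  assumes ucp: "\<Gamma> \<in> ucp_maps pt_fam pt_fam bin_fam bin_fam"
    and x: "\<And>i. x i \<in> topspace (Omega bin_fam)"
    and w: "\<And>i. 0 \<le> w i" "(\<Sum>i<N. w i) = 1"
    and \<Gamma>: "\<And>h. h \<in> carrier (cont_fun Omega_AB) \<Longrightarrow>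
      \<Gamma> h = ae_class mu_XY (\<lambda>_. \<Sum>i<N. of_real (w i) * h (x i, x i))"
  shows "\<Gamma> \<in> C_qs pt_fam pt_fam bin_fam bin_fam"
proof -
  let ?I = "{..<N}"
  let ?H = "fin_sp ?I"
  let ?K = "fin_sp_prod ?I ?I"
  have fin: "finite ?I" by simp
  interpret PM: point_measure "mu pt_fam" base_pt by (rule point_measure_mu)
  interpret mu_XY: point_measure mu_XY "(base_pt, base_pt)" by (rule point_measure_mu_XY)
  let ?tX = "\<lambda>(u :: (seq \<Rightarrow> complex) set) (h :: universe) i. rep u base_pt * h i"
  have tX: "hilbert_tensor (L2 (mu pt_fam)) ?H ?H ?tX" by (rule PM.hilbert_tensor_L2_fin_sp[OF fin])
  interpret P: point_tensor "mu pt_fam" base_pt ?H ?H ?tX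
    by (rule point_tensorI[OF point_measure_mu hilbert_fin_sp[OF fin] tX])
  have t: "hilbert_tensor ?H ?H ?K fin_sp_tensor" by (rule hilbert_tensor_fin_sp[OF fin fin])
  interpret HK: hilbert_space ?K using t by (simp add: hilbert_tensor_def)
  interpret T: tensor_product ?H ?H ?K fin_sp_tensor by unfold_locales (rule t)
  define \<Phi> where "\<Phi> = (\<lambda>f :: seq \<Rightarrow> complex. diag_op ?I (\<lambda>i. f (x i)))"
  define e :: "nat \<Rightarrow> universe" where "e = (\<lambda>s i. if i = s \<and> s < N then 1 else 0)"
  define a :: "nat \<Rightarrow> universe" where "a = (\<lambda>s i. of_real (sqrt (w s)) * e s i)"
  have e: "e s \<in> carrier ?H" "a s \<in> carrier ?H" for s by (auto simp: e_def a_def fin_sp_simps)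
  have ip_e: "ip ?H (\<lambda>i. c i * e s i) (\<lambda>i. d i * e s' i) = (if s = s' \<and> s < N then c s * cnj (d s) else 0)" for c d s s'
  proof (cases "s = s' \<and> s < N")
    case True
    have "ip ?H (\<lambda>i. c i * e s i) (\<lambda>i. d i * e s' i) = (\<Sum>i<N. if i = s then c s * cnj (d s) else 0)"
      unfolding fin_sp_simps using True by (intro sum.cong) (auto simp: e_def)
    then show ?thesis using True by simp
  next
    case False
    then show ?thesis unfolding fin_sp_simps by (auto simp: e_def intro!: sum.neutral)
  qed
  define \<xi> where "\<xi> = T.tsum a e N"
  have \<xi>: "\<xi> \<in> carrier ?K" unfolding \<xi>_def using e by simp
  have sqrtw: "complex_of_real (sqrt (w i)) * complex_of_real (sqrt (w i)) = of_real (w i)" for i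
    using w(1)[of i] by (simp flip: of_real_mult)
  have form: "ip ?K (T.tsum (\<lambda>s. diag_op ?I c (a s)) (\<lambda>s. diag_op ?I d (e s)) N) \<xi>
      = (\<Sum>s<N. of_real (w s) * (c s * d s))" for c d
  proof -
    have da: "diag_op ?I c (a s) = (\<lambda>i. (c i * of_real (sqrt (w s))) * e s i)" for s
      using e by (simp add: diag_op_def a_def mult.assoc)
    have de: "diag_op ?I d (e s) = (\<lambda>i. d i * e s i)" for s using e by (simp add: diag_op_def)
    have in1: "diag_op ?I c (a s) \<in> carrier ?H" "diag_op ?I d (e s) \<in> carrier ?H" for s
      using P.K.bounded_op_in[OF bounded_diag_op[OF fin]] e by blast+
    have "ip ?K (T.tsum (\<lambda>s. diag_op ?I c (a s)) (\<lambda>s. diag_op ?I d (e s)) N) \<xi>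
        = (\<Sum>s<N. \<Sum>s'<N. ip ?H (diag_op ?I c (a s)) (a s') * ip ?H (diag_op ?I d (e s)) (e s'))"
      unfolding \<xi>_def by (rule T.ip_tsum) (use in1 e in auto)
    also have "\<dots> = (\<Sum>s<N. \<Sum>s'<N. if s = s' then of_real (w s) * (c s * d s) else 0)"
    proof (intro sum.cong refl)
      fix s s' assume s: "s \<in> ?I" "s' \<in> ?I"
      have "ip ?H (diag_op ?I c (a s)) (a s') = (if s = s' \<and> s < N then (c s * of_real (sqrt (w s))) * cnj (of_real (sqrt (w s'))) else 0)"
        unfolding da a_def[THEN fun_cong, of s'] by (rule ip_e)
      moreover have "ip ?H (diag_op ?I d (e s)) (e s') = (if s = s' \<and> s < N then d s * cnj 1 else 0)"
        unfolding de using ip_e[of d s "\<lambda>_. 1" s'] by simp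
      ultimately show "ip ?H (diag_op ?I c (a s)) (a s') * ip ?H (diag_op ?I d (e s)) (e s')
          = (if s = s' then of_real (w s) * (c s * d s) else 0)"
        using s sqrtw[of s'] by (simp add: mult_ac)
    qed
    also have "\<dots> = (\<Sum>s<N. of_real (w s) * (c s * d s))" by simp
    finally show ?thesis .
  qed
  have "hnorm ?K \<xi> = 1"
  proof -
    have "diag_op ?I (\<lambda>_. 1) (a s) = a s" "diag_op ?I (\<lambda>_. 1) (e s) = e s" for s
      using e by (simp_all add: diag_op_def)
    then have "ip ?K \<xi> \<xi> = (\<Sum>s<N. of_real (w s))"
      using form[of "\<lambda>_. 1" "\<lambda>_. 1"] by (simp add: \<xi>_def)
    also have "\<dots> = 1" using w(2) by (simp flip: of_real_sum)
    finally show ?thesis by (simp add: hnorm_def)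
  qed
  have compress_diag: "P.compress c (diag_op ?I d) = diag_op ?I (\<lambda>i. c * d i)" for c d
  proof (rule extensionalityI[of _ "carrier ?H"])
    fix h assume h: "h \<in> carrier ?H"
    have V: "P.V h = h" for h unfolding P.V_def by simp
    show "P.compress c (diag_op ?I d) h = diag_op ?I (\<lambda>i. c * d i) h"
    proof (rule P.K.ip_ext)
      show "P.compress c (diag_op ?I d) h \<in> carrier ?H"
        using P.K.bounded_op_in[OF P.bounded_compress[OF bounded_diag_op[OF fin]] h] .
      show "diag_op ?I (\<lambda>i. c * d i) h \<in> carrier ?H"
        using P.K.bounded_op_in[OF bounded_diag_op[OF fin] h] .
      fix z assume z: "z \<in> carrier ?H"
      show "ip ?H (P.compress c (diag_op ?I d) h) z = ip ?H (diag_op ?I (\<lambda>i. c * d i) h) z"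
        unfolding P.ip_compress[OF bounded_diag_op[OF fin] h z] V
        using h by (simp add: diag_op_def fin_sp_simps sum_distrib_left mult.assoc)
    qed
  qed (simp_all add: diag_op_def P.compress_def)
  have \<Phi>: "ucp (cont_fun (Omega bin_fam)) (vN_tensor (mu pt_fam) ?H ?H ?tX) \<Phi>"
    unfolding ucp_def linear_map_def
  proof (intro conjI ballI allI impI)
    show "\<Phi> \<in> carrier (cont_fun (Omega bin_fam)) \<rightarrow> carrier (vN_tensor (mu pt_fam) ?H ?H ?tX)"
      unfolding \<Phi>_def P.carrier_vN using bounded_diag_op[OF fin] by blast
    show "\<Phi> (f \<oplus>\<^bsub>cont_fun (Omega bin_fam)\<^esub> g) = \<Phi> f \<oplus>\<^bsub>vN_tensor (mu pt_fam) ?H ?H ?tX\<^esub> \<Phi> g" for f g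
      using x by (auto simp: \<Phi>_def vN_tensor_def bounded_ops_def cont_fun_def diag_op_def fin_sp_simps
          fun_eq_iff restrict_def algebra_simps)
    show "\<Phi> (c \<odot>\<^bsub>cont_fun (Omega bin_fam)\<^esub> f) = c \<odot>\<^bsub>vN_tensor (mu pt_fam) ?H ?H ?tX\<^esub> \<Phi> f" for c f
      using x by (auto simp: \<Phi>_def vN_tensor_def bounded_ops_def cont_fun_def diag_op_def fin_sp_simps
          fun_eq_iff restrict_def algebra_simps)
    show "\<Phi> \<one>\<^bsub>cont_fun (Omega bin_fam)\<^esub> = \<one>\<^bsub>vN_tensor (mu pt_fam) ?H ?H ?tX\<^esub>"
      using x by (auto simp: \<Phi>_def vN_tensor_def bounded_ops_def cont_fun_def diag_op_def fin_sp_simps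
          fun_eq_iff restrict_def)
    fix n and b :: "nat \<Rightarrow> nat \<Rightarrow> seq \<Rightarrow> complex"
    assume "(\<forall>i<n. \<forall>j<n. b i j \<in> carrier (cont_fun (Omega bin_fam))) \<and> mpos (cont_fun (Omega bin_fam)) n b"
    then have b: "psd n (\<lambda>i j. b i j (x l))" for l using x by (simp add: cont_fun_def)
    have "(\<Sum>i<n. \<Sum>j<n. ip ?H (\<Phi> (b i j) (\<eta> j)) (\<eta> i)) \<in> \<real>\<^sub>\<ge>\<^sub>0"
      if \<eta>: "\<And>i. i < n \<Longrightarrow> \<eta> i \<in> carrier ?H" for \<eta>
    proof -
      have "(\<Sum>i<n. \<Sum>j<n. ip ?H (\<Phi> (b i j) (\<eta> j)) (\<eta> i))
          = (\<Sum>i<n. \<Sum>j<n. \<Sum>l<N. cnj (\<eta> i l) * b i j (x l) * \<eta> j l)"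
        by (intro sum.cong refl) (simp add: \<Phi>_def diag_op_def \<eta> fin_sp_simps(5) mult_ac)
      also have "\<dots> = (\<Sum>i<n. \<Sum>l<N. \<Sum>j<n. cnj (\<eta> i l) * b i j (x l) * \<eta> j l)"
        by (rule sum.cong[OF refl], rule sum.swap)
      also have "\<dots> = (\<Sum>l<N. \<Sum>i<n. \<Sum>j<n. cnj (\<eta> i l) * b i j (x l) * \<eta> j l)"
        by (rule sum.swap)
      also have "\<dots> \<in> \<real>\<^sub>\<ge>\<^sub>0"
      proof -
        have "(\<Sum>i<n. \<Sum>j<n. cnj (\<eta> i l) * b i j (x l) * \<eta> j l) \<in> \<real>\<^sub>\<ge>\<^sub>0" for l
          using b[of l, unfolded psd_def, rule_format, of "\<lambda>i. \<eta> i l"] .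
        then show ?thesis by (simp add: complex_nonneg_Reals_iff sum_nonneg)
      qed
      finally show ?thesis .
    qed
    then show "mpos (vN_tensor (mu pt_fam) ?H ?H ?tX) n (\<lambda>i j. \<Phi> (b i j))"
      by (simp add: vN_tensor_def bounded_ops_def)
  qed
  have corr: "pairing mu_XY (\<lambda>(x, y). g\<^sub>1 x * g\<^sub>2 y) (\<Gamma> (\<lambda>(a, b)\<in>topspace Omega_AB. f\<^sub>1 a * f\<^sub>2 b))
      = ip ?K (tensor_op ?H ?H ?K fin_sp_tensor (slice_map (mu pt_fam) ?H ?H ?tX g\<^sub>1 (\<Phi> f\<^sub>1))
                (slice_map (mu pt_fam) ?H ?H ?tX g\<^sub>2 (\<Phi> f\<^sub>2)) \<xi>) \<xi>"
    if f: "f\<^sub>1 \<in> carrier (cont_fun (Omega bin_fam))" "f\<^sub>2 \<in> carrier (cont_fun (Omega bin_fam))" for f\<^sub>1 f\<^sub>2 g\<^sub>1 g\<^sub>2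
  proof -
    have sl: "slice_map (mu pt_fam) ?H ?H ?tX g (\<Phi> f) = diag_op ?I (\<lambda>i. g base_pt * f (x i))" for g f
      unfolding \<Phi>_def P.slice_map_eq[OF bounded_diag_op[OF fin]] by (rule compress_diag)
    have "ip ?K (tensor_op ?H ?H ?K fin_sp_tensor (slice_map (mu pt_fam) ?H ?H ?tX g\<^sub>1 (\<Phi> f\<^sub>1))
                (slice_map (mu pt_fam) ?H ?H ?tX g\<^sub>2 (\<Phi> f\<^sub>2)) \<xi>) \<xi>
        = (\<Sum>s<N. of_real (w s) * ((g\<^sub>1 base_pt * f\<^sub>1 (x s)) * (g\<^sub>2 base_pt * f\<^sub>2 (x s))))"
      unfolding sl form[symmetric] unfolding \<xi>_def
      by (subst T.tensor_op_tsum) (simp_all add: bounded_diag_op e)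
    moreover have "pairing mu_XY (\<lambda>(x, y). g\<^sub>1 x * g\<^sub>2 y) (\<Gamma> (\<lambda>(a, b)\<in>topspace Omega_AB. f\<^sub>1 a * f\<^sub>2 b))
        = g\<^sub>1 base_pt * g\<^sub>2 base_pt * (\<Sum>s<N. of_real (w s) * (f\<^sub>1 (x s) * f\<^sub>2 (x s)))"
      unfolding \<Gamma>[OF tensor_cont[OF f]] pairing_def using x by simp
    ultimately show ?thesis by (simp add: sum_distrib_left mult_ac)
  qed
  have "\<exists>(H :: universe inner_module) (K :: universe inner_module)
        (HK :: universe inner_module) t (XH :: universe inner_module) t\<^sub>X
        (YK :: universe inner_module) t\<^sub>Y \<xi> \<Phi> \<Psi>.
       separable_hilbert_space H \<and> separable_hilbert_space K \<and>
       hilbert_tensor H K HK t \<and>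
       hilbert_tensor (L2 (mu pt_fam)) H XH t\<^sub>X \<and> hilbert_tensor (L2 (mu pt_fam)) K YK t\<^sub>Y \<and>
       \<xi> \<in> carrier HK \<and> hnorm HK \<xi> = 1 \<and>
       ucp (cont_fun (Omega bin_fam)) (vN_tensor (mu pt_fam) H XH t\<^sub>X) \<Phi> \<and>
       ucp (cont_fun (Omega bin_fam)) (vN_tensor (mu pt_fam) K YK t\<^sub>Y) \<Psi> \<and>
       (\<forall>f\<^sub>1\<in>carrier (cont_fun (Omega bin_fam)). \<forall>f\<^sub>2\<in>carrier (cont_fun (Omega bin_fam)).
        \<forall>g\<^sub>1 g\<^sub>2. integrable (mu pt_fam) g\<^sub>1 \<and> integrable (mu pt_fam) g\<^sub>2 \<longrightarrow>
          pairing mu_XY (\<lambda>(x, y). g\<^sub>1 x * g\<^sub>2 y)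
            (\<Gamma> (\<lambda>(a, b)\<in>topspace Omega_AB. f\<^sub>1 a * f\<^sub>2 b))
          = ip HK (tensor_op H K HK t (slice_map (mu pt_fam) H XH t\<^sub>X g\<^sub>1 (\<Phi> f\<^sub>1))
                                      (slice_map (mu pt_fam) K YK t\<^sub>Y g\<^sub>2 (\<Psi> f\<^sub>2)) \<xi>) \<xi>)"
    by (rule exI[of _ ?H], rule exI[of _ ?H], rule exI[of _ ?K], rule exI[of _ fin_sp_tensor],
        rule exI[of _ ?H], rule exI[of _ ?tX], rule exI[of _ ?H], rule exI[of _ ?tX],
        rule exI[of _ \<xi>], rule exI[of _ \<Phi>], rule exI[of _ \<Phi>])
       (intro conjI ballI allI impI separable_fin_sp fin t tX \<xi> \<open>hnorm ?K \<xi> = 1\<close> \<Phi> corr)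
  with ucp show ?thesis unfolding C_qs_def by (intro CollectI conjI)
qed

section \<open>Convergence of the truncated correlations\<close>

text \<open>Keeping \<open>n\<close> random digits and replacing the others by \<open>1\<close> makes the answers finitely supported.\<close>

definition cut_off :: "nat \<Rightarrow> seq \<Rightarrow> seq" where
  "cut_off n a = (\<lambda>i. if i < n then a i else 1)"

lemma cut_in: "a \<in> topspace (Omega bin_fam) \<Longrightarrow> cut_off n a \<in> topspace (Omega bin_fam)"
  by (auto simp: cut_off_def topspace_Omega)

lemma space_mu_bin_fam: "space (mu bin_fam) = topspace (Omega bin_fam)"
  by (simp add: space_mu topspace_Omega)

lemma diagonal_cont:
  assumes h: "h \<in> carrier (cont_fun Omega_AB)"
  shows "continuous_map (Omega bin_fam) euclidean (\<lambda>a. h (a, a))"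
proof -
  have "continuous_map (Omega bin_fam) Omega_AB (\<lambda>a. (a, a))"
    by (intro continuous_map_pairedI) simp_all
  moreover have "continuous_map Omega_AB euclidean h" using h by (simp add: cont_fun_def)
  ultimately have "continuous_map (Omega bin_fam) euclidean (h \<circ> (\<lambda>a. (a, a)))"
    by (rule continuous_map_compose)
  then show ?thesis by (simp add: comp_def)
qed

lemma diagonal_bounded:
  assumes h: "h \<in> carrier (cont_fun Omega_AB)"
  shows "\<exists>B. \<forall>a\<in>topspace (Omega bin_fam). cmod (h (a, a)) \<le> B"
proof -
  have "compact_space (Omega bin_fam)"
    unfolding Omega_def by (simp add: compact_space_product_topology compact_space_discrete_topology)
  then have "compact ((\<lambda>a. h (a, a)) ` topspace (Omega bin_fam))"
    using image_compactin[OF _ diagonal_cont[OF h]] by (simp add: compact_space_def)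
  then have "bounded ((\<lambda>a. h (a, a)) ` topspace (Omega bin_fam))" by (rule compact_imp_bounded)
  then show ?thesis by (simp add: bounded_iff)
qed

lemma cut_limit:
  assumes h: "h \<in> carrier (cont_fun Omega_AB)" and a: "a \<in> topspace (Omega bin_fam)"
  shows "(\<lambda>n. h (cut_off n a, cut_off n a)) \<longlonglongrightarrow> h (a, a)"
proof -
  have "limitin (Omega bin_fam) (\<lambda>n. cut_off n a) a sequentially"
    unfolding Omega_def limitin_componentwise
  proof (intro conjI ballI)
    show "\<forall>\<^sub>F n in sequentially. cut_off n a \<in> topspace (product_topology (\<lambda>i. discrete_topology {1..mult_seq bin_fam i}) UNIV)"
      using cut_in[OF a] by (simp add: Omega_def)
    fix i
    have "\<forall>\<^sub>F n in sequentially. cut_off n a i = a i"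
      using eventually_gt_at_top[of i] by (rule eventually_mono) (simp add: cut_off_def)
    moreover have "a i \<in> {1..mult_seq bin_fam i}" using a by (auto simp: topspace_Omega mult_seq_const)
    ultimately show "limitin (discrete_topology {1..mult_seq bin_fam i}) (\<lambda>n. cut_off n a i) (a i) sequentially"
      unfolding limitin_def by (auto elim: eventually_mono)
  qed simp
  from continuous_map_limit[OF diagonal_cont[OF h] this] show ?thesis by (simp add: comp_def)
qed

lemma cut_expansion:
  fixes h :: "seq \<times> seq \<Rightarrow> complex"
  assumes a: "a \<in> topspace (Omega bin_fam)"
  shows "h (cut_off n a, cut_off n a) = (\<Sum>s\<in>words n. cylinder n s a * h (cut_off n s, cut_off n s))"
proof -
  have "cut_off n (restrict a {..<n}) = cut_off n a" by (auto simp: cut_off_def)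
  then show ?thesis using cylinder_expansion[OF a, of n "\<lambda>s. h (cut_off n s, cut_off n s)"] by simp
qed

lemma cut_integral:
  fixes h :: "seq \<times> seq \<Rightarrow> complex"
  shows "integrable (mu bin_fam) (\<lambda>a. h (cut_off n a, cut_off n a))"
    and "(LINT a|mu bin_fam. h (cut_off n a, cut_off n a)) = (\<Sum>s\<in>words n. of_real (1 / 2 ^ n) * h (cut_off n s, cut_off n s))"
proof -
  have e: "\<And>a. a \<in> space (mu bin_fam) \<Longrightarrow> h (cut_off n a, cut_off n a) = (\<Sum>s\<in>words n. cylinder n s a * h (cut_off n s, cut_off n s))"
    unfolding space_mu_bin_fam by (rule cut_expansion)
  have i: "integrable (mu bin_fam) (\<lambda>a. cylinder n s a * h (cut_off n s, cut_off n s))" if "s \<in> words n" for s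
    using cylinder_integral(3)[OF that] by simp
  have "integrable (mu bin_fam) (\<lambda>a. \<Sum>s\<in>words n. cylinder n s a * h (cut_off n s, cut_off n s))"
    by (rule Bochner_Integration.integrable_sum) (rule i)
  then show "integrable (mu bin_fam) (\<lambda>a. h (cut_off n a, cut_off n a))"
    by (subst Bochner_Integration.integrable_cong[OF refl e])
  have "(LINT a|mu bin_fam. h (cut_off n a, cut_off n a)) = (LINT a|mu bin_fam. (\<Sum>s\<in>words n. cylinder n s a * h (cut_off n s, cut_off n s)))"
    by (rule Bochner_Integration.integral_cong[OF refl e])
  also have "\<dots> = (\<Sum>s\<in>words n. LINT a|mu bin_fam. cylinder n s a * h (cut_off n s, cut_off n s))"
    by (rule Bochner_Integration.integral_sum) (rule i)
  also have "\<dots> = (\<Sum>s\<in>words n. of_real (1 / 2 ^ n) * h (cut_off n s, cut_off n s))"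
    using cylinder_integral(2) by simp
  finally show "(LINT a|mu bin_fam. h (cut_off n a, cut_off n a)) = (\<Sum>s\<in>words n. of_real (1 / 2 ^ n) * h (cut_off n s, cut_off n s))" .
qed

text \<open>A continuous function on the Cantor set is the pointwise limit of its cut-offs. As these depend on
  finitely many digits, they are measurable, so the limit is measurable for the product
  \<open>\<sigma>\<close>-algebra; boundedness by compactness allows dominated convergence.\<close>

lemma diagonal_integral:
  assumes h: "h \<in> carrier (cont_fun Omega_AB)"
  shows "integrable (mu bin_fam) (\<lambda>a. h (a, a))"
    and "(\<lambda>n. LINT a|mu bin_fam. h (cut_off n a, cut_off n a)) \<longlonglongrightarrow> (LINT a|mu bin_fam. h (a, a))"
proof -
  interpret P: prob_space "mu bin_fam" by (rule prob_space_mu) simp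
  obtain B where B: "\<And>a. a \<in> topspace (Omega bin_fam) \<Longrightarrow> cmod (h (a, a)) \<le> B"
    using diagonal_bounded[OF h] by blast
  have cutm: "(\<lambda>a. h (cut_off n a, cut_off n a)) \<in> borel_measurable (mu bin_fam)" for n
    using cut_integral(1)[of h n] by (rule borel_measurable_integrable)
  have m: "(\<lambda>a. h (a, a)) \<in> borel_measurable (mu bin_fam)"
    by (rule borel_measurable_LIMSEQ_metric[where f = "\<lambda>n a. h (cut_off n a, cut_off n a)", OF cutm]) (simp add: space_mu_bin_fam cut_limit[OF h])
  show "integrable (mu bin_fam) (\<lambda>a. h (a, a))"
    by (rule P.integrable_const_bound[OF _ m, of B], rule AE_I2) (simp add: space_mu_bin_fam B)
  show "(\<lambda>n. LINT a|mu bin_fam. h (cut_off n a, cut_off n a)) \<longlonglongrightarrow> (LINT a|mu bin_fam. h (a, a))"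
  proof (rule integral_dominated_convergence[OF m cutm, of "\<lambda>_. B"])
    show "integrable (mu bin_fam) (\<lambda>_. B)" by simp
    show "AE a in mu bin_fam. (\<lambda>n. h (cut_off n a, cut_off n a)) \<longlonglongrightarrow> h (a, a)"
      by (rule AE_I2) (simp add: space_mu_bin_fam cut_limit[OF h])
    show "AE a in mu bin_fam. norm (h (cut_off n a, cut_off n a)) \<le> B" for n
      by (rule AE_I2) (simp add: space_mu_bin_fam B cut_in)
  qed
qed

lemma integral_nonneg_Reals:
  fixes f :: "'x \<Rightarrow> complex"
  assumes "integrable M f" "\<And>x. x \<in> space M \<Longrightarrow> f x \<in> \<real>\<^sub>\<ge>\<^sub>0"
  shows "(LINT x|M. f x) \<in> \<real>\<^sub>\<ge>\<^sub>0"
proof -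
  have "Re (LINT x|M. f x) = (LINT x|M. Re (f x))" "Im (LINT x|M. f x) = (LINT x|M. Im (f x))"
    using integral_bounded_linear[OF bounded_linear_Re assms(1)]
      integral_bounded_linear[OF bounded_linear_Im assms(1)] by simp_all
  moreover have "0 \<le> (LINT x|M. Re (f x))"
    by (rule Bochner_Integration.integral_nonneg) (use assms(2) in \<open>simp add: complex_nonneg_Reals_iff\<close>)
  moreover have "(LINT x|M. Im (f x)) = (LINT x|M. 0)"
    by (rule Bochner_Integration.integral_cong) (use assms(2) in \<open>auto simp: complex_nonneg_Reals_iff\<close>)
  ultimately show ?thesis by (simp add: complex_nonneg_Reals_iff)
qed

lemma diagonal_ucp:
  assumes \<pi>: "\<And>a. a \<in> topspace (Omega bin_fam) \<Longrightarrow> \<pi> a \<in> topspace (Omega bin_fam)"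
    and int: "\<And>h. h \<in> carrier (cont_fun Omega_AB) \<Longrightarrow> integrable (mu bin_fam) (\<lambda>a. h (\<pi> a, \<pi> a))"
  shows "diagonal_corr \<pi> \<in> ucp_maps pt_fam pt_fam bin_fam bin_fam"
proof -
  interpret P: prob_space "mu bin_fam" by (rule prob_space_mu) simp
  interpret mu_XY: point_measure mu_XY "(base_pt, base_pt)" by (rule point_measure_mu_XY)
  define F where "F = (\<lambda>h. LINT a|mu bin_fam. (h (\<pi> a, \<pi> a) :: complex))"
  have D: "diagonal_corr \<pi> h = mu_XY.cls (F h)" if "h \<in> carrier (cont_fun Omega_AB)" for h
    using that by (simp add: diagonal_corr_def F_def)
  have top: "(\<pi> a, \<pi> a) \<in> topspace Omega_AB" if "a \<in> space (mu bin_fam)" for a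
    using \<pi> that by (simp add: space_mu_bin_fam)
  have Fcong: "F h = (LINT a|mu bin_fam. k a)" if "\<And>a. a \<in> space (mu bin_fam) \<Longrightarrow> h (\<pi> a, \<pi> a) = k a" for h k
    unfolding F_def using that by (intro Bochner_Integration.integral_cong) auto
  have C_add: "f \<oplus>\<^bsub>cont_fun Omega_AB\<^esub> g = (\<lambda>z\<in>topspace Omega_AB. f z + g z)" for f g by (rule cont_fun_add)
  have C_smult: "c \<odot>\<^bsub>cont_fun Omega_AB\<^esub> f = (\<lambda>z\<in>topspace Omega_AB. c * f z)" for c f by (simp add: cont_fun_def)
  have C_one: "\<one>\<^bsub>cont_fun Omega_AB\<^esub> = (\<lambda>z\<in>topspace Omega_AB. 1)" by (simp add: cont_fun_def)
  have in_smult: "c \<odot>\<^bsub>cont_fun Omega_AB\<^esub> f \<in> carrier (cont_fun Omega_AB)" if "f \<in> carrier (cont_fun Omega_AB)" for c f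
    unfolding C_smult
    by (rule restrict_cont, rule continuous_map_times) (use that in \<open>simp_all add: cont_fun_carrier\<close>)
  have F_add: "F (f \<oplus>\<^bsub>cont_fun Omega_AB\<^esub> g) = F f + F g"
    if "f \<in> carrier (cont_fun Omega_AB)" "g \<in> carrier (cont_fun Omega_AB)" for f g
  proof -
    have "F (f \<oplus>\<^bsub>cont_fun Omega_AB\<^esub> g) = (LINT a|mu bin_fam. f (\<pi> a, \<pi> a) + g (\<pi> a, \<pi> a))"
      by (rule Fcong) (use top in \<open>simp add: C_add\<close>)
    then show ?thesis using int that by (simp add: F_def)
  qed
  have F_smult: "F (c \<odot>\<^bsub>cont_fun Omega_AB\<^esub> f) = c * F f" if "f \<in> carrier (cont_fun Omega_AB)" for c f
  proof -
    have "F (c \<odot>\<^bsub>cont_fun Omega_AB\<^esub> f) = (LINT a|mu bin_fam. c * f (\<pi> a, \<pi> a))"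
      by (rule Fcong) (use top in \<open>simp add: C_smult\<close>)
    then show ?thesis by (simp add: F_def)
  qed
  have F_one: "F (\<one>\<^bsub>cont_fun Omega_AB\<^esub>) = 1"
  proof -
    have "F (\<one>\<^bsub>cont_fun Omega_AB\<^esub>) = (LINT a|mu bin_fam. 1)"
      by (rule Fcong) (use top in \<open>simp add: C_one\<close>)
    then show ?thesis by (simp add: P.prob_space)
  qed
  have Linf: "carrier (Linfty mu_XY) = range mu_XY.cls" "\<one>\<^bsub>Linfty mu_XY\<^esub> = mu_XY.cls 1"
    "u \<oplus>\<^bsub>Linfty mu_XY\<^esub> v = mu_XY.cls (rep u (base_pt, base_pt) + rep v (base_pt, base_pt))"
    "c \<odot>\<^bsub>Linfty mu_XY\<^esub> u = mu_XY.cls (c * rep u (base_pt, base_pt))"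
    "mpos (Linfty mu_XY) n b = psd n (\<lambda>i j. rep (b i j) (base_pt, base_pt))" for u v c n b
  proof -
    have "mu_XY.cls c \<in> ae_class mu_XY ` UNIV" for c by (rule image_eqI[of _ _ "\<lambda>_. c"]) auto
    then show "carrier (Linfty mu_XY) = range mu_XY.cls" unfolding Linfty_def by auto
  qed (simp_all add: Linfty_def)
  have "ucp (cont_fun Omega_AB) (Linfty mu_XY) (diagonal_corr \<pi>)"
    unfolding ucp_def linear_map_def
  proof (intro conjI ballI allI impI)
    show "diagonal_corr \<pi> \<in> carrier (cont_fun Omega_AB) \<rightarrow> carrier (Linfty mu_XY)"
      by (auto simp: D Linf)
    show "diagonal_corr \<pi> (f \<oplus>\<^bsub>cont_fun Omega_AB\<^esub> g) = diagonal_corr \<pi> f \<oplus>\<^bsub>Linfty mu_XY\<^esub> diagonal_corr \<pi> g"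
      if "f \<in> carrier (cont_fun Omega_AB)" "g \<in> carrier (cont_fun Omega_AB)" for f g
      unfolding D[OF that(1)] D[OF that(2)] D[OF cont_fun_add_in[OF that]] Linf F_add[OF that] by simp
    show "diagonal_corr \<pi> (c \<odot>\<^bsub>cont_fun Omega_AB\<^esub> f) = c \<odot>\<^bsub>Linfty mu_XY\<^esub> diagonal_corr \<pi> f"
      if "f \<in> carrier (cont_fun Omega_AB)" for c f
      unfolding D[OF that] D[OF in_smult[OF that]] Linf F_smult[OF that] by simp
    show "diagonal_corr \<pi> \<one>\<^bsub>cont_fun Omega_AB\<^esub> = \<one>\<^bsub>Linfty mu_XY\<^esub>"
      unfolding D[OF cont_fun_one_in] Linf F_one ..
    fix n and b :: "nat \<Rightarrow> nat \<Rightarrow> seq \<times> seq \<Rightarrow> complex"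
    assume "(\<forall>i<n. \<forall>j<n. b i j \<in> carrier (cont_fun Omega_AB)) \<and> mpos (cont_fun Omega_AB) n b"
    then have b: "\<And>i j. i < n \<Longrightarrow> j < n \<Longrightarrow> b i j \<in> carrier (cont_fun Omega_AB)"
      and pos: "\<And>z. z \<in> topspace Omega_AB \<Longrightarrow> psd n (\<lambda>i j. b i j z)" by (auto simp: cont_fun_def)
    have "(\<Sum>i<n. \<Sum>j<n. cnj (c i) * rep (diagonal_corr \<pi> (b i j)) (base_pt, base_pt) * c j) \<in> \<real>\<^sub>\<ge>\<^sub>0" for c
    proof -
      have i1: "integrable (mu bin_fam) (\<lambda>a. cnj (c i) * b i j (\<pi> a, \<pi> a) * c j)" if "i < n" "j < n" for i j
        using int[OF b[OF that]] by simp
      have "(\<Sum>i<n. \<Sum>j<n. cnj (c i) * rep (diagonal_corr \<pi> (b i j)) (base_pt, base_pt) * c j)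
          = (\<Sum>i<n. \<Sum>j<n. LINT a|mu bin_fam. cnj (c i) * b i j (\<pi> a, \<pi> a) * c j)"
        by (intro sum.cong refl) (simp add: D b F_def)
      also have "\<dots> = (\<Sum>i<n. LINT a|mu bin_fam. (\<Sum>j<n. cnj (c i) * b i j (\<pi> a, \<pi> a) * c j))"
        by (intro sum.cong refl Bochner_Integration.integral_sum[symmetric] i1) auto
      also have "\<dots> = (LINT a|mu bin_fam. (\<Sum>i<n. \<Sum>j<n. cnj (c i) * b i j (\<pi> a, \<pi> a) * c j))"
        by (intro Bochner_Integration.integral_sum[symmetric] Bochner_Integration.integrable_sum i1) auto
      also have "\<dots> \<in> \<real>\<^sub>\<ge>\<^sub>0"
      proof (rule integral_nonneg_Reals)
        show "integrable (mu bin_fam) (\<lambda>a. \<Sum>i<n. \<Sum>j<n. cnj (c i) * b i j (\<pi> a, \<pi> a) * c j)"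
          by (intro Bochner_Integration.integrable_sum i1) auto
        show "(\<Sum>i<n. \<Sum>j<n. cnj (c i) * b i j (\<pi> a, \<pi> a) * c j) \<in> \<real>\<^sub>\<ge>\<^sub>0" if "a \<in> space (mu bin_fam)" for a
          using pos[OF top[OF that], unfolded psd_def] by blast
      qed
      finally show ?thesis .
    qed
    then show "mpos (Linfty mu_XY) n (\<lambda>i j. diagonal_corr \<pi> (b i j))"
      unfolding Linf psd_def by blast
  qed
  then show ?thesis by (simp add: ucp_maps_def diagonal_corr_def)
qed

lemma diagonal_id_ucp: "diagonal_corr id \<in> ucp_maps pt_fam pt_fam bin_fam bin_fam"
  by (rule diagonal_ucp) (simp_all add: diagonal_integral(1))

lemma diagonal_cut_spatial: "diagonal_corr (cut_off n) \<in> C_qs pt_fam pt_fam bin_fam bin_fam"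
proof -
  define N where "N = card (words n)"
  obtain f where f: "bij_betw f {0..<N} (words n)"
    using ex_bij_betw_nat_finite[OF finite_words] unfolding N_def by blast
  then have f: "bij_betw f {..<N} (words n)" by (simp add: atLeast0LessThan)
  define x where "x = (\<lambda>i. if i < N then cut_off n (f i) else base_pt)"
  have N: "real N = 2 ^ n" by (simp add: N_def card_words)
  show ?thesis
  proof (rule atomic_correlation_spatial)
    show "diagonal_corr (cut_off n) \<in> ucp_maps pt_fam pt_fam bin_fam bin_fam"
      by (rule diagonal_ucp) (simp_all only: cut_in cut_integral(1))
    show "x i \<in> topspace (Omega bin_fam)" for i
    proof (cases "i < N")
      case True
      then have "f i \<in> words n" using f by (auto simp: bij_betw_def)
      then have "f i j \<in> {1..2}" if "j < n" for j using PiE_mem that unfolding words_def by blast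
      then show ?thesis using True by (auto simp: x_def cut_off_def topspace_Omega)
    qed (simp add: x_def base_pt_def topspace_Omega)
    show "0 \<le> 1 / (2::real) ^ n" "(\<Sum>i<N. 1 / 2 ^ n) = (1::real)" using N by simp_all
    fix h assume h: "h \<in> carrier (cont_fun Omega_AB)"
    have "(LINT a|mu bin_fam. h (cut_off n a, cut_off n a)) = (\<Sum>s\<in>words n. of_real (1 / 2 ^ n) * h (cut_off n s, cut_off n s))"
      by (rule cut_integral(2))
    also have "\<dots> = (\<Sum>i<N. of_real (1 / 2 ^ n) * h (cut_off n (f i), cut_off n (f i)))"
      by (rule sum.reindex_bij_betw[OF f, symmetric])
    also have "\<dots> = (\<Sum>i<N. of_real (1 / 2 ^ n) * h (x i, x i))"
      by (intro sum.cong refl) (simp add: x_def)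
    finally show "diagonal_corr (cut_off n) h = ae_class mu_XY (\<lambda>_. \<Sum>i<N. of_real (1 / 2 ^ n) * h (x i, x i))"
      using h by (simp only: diagonal_corr_def restrict_apply if_True)
  qed
qed

text \<open>After pairing with an integrable function, BW convergence is the convergence of integrals just
  proved.\<close>

lemma diagonal_cut_limit:
  "limitin (BW_topology pt_fam pt_fam bin_fam bin_fam) (\<lambda>n. diagonal_corr (cut_off n)) (diagonal_corr id) sequentially"
proof -
  interpret mu_XY: point_measure mu_XY "(base_pt, base_pt)" by (rule point_measure_mu_XY)
  let ?I = "carrier (cont_fun Omega_AB) \<times> {g :: seq \<times> seq \<Rightarrow> complex. integrable mu_XY g}"
  let ?F = "\<lambda>\<Gamma>. \<lambda>(h, g)\<in>?I. pairing mu_XY g (\<Gamma> h)"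
  have in_ucp: "diagonal_corr (cut_off n) \<in> ucp_maps pt_fam pt_fam bin_fam bin_fam" for n
    using diagonal_cut_spatial by (simp add: C_qs_def)
  have lim: "limitin (product_topology (\<lambda>_. euclidean) ?I) (\<lambda>n. ?F (diagonal_corr (cut_off n))) (?F (diagonal_corr id)) sequentially"
    unfolding limitin_componentwise
  proof (intro conjI ballI)
    fix k assume k: "k \<in> ?I"
    obtain h g where kk: "k = (h, g)" and h: "h \<in> carrier (cont_fun Omega_AB)" using k by auto
    have e: "?F (diagonal_corr \<pi>) k = g (base_pt, base_pt) * (LINT a|mu bin_fam. h (\<pi> a, \<pi> a))" for \<pi>
      using k h by (simp add: kk pairing_def diagonal_corr_def)
    have "(\<lambda>n. ?F (diagonal_corr (cut_off n)) k) \<longlonglongrightarrow> ?F (diagonal_corr id) k"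
      unfolding e using diagonal_integral(2)[OF h] by (intro tendsto_mult tendsto_const) simp
    then show "limitin euclidean (\<lambda>n. ?F (diagonal_corr (cut_off n)) k) (?F (diagonal_corr id) k) sequentially"
      by simp
  qed auto
  show ?thesis
    unfolding limitin_def
  proof (intro conjI allI impI)
    show "diagonal_corr id \<in> topspace (BW_topology pt_fam pt_fam bin_fam bin_fam)"
      using diagonal_id_ucp by (simp add: topspace_BW_topology)
    fix U assume U: "openin (BW_topology pt_fam pt_fam bin_fam bin_fam) U \<and> diagonal_corr id \<in> U"
    then obtain O' where O': "openin (product_topology (\<lambda>_. euclidean) ?I) O'"
      "U = ?F -` O' \<inter> ucp_maps pt_fam pt_fam bin_fam bin_fam"
      unfolding BW_topology_def Let_def openin_pullback_topology by blast
    then have "?F (diagonal_corr id) \<in> O'" using U by blast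
    with lim O'(1) have "\<forall>\<^sub>F n in sequentially. ?F (diagonal_corr (cut_off n)) \<in> O'"
      unfolding limitin_def by blast
    then show "\<forall>\<^sub>F n in sequentially. diagonal_corr (cut_off n) \<in> U"
      by (rule eventually_mono) (use in_ucp O'(2) in blast)
  qed
qed

theorem corollary5p17:
  shows "\<exists>X Y A B. inductive_family X \<and> inductive_family Y \<and> inductive_family A \<and> inductive_family B \<and>
           \<not> closedin (BW_topology X Y A B) (C_qs X Y A B)"
proof (intro exI conjI notI)
  show "inductive_family pt_fam" unfolding pt_fam_def by (rule inductive_family_const) simp
  then show "inductive_family pt_fam" .
  show "inductive_family bin_fam" by (rule inductive_family_const) simp
  then show "inductive_family bin_fam" .
  assume "closedin (BW_topology pt_fam pt_fam bin_fam bin_fam) (C_qs pt_fam pt_fam bin_fam bin_fam)"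
  then have "diagonal_corr id \<in> C_qs pt_fam pt_fam bin_fam bin_fam"
    by (rule limitin_closedin[OF diagonal_cut_limit]) (simp_all add: diagonal_cut_spatial)
  then show False using diagonal_not_spatial by blast
qed

end
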